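(* Let $\mathcal M(R,F)$ be a quantum matrix algebra of BMW type with parameters $q,\mu$, and let $n\ge 1$. (i) If $j_q\neq 0$ and $\mu\neq -q^{3-2j}$ for all $j=2,\dots,n$ (so that $a_0,\dots,a_n$ are defined), then $$\sum_{i=0}^{n-1}(-q)^i\,a_i\,p_{n-i}=(-1)^{n-1}n_q\,a_n+(-1)^n\sum_{i=1}^{\lfloor n/2\rfloor}\bigl(\mu q^{n-2i}-q^{1-n+2i}\bigr)\,a_{n-2i}\,g^i .$$ (ii) If $j_q\neq 0$ and $\mu\neq q^{2j-3}$ for all $j=2,\dots,n$ (so that $s_0,\dots,s_n$ are defined), then $$\sum_{i=0}^{n-1}q^{-i}\,s_i\,p_{n-i}=n_q\,s_n+\sum_{i=1}^{\lfloor n/2\rfloor}\bigl(\mu q^{2i-n}+q^{n-2i-1}\bigr)\,s_{n-2i}\,g^i .$$ (iii) If both families $\{a_i\}_{i=0}^n$ and $\{s_i\}_{i=0}^n$ are defined, then for every $0\le m\le n$ $$\sum_{i=0}^{m}(-1)^i a_i\,s_{m-i}=\delta_{m,0}-\delta_{m,2}\,g .$$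
   Context: Let $V$ be a complex vector space of dimension $N$ with a fixed basis, so operators on $V^{\otimes n}$ are matrices. For $X\in\mathrm{End}(V\otimes V)$, $X_{m}$ denotes the operator on $V^{\otimes n}$ acting as $X$ on tensor factors $m,m+1$ and as the identity elsewhere; for $Y\in\mathrm{End}(V)$, $Y_m$ acts as $Y$ on factor $m$. $P$ is the flip $u\otimes v\mapsto v\otimes u$; $\mathrm{Tr}_{(i)}$ is the partial trace over factor $i$. An operator $X\in\mathrm{End}(V\otimes V)$ is skew invertible if there is $\Psi_X$ with $\mathrm{Tr}_{(2)}X_{12}\Psi_{X,23}=\mathrm{Tr}_{(2)}\Psi_{X,12}X_{23}=P_{13}$; then $C_X:=\mathrm{Tr}_{(1)}\Psi_{X,12}$, $D_X:=\mathrm{Tr}_{(2)}\Psi_{X,12}$; $X$ is strictly skew invertible if moreover $C_X$ or $D_X$ is invertible. An R-matrix is an invertible $R\in\mathrm{End}(V\otimes V)$ with $R_1R_2R_1=R_2R_1R_2$. A pair $\{R,F\}$ is compatible if $R_1F_2F_1=F_2F_1R_2$ and $R_2F_1F_2=F_1F_2R_1$. Fix $q\in\mathbb C\setminus\{0,\pm1\}$, $\mu\in\mathbb C\setminus\{0,q,-q^{-1}\}$; $R$ is of BMW type if $(qI-R)(q^{-1}I+R)(\mu I-R)=0$ and $K:=\mu^{-1}(q-q^{-1})^{-1}(qI-R)(q^{-1}I+R)$ satisfies $K_2K_1=R_1^{\epsilon}R_2^{\epsilon}K_1$ ($\epsilon=\pm1$) and $K_1K_2K_1=K_1$. For skew invertible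 $R$ and $X$ a matrix over $V^{\otimes n}$ with entries in some linear space, the R-trace is $\mathrm{Tr}_{R,(i_1,\dots,i_k)}X:=\mathrm{Tr}_{(i_1,\dots,i_k)}(D_{R,i_1}\cdots D_{R,i_k}X)$, and $\mathrm{Tr}_R M=\mathrm{Tr}(D_RM)$. Braid group $\mathcal B_n$: generators $\sigma_1,\dots,\sigma_{n-1}$, relations $\sigma_i\sigma_{i+1}\sigma_i=\sigma_{i+1}\sigma_i\sigma_{i+1}$, $\sigma_i\sigma_j=\sigma_j\sigma_i$ ($|i-j|>1$). With $\kappa_i:=\frac{(q-\sigma_i)(q^{-1}+\sigma_i)}{\mu(q-q^{-1})}$, the BMW algebra $\mathcal W_n(q,\mu)$ is $\mathbb C\mathcal B_n$ modulo $\sigma_i\kappa_i=\kappa_i\sigma_i=\mu\kappa_i$, $\kappa_i\sigma_{i+1}^{\epsilon}\kappa_i=\mu^{-\epsilon}\kappa_i$ ($\epsilon=\pm1$). $\eta:=\frac{(q-\mu)(q^{-1}+\mu)}{\mu(q-q^{-1})}$; $i_q:=\frac{q^i-q^{-i}}{q-q^{-1}}$. Elements of $\mathcal W_n$ are viewed in $\mathcal W_m$, $m>n$, via $\sigma_i\mapsto\sigma_i$. Baxterized elements: $\sigma_i^{\varepsilon}(x):=1+\frac{x-1}{q-q^{-1}}\sigma_i+\frac{x-1}{\alpha_\varepsilon x+1}\kappa_i$, $\alpha_\varepsilon=-\varepsilon q^{-\varepsilon}\mu^{-1}$. Antisymmetrizers: $a^{(1)}=1$, $a^{(i+1)}=\frac{q^i}{(i+1)_q}a^{(i)}\sigma_i^{-}(q^{-2i})a^{(i)}$;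 symmetrizers: $s^{(1)}=1$, $s^{(i+1)}=\frac{q^{-i}}{(i+1)_q}s^{(i)}\sigma_i^{+}(q^{2i})s^{(i)}$. Quantum matrix algebra of BMW type: $\{R,F\}$ is a compatible pair of strictly skew invertible R-matrices with $R$ of BMW type. $\mathcal M(R,F)$ is the quotient of the free algebra $\mathbb C\langle 1,M_a^b\rangle_{1\le a,b\le N}$ by the entries of $R_1M_{\bar1}M_{\bar2}=M_{\bar1}M_{\bar2}R_1$, where $M=\|M_a^b\|$, $M_{\bar1}:=M_1$, $M_{\bar i}:=F_{i-1}M_{\overline{i-1}}F_{i-1}^{-1}$. $\rho_R:\sigma_i\mapsto R_i$ is a representation of $\mathcal W_n(q,\mu)$ on $V^{\otimes n}$ (with $\rho_R(\kappa_i)=K_i$). For $\alpha\in\mathcal W_n$: $ch(\alpha):=\mathrm{Tr}_{R,(1,\dots,n)}(M_{\bar1}\cdots M_{\bar n}\rho_R(\alpha))$. Define $p_0:=\mathrm{Tr}_R I$, $p_1:=\mathrm{Tr}_R M$, $p_i:=ch(\sigma_{i-1}\cdots\sigma_1)$ ($i\ge2$), $g:=\eta^{-1}ch(\kappa_1)$, $a_0=s_0=1$, $a_i:=ch(a^{(i)})$, $s_i:=ch(s^{(i)})$ for $i\ge1$ whenever defined. *)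

theory Defs
  imports Complex_Main
begin

text \<open>An operator (matrix) on V^{\<otimes>n}, with entries in some type 'b, is a function on
  multi-indices: lists of length n with entries < N. Factors are numbered from 1,
  list positions from 0. Only the entries at indices in idx N n are meaningful;
  equality of operators is op_eq.\<close>

type_synonym 'b op = "nat list \<Rightarrow> nat list \<Rightarrow> 'b"

definition idx :: "nat \<Rightarrow> nat \<Rightarrow> nat list set" where
  "idx N n = {xs. length xs = n \<and> set xs \<subseteq> {..<N}}"

definition op_eq :: "nat \<Rightarrow> nat \<Rightarrow> 'b op \<Rightarrow> 'b op \<Rightarrow> bool" where
  "op_eq N n X Y \<longleftrightarrow> (\<forall>I\<in>idx N n. \<forall>J\<in>idx N n. X I J = Y I J)"

definition mmul :: "nat \<Rightarrow> nat \<Rightarrow> ('b::semiring_0) op \<Rightarrow> 'b op \<Rightarrow> 'b op" where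
  "mmul N n X Y = (\<lambda>I J. \<Sum>K\<in>idx N n. X I K * Y K J)"

definition idop :: "('b::{zero,one}) op" where
  "idop = (\<lambda>I J. if I = J then 1 else 0)"

definition oadd :: "('b::plus) op \<Rightarrow> 'b op \<Rightarrow> 'b op" where
  "oadd X Y = (\<lambda>I J. X I J + Y I J)"

definition osmul :: "'b::times \<Rightarrow> 'b op \<Rightarrow> 'b op" where
  "osmul c X = (\<lambda>I J. c * X I J)"

definition mprod :: "nat \<Rightarrow> nat \<Rightarrow> ('b::semiring_1) op list \<Rightarrow> 'b op" where
  "mprod N n Xs = foldr (mmul N n) Xs idop"

definition at1 :: "nat \<Rightarrow> nat \<Rightarrow> ('b::{zero,one,times}) op \<Rightarrow> 'b op" where
  "at1 n m Y = (\<lambda>I J. Y [I!(m-1)] [J!(m-1)] *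
      (if (\<forall>k<n. k \<noteq> m-1 \<longrightarrow> I!k = J!k) then 1 else 0))"

definition at2 :: "nat \<Rightarrow> nat \<Rightarrow> ('b::{zero,one,times}) op \<Rightarrow> 'b op" where
  "at2 n m X = (\<lambda>I J. X [I!(m-1), I!m] [J!(m-1), J!m] *
      (if (\<forall>k<n. k \<noteq> m-1 \<and> k \<noteq> m \<longrightarrow> I!k = J!k) then 1 else 0))"

definition ptr :: "nat \<Rightarrow> nat \<Rightarrow> ('b::comm_monoid_add) op \<Rightarrow> 'b op" where
  "ptr N i X = (\<lambda>I J. \<Sum>k<N. X (take (i-1) I @ k # drop (i-1) I) (take (i-1) J @ k # drop (i-1) J))"

definition otr :: "nat \<Rightarrow> nat \<Rightarrow> ('b::comm_monoid_add) op \<Rightarrow> 'b" where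
  "otr N n X = (\<Sum>I\<in>idx N n. X I I)"

definition flip :: "complex op" where
  "flip = (\<lambda>I J. if I = [J!1, J!0] then 1 else 0)"

definition op_invertible :: "nat \<Rightarrow> nat \<Rightarrow> complex op \<Rightarrow> bool" where
  "op_invertible N n X \<longleftrightarrow> (\<exists>Y. op_eq N n (mmul N n X Y) idop \<and> op_eq N n (mmul N n Y X) idop)"

definition opinv :: "nat \<Rightarrow> nat \<Rightarrow> complex op \<Rightarrow> complex op" where
  "opinv N n X = (SOME Y. op_eq N n (mmul N n X Y) idop \<and> op_eq N n (mmul N n Y X) idop)"

text \<open>Tr_(2) X_12 Psi_23 = Tr_(2) Psi_12 X_23 = P_13 (the result being an operator on factors 1,3).\<close>
definition skew_inv_by :: "nat \<Rightarrow> complex op \<Rightarrow> complex op \<Rightarrow> bool" where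
  "skew_inv_by N X Psi \<longleftrightarrow>
     op_eq N 2 (ptr N 2 (mmul N 3 (at2 3 1 X) (at2 3 2 Psi))) flip \<and>
     op_eq N 2 (ptr N 2 (mmul N 3 (at2 3 1 Psi) (at2 3 2 X))) flip"

definition skew_invertible :: "nat \<Rightarrow> complex op \<Rightarrow> bool" where
  "skew_invertible N X \<longleftrightarrow> (\<exists>Psi. skew_inv_by N X Psi)"

definition PsiOf :: "nat \<Rightarrow> complex op \<Rightarrow> complex op" where
  "PsiOf N X = (SOME Psi. skew_inv_by N X Psi)"

definition Cop :: "nat \<Rightarrow> complex op \<Rightarrow> complex op" where
  "Cop N X = ptr N 1 (PsiOf N X)"

definition Dop :: "nat \<Rightarrow> complex op \<Rightarrow> complex op" where
  "Dop N X = ptr N 2 (PsiOf N X)"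

definition strictly_skew_invertible :: "nat \<Rightarrow> complex op \<Rightarrow> bool" where
  "strictly_skew_invertible N X \<longleftrightarrow> skew_invertible N X \<and>
     (op_invertible N 1 (Cop N X) \<or> op_invertible N 1 (Dop N X))"

definition R_matrix :: "nat \<Rightarrow> complex op \<Rightarrow> bool" where
  "R_matrix N R \<longleftrightarrow> op_invertible N 2 R \<and>
     op_eq N 3 (mmul N 3 (at2 3 1 R) (mmul N 3 (at2 3 2 R) (at2 3 1 R)))
               (mmul N 3 (at2 3 2 R) (mmul N 3 (at2 3 1 R) (at2 3 2 R)))"

definition compatible_pair :: "nat \<Rightarrow> complex op \<Rightarrow> complex op \<Rightarrow> bool" where
  "compatible_pair N R F \<longleftrightarrow>
     op_eq N 3 (mprod N 3 [at2 3 1 R, at2 3 2 F, at2 3 1 F]) (mprod N 3 [at2 3 2 F, at2 3 1 F, at2 3 2 R]) \<and>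
     op_eq N 3 (mprod N 3 [at2 3 2 R, at2 3 1 F, at2 3 2 F]) (mprod N 3 [at2 3 1 F, at2 3 2 F, at2 3 1 R])"

definition Kop :: "nat \<Rightarrow> complex \<Rightarrow> complex \<Rightarrow> complex op \<Rightarrow> complex op" where
  "Kop N q \<mu> R = osmul (1 / (\<mu> * (q - 1/q)))
     (mmul N 2 (oadd (osmul q idop) (osmul (-1) R)) (oadd (osmul (1/q) idop) R))"

definition BMW_type :: "nat \<Rightarrow> complex \<Rightarrow> complex \<Rightarrow> complex op \<Rightarrow> bool" where
  "BMW_type N q \<mu> R \<longleftrightarrow>
     op_eq N 2 (mprod N 2 [oadd (osmul q idop) (osmul (-1) R), oadd (osmul (1/q) idop) R,
                           oadd (osmul \<mu> idop) (osmul (-1) R)]) (\<lambda>I J. 0) \<and>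
     (let K = Kop N q \<mu> R; Ri = opinv N 2 R in
       op_eq N 3 (mmul N 3 (at2 3 2 K) (at2 3 1 K)) (mprod N 3 [at2 3 1 R, at2 3 2 R, at2 3 1 K]) \<and>
       op_eq N 3 (mmul N 3 (at2 3 2 K) (at2 3 1 K)) (mprod N 3 [at2 3 1 Ri, at2 3 2 Ri, at2 3 1 K]) \<and>
       op_eq N 3 (mprod N 3 [at2 3 1 K, at2 3 2 K, at2 3 1 K]) (at2 3 1 K))"

text \<open>The algebra M(R,F) is the quotient of the free algebra by the relations
  R_1 M_1bar M_2bar = M_1bar M_2bar R_1. We state identities in M(R,F) equivalently
  (universal property) as identities holding in every complex algebra A with an N x N
  matrix M over A satisfying these relations. A complex algebra is a ring 'a together
  with a unital ring homomorphism sc from the complex numbers into its centre.\<close>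

definition complex_algebra_map :: "(complex \<Rightarrow> 'a::ring_1) \<Rightarrow> bool" where
  "complex_algebra_map sc \<longleftrightarrow> sc 1 = 1 \<and> (\<forall>x y. sc (x + y) = sc x + sc y) \<and>
     (\<forall>x y. sc (x * y) = sc x * sc y) \<and> (\<forall>x a. sc x * a = a * sc x)"

definition cop :: "(complex \<Rightarrow> 'a) \<Rightarrow> complex op \<Rightarrow> 'a op" where
  "cop sc X = (\<lambda>I J. sc (X I J))"

fun Mbar :: "nat \<Rightarrow> (complex \<Rightarrow> 'a::ring_1) \<Rightarrow> complex op \<Rightarrow> (nat \<Rightarrow> nat \<Rightarrow> 'a) \<Rightarrow> nat \<Rightarrow> nat \<Rightarrow> 'a op" where
  "Mbar N sc F M n 0 = (\<lambda>I J. 0)"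
| "Mbar N sc F M n (Suc 0) = at1 n 1 (\<lambda>I J. M (I!0) (J!0))"
| "Mbar N sc F M n (Suc (Suc k)) =
     mprod N n [cop sc (at2 n (Suc k) F), Mbar N sc F M n (Suc k), cop sc (at2 n (Suc k) (opinv N 2 F))]"

definition QMA_rel :: "nat \<Rightarrow> (complex \<Rightarrow> 'a::ring_1) \<Rightarrow> complex op \<Rightarrow> complex op \<Rightarrow> (nat \<Rightarrow> nat \<Rightarrow> 'a) \<Rightarrow> bool" where
  "QMA_rel N sc R F M \<longleftrightarrow>
     op_eq N 2 (mprod N 2 [cop sc (at2 2 1 R), Mbar N sc F M 2 1, Mbar N sc F M 2 2])
               (mprod N 2 [Mbar N sc F M 2 1, Mbar N sc F M 2 2, cop sc (at2 2 1 R)])"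

text \<open>ch of an element alpha of W_n, given through X = rho_R(alpha):
  Tr_{R,(1..n)} (M_bar_1 ... M_bar_n X) = Tr(D_{R,1} ... D_{R,n} M_bar_1 ... M_bar_n X).\<close>
definition chX :: "nat \<Rightarrow> (complex \<Rightarrow> 'a::ring_1) \<Rightarrow> complex op \<Rightarrow> complex op \<Rightarrow> (nat \<Rightarrow> nat \<Rightarrow> 'a) \<Rightarrow> nat \<Rightarrow> complex op \<Rightarrow> 'a" where
  "chX N sc R F M n X = otr N n
     (mmul N n (cop sc (mprod N n (map (\<lambda>k. at1 n k (Dop N R)) [1..<n+1])))
       (mmul N n (mprod N n (map (Mbar N sc F M n) [1..<n+1])) (cop sc X)))"

definition qnum :: "complex \<Rightarrow> nat \<Rightarrow> complex" where
  "qnum q i = (q ^ i - (1/q) ^ i) / (q - 1/q)"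

definition eta :: "complex \<Rightarrow> complex \<Rightarrow> complex" where
  "eta q \<mu> = (q - \<mu>) * (1/q + \<mu>) / (\<mu> * (q - 1/q))"

text \<open>rho_R of the Baxterized element 1 + (x-1)/(q-q^{-1}) sigma_i + (x-1)/(alpha x + 1) kappa_i
  on V^{\<otimes>n}; rho_R(sigma_i) = R_i, rho_R(kappa_i) = K_i.\<close>
definition baxop :: "nat \<Rightarrow> nat \<Rightarrow> complex \<Rightarrow> complex \<Rightarrow> complex op \<Rightarrow> complex \<Rightarrow> complex \<Rightarrow> nat \<Rightarrow> complex op" where
  "baxop N n q \<mu> R \<alpha> x i = oadd idop (oadd (osmul ((x - 1) / (q - 1/q)) (at2 n i R))
                                     (osmul ((x - 1) / (\<alpha> * x + 1)) (at2 n i (Kop N q \<mu> R))))"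

text \<open>rho_R(a^{(i)}) on V^{\<otimes>n}: a^{(1)} = 1,
  a^{(i+1)} = q^i/(i+1)_q a^{(i)} sigma_i^-(q^{-2i}) a^{(i)}, alpha_- = q mu^{-1}.\<close>
fun Aop :: "nat \<Rightarrow> nat \<Rightarrow> complex \<Rightarrow> complex \<Rightarrow> complex op \<Rightarrow> nat \<Rightarrow> complex op" where
  "Aop N n q \<mu> R 0 = idop"
| "Aop N n q \<mu> R (Suc 0) = idop"
| "Aop N n q \<mu> R (Suc (Suc k)) = osmul (q ^ Suc k / qnum q (Suc (Suc k)))
     (mprod N n [Aop N n q \<mu> R (Suc k), baxop N n q \<mu> R (q / \<mu>) ((1/q) ^ (2 * Suc k)) (Suc k),
                 Aop N n q \<mu> R (Suc k)])"

text \<open>rho_R(s^{(i)}) on V^{\<otimes>n}: s^{(1)} = 1,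
  s^{(i+1)} = q^{-i}/(i+1)_q s^{(i)} sigma_i^+(q^{2i}) s^{(i)}, alpha_+ = -q^{-1} mu^{-1}.\<close>
fun Sop :: "nat \<Rightarrow> nat \<Rightarrow> complex \<Rightarrow> complex \<Rightarrow> complex op \<Rightarrow> nat \<Rightarrow> complex op" where
  "Sop N n q \<mu> R 0 = idop"
| "Sop N n q \<mu> R (Suc 0) = idop"
| "Sop N n q \<mu> R (Suc (Suc k)) = osmul ((1/q) ^ Suc k / qnum q (Suc (Suc k)))
     (mprod N n [Sop N n q \<mu> R (Suc k), baxop N n q \<mu> R (- 1 / (q * \<mu>)) (q ^ (2 * Suc k)) (Suc k),
                 Sop N n q \<mu> R (Suc k)])"

definition p_el :: "nat \<Rightarrow> (complex \<Rightarrow> 'a::ring_1) \<Rightarrow> complex op \<Rightarrow> complex op \<Rightarrow> (nat \<Rightarrow> nat \<Rightarrow> 'a) \<Rightarrow> nat \<Rightarrow> 'a" where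
  "p_el N sc R F M i = chX N sc R F M i (mprod N i (map (\<lambda>k. at2 i k R) (rev [1..<i])))"

definition g_el :: "nat \<Rightarrow> (complex \<Rightarrow> 'a::ring_1) \<Rightarrow> complex op \<Rightarrow> complex op \<Rightarrow> (nat \<Rightarrow> nat \<Rightarrow> 'a) \<Rightarrow> complex \<Rightarrow> complex \<Rightarrow> 'a" where
  "g_el N sc R F M q \<mu> = sc (1 / eta q \<mu>) * chX N sc R F M 2 (at2 2 1 (Kop N q \<mu> R))"

definition a_el :: "nat \<Rightarrow> (complex \<Rightarrow> 'a::ring_1) \<Rightarrow> complex op \<Rightarrow> complex op \<Rightarrow> (nat \<Rightarrow> nat \<Rightarrow> 'a) \<Rightarrow> complex \<Rightarrow> complex \<Rightarrow> nat \<Rightarrow> 'a" where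
  "a_el N sc R F M q \<mu> i = (if i = 0 then 1 else chX N sc R F M i (Aop N i q \<mu> R i))"

definition s_el :: "nat \<Rightarrow> (complex \<Rightarrow> 'a::ring_1) \<Rightarrow> complex op \<Rightarrow> complex op \<Rightarrow> (nat \<Rightarrow> nat \<Rightarrow> 'a) \<Rightarrow> complex \<Rightarrow> complex \<Rightarrow> nat \<Rightarrow> 'a" where
  "s_el N sc R F M q \<mu> i = (if i = 0 then 1 else chX N sc R F M i (Sop N i q \<mu> R i))"

end

theory Submission
  imports Defs
begin

text \<open>All computations take place in a ring that contains the coefficient algebra and a copy of \<open>Mat\<^sub>N\<close> for
  every strand. There the R-trace is compatible with the braidings, so \<open>ch\<close> is a trace on the BMW
  algebra and is multiplicative, \<open>ch(\<alpha>) ch(\<beta>) = ch(\<alpha> \<beta>\<up>)\<close>, where \<open>\<beta>\<up>\<close> is the shift of \<open>\<beta>\<close>. Everything else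
  is algebra: with \<open>T\<^sub>i = a\<^sub>i p\<^sub>n\<^sub>-\<^sub>i = ch(a\<^sup>(\<^sup>i\<^sup>) \<sigma>\<^sub>n\<^sub>-\<^sub>1 \<cdots> \<sigma>\<^sub>i\<^sub>+\<^sub>1)\<close>, \<open>U\<^sub>i = ch(a\<^sup>(\<^sup>i\<^sup>) \<sigma>\<^sub>n\<^sub>-\<^sub>1 \<cdots> \<sigma>\<^sub>i)\<close> and
  \<open>V\<^sub>i = ch(a\<^sup>(\<^sup>i\<^sup>) \<sigma>\<^sub>n\<^sub>-\<^sub>1 \<cdots> \<sigma>\<^sub>i\<^sub>+\<^sub>1 \<kappa>\<^sub>i)\<close>, the recursive definition of \<open>a\<^sup>(\<^sup>i\<^sup>+\<^sup>1\<^sup>)\<close> expresses \<open>T\<^sub>i\<close> through \<open>U\<^sub>i\<^sub>+\<^sub>1\<close>, \<open>U\<^sub>i\<close>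
  and \<open>V\<^sub>i\<close> and makes the sum telescope up to the \<open>V\<^sub>i\<close>. Removing the contraction turns \<open>V\<^sub>i\<close> into \<open>g\<close> times a
  combination of \<open>T\<^sub>i\<^sub>-\<^sub>1\<close>, \<open>U\<^sub>i\<^sub>-\<^sub>1\<close>, \<open>V\<^sub>i\<^sub>-\<^sub>1\<close> for \<open>n - 2\<close>, which telescopes again and gives an induction
  on \<open>n\<close>. The symmetric case is the antisymmetric one with \<open>q\<close> replaced by \<open>-1/q\<close>, and the Wronski relation
  follows from both Newton relations.\<close>

section \<open>Scalars and the relations of the BMW algebra\<close>

text \<open>The entries of M do not commute, so a trace over tensor powers of V is not cyclic in
  general; only factors with complex entries that commute with the product of the D's and with that
  of the M's may be carried round it. In a ring with infinitely many strands the algebras W_n lie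
  inside one another, a partial trace is an additive map of the ring into itself, and "does not
  involve strand k" becomes a commutation property. The Newton argument uses just three properties
  of \<open>ch\<close>: linearity, cyclicity for the generators, multiplicativity on words. That the
  second telescoping closes is not automatic: lowering V_(k+1) from m + 2 to m strands produces T_k,
  U_k and V_k again. Its coefficient at V_k matches the one in the recursion for U, so V_k can be
  eliminated, and what is left is a weighted T_k and a telescoping difference of U's. The conditions
  on q and \<mu> are denominators: j_q normalises the idempotents, and 1 + \<mu> q^(2j-3) divides
  the coefficient of the contraction.\<close>

lemma comm_mult: "x * a = a * x \<Longrightarrow> x * b = b * x \<Longrightarrow> x * (a * b) = (a * b) * (x :: 'e::semigroup_mult)"
  by (metis mult.assoc)

lemma comm_left: "x * a = a * x \<Longrightarrow> x * (a * z) = a * (x * (z :: 'e::semigroup_mult))"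
  by (metis mult.assoc)

lemma comm3: "x * a = a * x \<Longrightarrow> x * (a * y * z) = a * (x * y * (z :: 'e::semigroup_mult))"
  by (metis mult.assoc)

lemma idem_left: "x * x = x \<Longrightarrow> x * (x * z) = x * (z :: 'e::semigroup_mult)"
  by (metis mult.assoc)

lemma intertwine_mult: "d * (x::'e::semigroup_mult) = x' * d \<Longrightarrow> d * y = y' * d \<Longrightarrow> d * (x * y) = (x' * y') * d"
  by (metis mult.assoc)

locale complex_alg =
  fixes sw :: "complex \<Rightarrow> 'e::ring_1"
  assumes sw_map: "complex_algebra_map sw"
begin

definition sm :: "complex \<Rightarrow> 'e \<Rightarrow> 'e"  (infixr "\<odot>" 75) where "c \<odot> x = sw c * x"

lemma sw_1 [simp]: "sw 1 = 1"
  and sw_add: "sw (a + b) = sw a + sw b"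
  and sw_mult: "sw (a * b) = sw a * sw b"
  and sw_central: "sw a * x = x * sw a"
  using sw_map unfolding complex_algebra_map_def by blast+

lemma sw_0 [simp]: "sw 0 = 0"
  using sw_add[of 0 0] by simp

lemma sw_minus: "sw (- a) = - sw a"
  using sw_add[of a "- a"] by (simp add: eq_neg_iff_add_eq_0 add.commute)

lemma sw_diff: "sw (a - b) = sw a - sw b"
  using sw_add[of a "- b"] by (simp add: sw_minus)

lemma sw_sum: "sw (sum f A) = (\<Sum>x\<in>A. sw (f x))"
  by (induction A rule: infinite_finite_induct) (auto simp: sw_add)

lemma sm_mult_left [simp]: "(c \<odot> x) * y = c \<odot> (x * y)"
  by (simp add: sm_def mult.assoc)
lemma sm_mult_right [simp]: "x * (c \<odot> y) = c \<odot> (x * y)"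
  by (metis sm_def mult.assoc sw_central)
lemma sm_sm [simp]: "c \<odot> d \<odot> x = (c * d) \<odot> x"
  by (simp add: sm_def sw_mult mult.assoc)
lemma sm_1 [simp]: "1 \<odot> x = x" by (simp add: sm_def)
lemma sm_0 [simp]: "0 \<odot> x = 0" by (simp add: sm_def)
lemma sm_zero [simp]: "c \<odot> 0 = 0" by (simp add: sm_def)
lemma sm_minus_left [simp]: "(- c) \<odot> x = - (c \<odot> x)" by (simp add: sm_def sw_minus)
lemma sm_minus_right [simp]: "c \<odot> (- x) = - (c \<odot> x)" by (simp add: sm_def)
lemma sm_add_left: "(c + d) \<odot> x = c \<odot> x + d \<odot> x" by (simp add: sm_def sw_add distrib_right)
lemma sm_diff_left: "(c - d) \<odot> x = c \<odot> x - d \<odot> x" by (simp add: sm_def sw_diff left_diff_distrib)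
lemma sm_add_right: "c \<odot> (x + y) = c \<odot> x + c \<odot> y" by (simp add: sm_def distrib_left)
lemma sm_diff_right: "c \<odot> (x - y) = c \<odot> x - c \<odot> y" by (simp add: sm_def right_diff_distrib)
lemma sm_sum_right: "c \<odot> sum f A = (\<Sum>x\<in>A. c \<odot> f x)" by (simp add: sm_def sum_distrib_left)
lemma sm_sum_left: "sum f A \<odot> x = (\<Sum>y\<in>A. f y \<odot> x)" by (simp add: sm_def sw_sum sum_distrib_right)

lemmas sm_distribs = sm_add_left sm_diff_left sm_add_right sm_diff_right

lemma sm_cancel: "c \<noteq> 0 \<Longrightarrow> c \<odot> x = c \<odot> y \<longleftrightarrow> x = y"
  by (metis sm_1 sm_sm left_inverse)

end

text \<open>Here \<^term>\<open>S i\<close>, \<^term>\<open>Si i\<close> and \<^term>\<open>K i\<close> stand for \<open>\<sigma>\<^sub>i\<close>, its inverse and \<open>\<kappa>\<^sub>i\<close>.\<close>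

locale bmw = complex_alg sw for sw :: "complex \<Rightarrow> 'e::ring_1" +
  fixes q \<mu> :: complex and S Si K :: "nat \<Rightarrow> 'e"
  assumes q0: "q \<noteq> 0" and q2: "q \<noteq> 1" "q \<noteq> -1" and mu: "\<mu> \<noteq> 0" "\<mu> \<noteq> q" "\<mu> \<noteq> - (1/q)"
    and far: "1 \<le> i \<Longrightarrow> i + 2 \<le> j \<Longrightarrow> S i * S j = S j * S i"
    and braid: "1 \<le> i \<Longrightarrow> S i * S (i+1) * S i = S (i+1) * S i * S (i+1)"
    and quad: "1 \<le> i \<Longrightarrow> S i * S i = 1 + (q - 1/q) \<odot> S i - ((q - 1/q) * \<mu>) \<odot> K i"
    and SK: "1 \<le> i \<Longrightarrow> S i * K i = \<mu> \<odot> K i"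
    and S_Si: "1 \<le> i \<Longrightarrow> S i * Si i = 1" and Si_S: "1 \<le> i \<Longrightarrow> Si i * S i = 1"
    and KK0: "1 \<le> i \<Longrightarrow> K (i+1) * K i = S i * S (i+1) * K i"
    and KKi0: "1 \<le> i \<Longrightarrow> K (i+1) * K i = Si i * Si (i+1) * K i"
    and KKK0: "1 \<le> i \<Longrightarrow> K i * K (i+1) * K i = K i"
begin

definition lam :: complex where "lam = q - 1/q"

abbreviation adj :: "nat \<Rightarrow> nat \<Rightarrow> bool" where
  "adj i j \<equiv> 1 \<le> i \<and> 1 \<le> j \<and> (j = i + 1 \<or> i = j + 1)"

lemma lam_nz: "lam \<noteq> 0"
proof
  assume "lam = 0"
  then have "q * q = 1 * 1" using q0 by (simp add: lam_def field_simps)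
  then show False using q2 by (metis square_eq_iff)
qed

lemma quad': "1 \<le> i \<Longrightarrow> S i * S i = 1 + lam \<odot> S i - (lam * \<mu>) \<odot> K i"
  using quad by (simp add: lam_def)

lemma K_eq: "1 \<le> i \<Longrightarrow> K i = (1 / (lam * \<mu>)) \<odot> (1 + lam \<odot> S i - S i * S i)"
  using lam_nz mu by (simp add: quad')

text \<open>\<open>K i\<close> is a polynomial in \<open>S i\<close>, see \<open>K_eq\<close>; hence
  whatever carries \<open>S i\<close> to \<open>S j\<close> carries \<open>K i\<close> to
  \<open>K j\<close>.\<close>

lemma K_intertwine: assumes "1 \<le> i" "1 \<le> j" "x * S i = S j * x" shows "x * K i = K j * x"
proof -
  have "x * (S i * S i) = (S j * S j) * x"
    by (simp only: mult.assoc[symmetric] assms(3)) (simp only: mult.assoc assms(3))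
  then show ?thesis unfolding K_eq[OF assms(1)] K_eq[OF assms(2)]
    using assms(3) by (simp add: distrib_left distrib_right left_diff_distrib right_diff_distrib)
qed

lemma K_commI: "1 \<le> i \<Longrightarrow> x * S i = S i * x \<Longrightarrow> x * K i = K i * x"
  by (rule K_intertwine)

lemma Si_intertwine: assumes "1 \<le> i" "1 \<le> j" "x * S i = S j * x" shows "x * Si i = Si j * x"
proof -
  have "x * Si i = (Si j * S j) * x * Si i" using Si_S[OF assms(2)] by simp
  also have "\<dots> = Si j * (x * S i) * Si i" by (simp only: assms(3) mult.assoc)
  also have "\<dots> = Si j * x" using S_Si[OF assms(1)] by (simp add: mult.assoc)
  finally show ?thesis .
qed

lemma Si_commI: "1 \<le> i \<Longrightarrow> x * S i = S i * x \<Longrightarrow> x * Si i = Si i * x"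
  by (rule Si_intertwine)

lemma KS: "1 \<le> i \<Longrightarrow> K i * S i = \<mu> \<odot> K i"
  using K_commI[of i "S i"] SK by simp

lemma SiK: "1 \<le> i \<Longrightarrow> Si i * K i = (1/\<mu>) \<odot> K i"
proof -
  assume i: "1 \<le> i"
  have "K i = Si i * (S i * K i)" using Si_S[OF i] by (simp flip: mult.assoc)
  also have "\<dots> = \<mu> \<odot> (Si i * K i)" using SK[OF i] by simp
  finally have "(1/\<mu>) \<odot> K i = (1/\<mu>) \<odot> \<mu> \<odot> (Si i * K i)" by simp
  then show ?thesis using mu by simp
qed

lemma KSi: "1 \<le> i \<Longrightarrow> K i * Si i = (1/\<mu>) \<odot> K i"
  using Si_commI[of i "K i"] SK KS SiK by simp

lemma Si_eq: "1 \<le> i \<Longrightarrow> Si i = S i - lam \<odot> 1 + lam \<odot> K i"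
proof -
  assume i: "1 \<le> i"
  have "Si i * (S i * S i) = Si i * (1 + lam \<odot> S i - (lam * \<mu>) \<odot> K i)" using quad'[OF i] by simp
  then have "S i = Si i + lam \<odot> 1 - lam \<odot> K i"
    using Si_S[OF i] SiK[OF i] mu by (simp add: distrib_left right_diff_distrib flip: mult.assoc)
  then show ?thesis by (simp add: algebra_simps)
qed

lemma far': "1 \<le> i \<Longrightarrow> 1 \<le> j \<Longrightarrow> i + 2 \<le> j \<or> j + 2 \<le> i \<Longrightarrow> S i * S j = S j * S i"
  using far[of i j] far[of j i] by auto

lemma braid': "adj i j \<Longrightarrow> S i * S j * S i = S j * S i * S j"
  using braid[of i] braid[of j] by auto

lemma half_twist: assumes "adj i j" shows "(S i * S j * S i) * S i = S j * (S i * S j * S i)"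
    "(S i * S j * S i) * S j = S i * (S i * S j * S i)"
  using braid'[OF assms] by (simp_all add: mult.assoc) (simp_all flip: mult.assoc)

lemma Si_cancel [simp]: "1 \<le> i \<Longrightarrow> S i * (Si i * x) = x" "1 \<le> i \<Longrightarrow> Si i * (S i * x) = x"
  using S_Si[of i] Si_S[of i] by (simp_all flip: mult.assoc)

lemma half_twist_cancel:
  assumes "adj i j" "x * (S i * S j * S i) = y * (S i * S j * S i)" shows "x = y"
proof -
  let ?D = "S i * S j * S i" and ?Di = "Si i * Si j * Si i"
  have D: "?D * ?Di = 1" using assms(1) S_Si[of i] by (auto simp: mult.assoc)
  have "x = (x * ?D) * ?Di" using D by (simp only: mult.assoc mult.right_neutral)
  also have "\<dots> = y" using D by (simp only: assms(2)) (simp only: mult.assoc mult.right_neutral)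
  finally show ?thesis .
qed

text \<open>Conjugation by the half twist exchanges the two generators and so mirrors every relation.\<close>

lemma twistK: assumes "adj i j" shows "(S i * S j * S i) * K i = K j * (S i * S j * S i)"
  and "(S i * S j * S i) * K j = K i * (S i * S j * S i)"
  using assms by (auto intro!: K_intertwine half_twist)

lemma twistSi: assumes "adj i j" shows "(S i * S j * S i) * Si i = Si j * (S i * S j * S i)"
  and "(S i * S j * S i) * Si j = Si i * (S i * S j * S i)"
  using assms by (auto intro!: Si_intertwine half_twist)

text \<open>The locale assumes this for j = i + 1 only. For i = j + 1 it is the half-twist conjugate
  of the assumed relation; \<open>KKSi\<close> and \<open>KKK\<close> are obtained in the same
  way.\<close>

lemma KKS: assumes a: "adj i j" shows "K j * K i = S i * S j * K i"
proof (cases "j = i + 1")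
  case True then show ?thesis using KK0[of i] a by simp
next
  case False
  then have e: "i = j + 1" using a by auto
  let ?D = "S j * S i * S j"
  have ji: "adj j i" using a by auto
  have h: "K i * K j = S j * S i * K j" using KK0[of j] e a by simp
  have "?D * (K i * K j) = (K j * K i) * ?D"
    by (intro intertwine_mult twistK[OF ji] twistSi[OF ji] half_twist[OF ji])
  moreover have "?D * (S j * S i * K j) = (S i * S j * K i) * ?D"
    by (intro intertwine_mult twistK[OF ji] twistSi[OF ji] half_twist[OF ji])
  ultimately show ?thesis using half_twist_cancel[OF ji] h by metis
qed

lemma KKSi: assumes a: "adj i j" shows "K j * K i = Si i * Si j * K i"
proof (cases "j = i + 1")
  case True then show ?thesis using KKi0[of i] a by simp
next
  case False
  then have e: "i = j + 1" using a by auto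
  let ?D = "S j * S i * S j"
  have ji: "adj j i" using a by auto
  have h: "K i * K j = Si j * Si i * K j" using KKi0[of j] e a by simp
  have "?D * (K i * K j) = (K j * K i) * ?D"
    by (intro intertwine_mult twistK[OF ji] twistSi[OF ji] half_twist[OF ji])
  moreover have "?D * (Si j * Si i * K j) = (Si i * Si j * K i) * ?D"
    by (intro intertwine_mult twistK[OF ji] twistSi[OF ji] half_twist[OF ji])
  ultimately show ?thesis using half_twist_cancel[OF ji] h by metis
qed

lemma KKK: assumes a: "adj i j" shows "K i * K j * K i = K i"
proof (cases "j = i + 1")
  case True then show ?thesis using KKK0[of i] a by simp
next
  case False
  then have e: "i = j + 1" using a by auto
  let ?D = "S j * S i * S j"
  have ji: "adj j i" using a by auto
  have h: "K j * K i * K j = K j" using KKK0[of j] e a by simp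
  have "?D * (K j * K i * K j) = (K i * K j * K i) * ?D"
    by (intro intertwine_mult twistK[OF ji] twistSi[OF ji] half_twist[OF ji])
  moreover have "?D * (K j) = (K i) * ?D"
    by (intro intertwine_mult twistK[OF ji] twistSi[OF ji] half_twist[OF ji])
  ultimately show ?thesis using half_twist_cancel[OF ji] h by metis
qed

text \<open>By the braid relation \<open>S i * S j\<close> carries \<open>S i\<close> to
  \<open>S j\<close>, hence also \<open>K i\<close> to \<open>K j\<close>.\<close>

lemma SSK: assumes "adj i j" shows "S i * S j * K i = K j * S i * S j"
proof -
  have "(S i * S j) * K i = K j * (S i * S j)"
    using assms braid'[OF assms] by (intro K_intertwine) (auto simp: mult.assoc)
  then show ?thesis by (simp add: mult.assoc)
qed

lemma SSKi: assumes "adj i j" shows "Si i * Si j * K i = K j * Si i * Si j"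
proof -
  have *: "K i * (S j * S i) = S j * S i * K j" using SSK[of j i] assms by (auto simp: mult.assoc)
  have "Si i * Si j * K i = Si i * Si j * (K i * (S j * S i)) * (Si i * Si j)"
    using assms S_Si[of j] by (auto simp: mult.assoc)
  also have "\<dots> = K j * Si i * Si j"
    unfolding * using assms by (auto simp: mult.assoc)
  finally show ?thesis .
qed

lemma KKS': "adj i j \<Longrightarrow> K j * K i = K j * S i * S j"
  using KKS SSK by simp
lemma KKSi': "adj i j \<Longrightarrow> K j * K i = K j * Si i * Si j"
  using KKSi SSKi by simp

text \<open>Next to a contraction, a neighbouring crossing can be traded for a second contraction.
  This and the variants \<open>SjK\<close> and \<open>KSij\<close> are the moves behind
  \<open>module_action\<close>, \<open>transport\<close> and \<open>slide\<close>.\<close>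

lemma KSj: assumes a: "adj i j" shows "K i * S j = K i * K j * Si i" 
proof -
  have "K i * K j * Si i = K i * S j * S i * Si i" using KKS'[of j i] a by auto
  then show ?thesis using S_Si[of i] a by (simp add: mult.assoc)
qed

lemma SjK: assumes a: "adj i j" shows "S j * K i = Si i * K j * K i"
proof -
  have "Si i * (K j * K i) = Si i * (S i * S j * K i)" using KKS a by auto
  then show ?thesis using Si_S[of i] a by (simp flip: mult.assoc)
qed

lemma KSij: assumes a: "adj i j" shows "K i * Si j = K i * K j * S i" 
proof -
  have "K i * K j * S i = K i * Si j * Si i * S i" using KKSi'[of j i] a by auto
  then show ?thesis using Si_S[of i] a by (simp add: mult.assoc)
qed

text \<open>A curl: after \<open>SjK\<close> the inverse crossing \<open>Si i\<close> meets
  \<open>K i\<close> and contributes 1/\<mu>.\<close>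

lemma KSK: assumes a: "adj i j" shows "K i * S j * K i = (1/\<mu>) \<odot> K i"
proof -
  have "K i * S j * K i = K i * Si i * K j * K i" using SjK[OF a] by (simp add: mult.assoc)
  also have "\<dots> = (1/\<mu>) \<odot> (K i * K j * K i)" using KSi[of i] a by simp
  finally show ?thesis using KKK[OF a] by simp
qed

text \<open>The value of a closed loop, see \<open>K2\<close>. Being nonzero, it can be cancelled
  again after a contraction has been doubled, a device used repeatedly below.\<close>

definition eta' :: complex where "eta' = (q - \<mu>) * (1/q + \<mu>) / (\<mu> * (q - 1/q))"

lemma eta_nz: "eta' \<noteq> 0"
proof -
  have "1/q + \<mu> \<noteq> 0" using mu by (metis add.commute add_eq_0_iff)
  then show ?thesis using mu lam_nz by (simp add: eta'_def lam_def)
qed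

lemma K2: assumes i: "1 \<le> i" shows "K i * K i = eta' \<odot> K i"
proof -
  have "(S i * S i) * K i = (1 + lam \<odot> S i - (lam * \<mu>) \<odot> K i) * K i" using quad'[OF i] by simp
  then have "(\<mu>*\<mu>) \<odot> K i = K i + (lam*\<mu>) \<odot> K i - (lam * \<mu>) \<odot> (K i * K i)"
    using SK[OF i] by (simp add: mult.assoc algebra_simps)
  then have "(lam * \<mu>) \<odot> (K i * K i) = (1 + lam*\<mu> - \<mu>*\<mu>) \<odot> K i"
    by (simp add: sm_distribs algebra_simps)
  moreover have "1 + lam*\<mu> - \<mu>*\<mu> = lam * \<mu> * eta'"
    using mu lam_nz q0 by (simp add: eta'_def lam_def[symmetric]) (simp add: lam_def field_simps)
  ultimately have "(lam * \<mu>) \<odot> (K i * K i) = (lam * \<mu>) \<odot> (eta' \<odot> K i)" by simp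
  then show ?thesis using lam_nz mu by (subst (asm) sm_cancel) auto
qed

end

section \<open>Antisymmetrizers\<close>

context bmw begin

definition al :: "nat \<Rightarrow> complex" where "al k = ((1/q) ^ (2*k) - 1) / (q - 1/q)"
definition be :: "nat \<Rightarrow> complex" where "be k = ((1/q) ^ (2*k) - 1) / ((q/\<mu>) * (1/q) ^ (2*k) + 1)"
definition cc :: "nat \<Rightarrow> complex" where "cc k = q ^ k / qnum q (Suc k)"
text \<open>Up to the unit (q/\<mu>) q^(-2k) this is the denominator of \<open>be k\<close>; it
  vanishes exactly for \<mu> = -q^(1-2k).\<close>

definition dd :: "nat \<Rightarrow> complex" where "dd k = 1 + \<mu> * q ^ (2*k) / q"
definition X :: "nat \<Rightarrow> 'e" where "X k = 1 + (al k \<odot> S k + be k \<odot> K k)"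

fun A :: "nat \<Rightarrow> 'e" where
  "A 0 = 1"
| "A (Suc 0) = 1"
| "A (Suc (Suc k)) = cc (Suc k) \<odot> (A (Suc k) * X (Suc k) * A (Suc k))"

text \<open>\<open>A j\<close> is built with the factor \<open>X (j - 1)\<close>, hence the shift
  between the two conditions.\<close>

definition generic :: "nat \<Rightarrow> bool" where
  "generic n \<longleftrightarrow> (\<forall>j\<in>{2..n}. qnum q j \<noteq> 0 \<and> dd (j - 1) \<noteq> 0)"

lemma genericD: "generic n \<Longrightarrow> 1 \<le> k \<Longrightarrow> k < n \<Longrightarrow> dd k \<noteq> 0" "generic n \<Longrightarrow> 1 \<le> k \<Longrightarrow> k \<le> n \<Longrightarrow> qnum q k \<noteq> 0"
proof -
  show "generic n \<Longrightarrow> 1 \<le> k \<Longrightarrow> k < n \<Longrightarrow> dd k \<noteq> 0"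
    unfolding generic_def by (drule bspec[of _ _ "Suc k"]) auto
  have "qnum q 1 \<noteq> 0" using lam_nz by (simp add: qnum_def lam_def)
  then show "generic n \<Longrightarrow> 1 \<le> k \<Longrightarrow> k \<le> n \<Longrightarrow> qnum q k \<noteq> 0"
    unfolding generic_def by (cases "k = 1") auto
qed

lemma generic_mono: "generic n \<Longrightarrow> m \<le> n \<Longrightarrow> generic m"
  by (auto simp: generic_def)

lemma qq_nz: "q * q - 1 \<noteq> 0"
  using lam_nz q0 by (auto simp: lam_def field_simps)

lemma qnum_eq: "qnum q k = (q^k - 1/q^k) / lam"
  by (simp add: qnum_def lam_def power_one_over)

lemma al_eq: "al k = - (qnum q k / q ^ k)"
proof -
  have "(1/q) ^ (2*k) - 1 = - ((q^k - 1/q^k) / q^k)"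
    using q0 by (simp add: power_one_over mult_2 mult_2_right power_add field_simps)
  then show ?thesis by (simp add: al_def qnum_eq lam_def[symmetric])
qed

lemma be_eq: assumes "dd k \<noteq> 0" shows "be k = - (\<mu> * q^k / q * lam * qnum q k / dd k)"
proof -
  define Q where "Q = q ^ k"
  have Q: "Q \<noteq> 0" using q0 by (simp add: Q_def)
  have e: "be k = (1/(Q*Q) - 1) / ((q/\<mu>) * (1/(Q*Q)) + 1)"
    by (simp add: be_def Q_def power_one_over mult_2 power_add)
  have d: "dd k = 1 + \<mu> * (Q*Q) / q" by (simp add: dd_def Q_def mult_2 power_add)
  have n: "q + \<mu> * (Q*Q) \<noteq> 0" using assms q0 unfolding d by (auto simp: field_simps)
  show ?thesis unfolding e d qnum_eq Q_def[symmetric] using Q n q0 lam_nz mu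
    by (simp add: divide_simps) (simp add: algebra_simps)
qed

lemma qnum_Suc: "qnum q (Suc k) = q ^ k + qnum q k / q"
  using q0 qq_nz by (simp add: qnum_def power_one_over) (simp add: field_simps)

lemma X_comm: "1 \<le> k \<Longrightarrow> x * S k = S k * x \<Longrightarrow> x * X k = X k * x"
  by (simp add: X_def algebra_simps K_commI)

lemma A_comm: "(\<And>k. 1 \<le> k \<Longrightarrow> k < n \<Longrightarrow> x * S k = S k * x) \<Longrightarrow> x * A n = A n * x"
proof (induction n rule: A.induct)
  case (3 k)
  have 1: "x * A (Suc k) = A (Suc k) * x" using 3 by auto
  have 2: "x * X (Suc k) = X (Suc k) * x" using 3 by (auto intro!: X_comm)
  show ?case using 1 2 by simp (metis mult.assoc)
qed auto

lemma A_S: "n < k \<Longrightarrow> S k * A n = A n * S k"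
  by (rule A_comm) (auto intro!: far')

lemma A_K: "n < k \<Longrightarrow> K k * A n = A n * K k"
  using K_commI[of k "A n"] A_S[of n k] by auto

lemma A_X: "n < k \<Longrightarrow> X k * A n = A n * X k"
  using X_comm[of k "A n"] A_S[of n k] by auto

text \<open>The computation takes place in the left module generated by a vector \<^term>\<open>a\<close> on which
  \<^term>\<open>S i\<close> acts by \<open>-1/q\<close> and \<^term>\<open>K i\<close> by 0; it is spanned by \<open>a\<close>, \<open>S\<^sub>j a\<close>, \<open>S\<^sub>i S\<^sub>j a\<close>,
  \<open>K\<^sub>j a\<close>, \<open>S\<^sub>i K\<^sub>j a\<close> and \<open>K\<^sub>i K\<^sub>j a\<close>.\<close>

lemma module_action:
  assumes adj: "adj i j" and Sa: "S i * a = - ((1/q) \<odot> a)" and Ka: "K i * a = 0"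
  shows "K i * (S j * a) = - (q \<odot> (K i * (K j * a)))"
    and "S j * (S j * a) = a + lam \<odot> (S j * a) - (lam * \<mu>) \<odot> (K j * a)"
    and "S j * (K j * a) = \<mu> \<odot> (K j * a)"
    and "S j * (S i * (S j * a)) = - ((1/q) \<odot> (S i * (S j * a)))"
    and "S j * (S i * (K j * a)) = K i * (K j * a)"
    and "S j * (K i * (K j * a)) = S i * (K j * a) - lam \<odot> (K j * a) + lam \<odot> (K i * (K j * a))"
proof -
  have Si: "Si i * a = - (q \<odot> a)"
  proof -
    have "a = Si i * (S i * a)" using adj by simp
    also have "\<dots> = - ((1/q) \<odot> (Si i * a))" using Sa by simp
    finally have "q \<odot> a = - (q \<odot> (1/q) \<odot> (Si i * a))" by (metis sm_minus_right)
    then show ?thesis using q0 by (simp add: eq_neg_iff_add_eq_0 add.commute)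
  qed
  have "K i * S j * a = K i * K j * (Si i * a)" using KSj[OF adj] by (simp add: mult.assoc)
  then show "K i * (S j * a) = - (q \<odot> (K i * (K j * a)))" by (simp add: Si mult.assoc)
  show "S j * (S j * a) = a + lam \<odot> (S j * a) - (lam * \<mu>) \<odot> (K j * a)"
    using quad'[of j] adj by (simp flip: mult.assoc) (simp add: algebra_simps)
  show "S j * (K j * a) = \<mu> \<odot> (K j * a)" using SK[of j] adj by (simp flip: mult.assoc)
  have "S j * S i * S j * a = S i * S j * (S i * a)"
    by (simp only: braid'[OF adj, symmetric]) (simp only: mult.assoc)
  then show "S j * (S i * (S j * a)) = - ((1/q) \<odot> (S i * (S j * a)))" by (simp add: Sa mult.assoc)
  have "adj j i" using adj by auto
  note KK = KKS[OF this] KKSi[OF this]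
  show "S j * (S i * (K j * a)) = K i * (K j * a)" using KK(1) by (simp flip: mult.assoc)
  have "S j * (K i * (K j * a)) = S j * ((K i * K j) * a)" by (simp add: mult.assoc)
  also have "\<dots> = Si i * (K j * a)" using KK(2) adj by (simp add: mult.assoc)
  also have "\<dots> = S i * (K j * a) - lam \<odot> (K j * a) + lam \<odot> (K i * (K j * a))"
    using Si_eq[of i] adj by (simp add: distrib_right left_diff_distrib)
  finally show "S j * (K i * (K j * a)) = S i * (K j * a) - lam \<odot> (K j * a) + lam \<odot> (K i * (K j * a))" .
qed

text \<open>Expand \<open>S j\<close> plus 1/q, applied to the vector, over the six spanning vectors
  of the module. Condition c1 kills the coefficients of \<open>a\<close> and \<open>S j * a\<close>,
  c2 those of \<open>S i * (K j * a)\<close> and \<open>K i * (K j * a)\<close>, c2 and c3 together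
  that of \<open>K j * a\<close>; the terms in \<open>S i * (S j * a)\<close> cancel by
  themselves.\<close>

lemma XX_action:
  assumes adj: "adj i j" and Sa: "S i * a = - ((1/q) \<odot> a)" and Ka: "K i * a = 0"
    and c1: "1 - al' / q + \<alpha> * q = 0"
    and c2: "\<beta>' * (\<beta> - q * \<alpha>) = - (al' * \<beta> / q)"
    and c3: "- (\<alpha> * lam * \<mu>) + \<beta> * \<mu> + lam * al' * \<beta> / q + \<beta> / q = 0"
  shows "S j * ((1 + (al' \<odot> S i + \<beta>' \<odot> K i)) * ((1 + (\<alpha> \<odot> S j + \<beta> \<odot> K j)) * a))
    = - ((1/q) \<odot> ((1 + (al' \<odot> S i + \<beta>' \<odot> K i)) * ((1 + (\<alpha> \<odot> S j + \<beta> \<odot> K j)) * a)))"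
proof -
  note m = module_action[OF adj Sa Ka]
  define Y where "Y = (1 + (al' \<odot> S i + \<beta>' \<odot> K i)) * ((1 + (\<alpha> \<odot> S j + \<beta> \<odot> K j)) * a)"
  define t where "t = \<beta>' * (\<beta> - q * \<alpha>)"
  have Y: "Y = (1 - al'/q) \<odot> a + \<alpha> \<odot> (S j * a) + \<beta> \<odot> (K j * a) + (al' * \<alpha>) \<odot> (S i * (S j * a))
      + (al' * \<beta>) \<odot> (S i * (K j * a)) + t \<odot> (K i * (K j * a))"
    by (simp add: Y_def t_def distrib_left distrib_right m Sa Ka sm_distribs mult.assoc algebra_simps)
  have SY: "S j * Y = (1 - al'/q) \<odot> (S j * a) + \<alpha> \<odot> (a + lam \<odot> (S j * a) - (lam * \<mu>) \<odot> (K j * a))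
     + (\<beta> * \<mu>) \<odot> (K j * a) + - ((al' * \<alpha> / q) \<odot> (S i * (S j * a))) + (al' * \<beta>) \<odot> (K i * (K j * a))
     + t \<odot> (S i * (K j * a) - lam \<odot> (K j * a) + lam \<odot> (K i * (K j * a)))"
    by (simp add: Y distrib_left m)
  have "S j * Y + (1/q) \<odot> Y = (\<alpha> + (1 - al'/q)/q) \<odot> a + ((1 - al'/q) + \<alpha> * lam + \<alpha>/q) \<odot> (S j * a)
     + (- (\<alpha> * lam * \<mu>) + \<beta> * \<mu> - lam * t + \<beta> / q) \<odot> (K j * a)
     + (t + al' * \<beta> / q) \<odot> (S i * (K j * a)) + (al' * \<beta> + lam * t + t/q) \<odot> (K i * (K j * a))"
    unfolding SY by (subst Y) (simp add: sm_distribs algebra_simps diff_divide_distrib add_divide_distrib)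
  also have "\<alpha> + (1 - al'/q)/q = 0" using c1 q0 by (simp add: field_simps)
  also have "(1 - al'/q) + \<alpha> * lam + \<alpha>/q = 0" using c1 q0 by (simp add: lam_def algebra_simps)
  also have "t + al' * \<beta> / q = 0" using c2 by (simp add: t_def)
  also have "al' * \<beta> + lam * t + t/q = 0" using c2 q0 unfolding t_def[symmetric] by (simp add: lam_def field_simps)
  also have "- (\<alpha> * lam * \<mu>) + \<beta> * \<mu> - lam * t + \<beta> / q = 0" using c3 c2 unfolding t_def[symmetric] by (simp add: algebra_simps)
  finally show ?thesis unfolding Y_def[symmetric] by (simp add: eq_neg_iff_add_eq_0)
qed

text \<open>In \<open>K k * S k * a\<close> the crossing acts by \<mu> on the left factor and by
  -1/q on the right one, and the two values differ.\<close>

lemma K_kill: assumes "1 \<le> k" "S k * a = - ((1/q) \<odot> a)" shows "K k * a = 0"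
proof -
  have "\<mu> \<odot> (K k * a) = K k * S k * a" using KS[OF assms(1)] by simp
  also have "\<dots> = - ((1/q) \<odot> (K k * a))" by (simp add: mult.assoc assms(2))
  finally have "(\<mu> + 1/q) \<odot> (K k * a) = 0" by (simp add: sm_add_left)
  moreover have "\<mu> + 1/q \<noteq> 0" using mu by (metis add_eq_0_iff2)
  ultimately show ?thesis by (metis sm_cancel sm_zero)
qed

text \<open>Verifies c1 to c3 of \<open>XX_action\<close> for neighbouring baxterized factors; with
  Q = q^n they become rational identities.\<close>

lemma coeff_step:
  assumes "dd n \<noteq> 0" "dd (Suc n) \<noteq> 0" 
  shows "1 - al n / q + al (Suc n) * q = 0"
    and "be n * (be (Suc n) - q * al (Suc n)) = - (al n * be (Suc n) / q)"
    and "- (al (Suc n) * lam * \<mu>) + be (Suc n) * \<mu> + lam * al n * be (Suc n) / q + be (Suc n) / q = 0"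
proof -
  define Q where "Q = q ^ n"
  have Q: "Q \<noteq> 0" using q0 by (simp add: Q_def)
  have d: "dd n = 1 + \<mu> * (Q*Q) / q" "dd (Suc n) = 1 + \<mu> * (Q*Q) * q"
    using q0 by (simp_all add: dd_def Q_def mult_2 mult_2_right power_add field_simps)
  have n1: "q + \<mu> * (Q*Q) \<noteq> 0" using assms q0 unfolding d by (auto simp: field_simps)
  have n2: "1 + \<mu> * (Q*Q) * q \<noteq> 0" using assms q0 unfolding d by (auto simp: field_simps)
  note e = al_eq be_eq[OF assms(1)] be_eq[OF assms(2)] qnum_eq d power_Suc Q_def[symmetric]
  show "1 - al n / q + al (Suc n) * q = 0" unfolding e using Q q0 lam_nz
    by (simp add: divide_simps) (simp add: lam_def field_simps)
  show "be n * (be (Suc n) - q * al (Suc n)) = - (al n * be (Suc n) / q)"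
    unfolding e using Q q0 lam_nz n1 n2 by (simp add: divide_simps) (simp add: lam_def field_simps)
  show "- (al (Suc n) * lam * \<mu>) + be (Suc n) * \<mu> + lam * al n * be (Suc n) / q + be (Suc n) / q = 0"
    unfolding e using Q q0 lam_nz n2 by (simp add: divide_simps) (simp add: lam_def field_simps)
qed

text \<open>On \<open>A (Suc n)\<close> the factor \<open>X n\<close> acts by
  \<open>1 - al n / q\<close>, and \<open>cc n\<close> is chosen as the inverse of this number; this
  gives idempotency.\<close>

lemma cc_al: "generic (Suc n) \<Longrightarrow> cc n * (1 - al n / q) = 1"
proof -
  assume g: "generic (Suc n)"
  have *: "q ^ n + qnum q n / q \<noteq> 0" using genericD(2)[OF g, of "Suc n"] by (simp add: qnum_Suc)
  have "q ^ n * (1 + qnum q n / q ^ n / q) = q ^ n + qnum q n / q" using q0 by (simp add: field_simps)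
  then show ?thesis using * by (simp add: cc_def al_eq qnum_Suc)
qed

text \<open>With m = n - 1, the product \<open>A n * X n * A n\<close> equals
  \<open>A m * X m * X n * A n\<close> up to a factor, because \<open>A m\<close> commutes with
  \<open>X n\<close> and is absorbed by \<open>A n\<close>. Then \<open>XX_action\<close> applies to
  the vector \<open>A n\<close>, and needs from the induction only how the top generator
  \<open>S m\<close> acts on \<open>A n\<close>.\<close>

lemma A_props: "generic (Suc n) \<Longrightarrow> A (Suc n) * A (Suc n) = A (Suc n) \<and>
   (1 \<le> n \<longrightarrow> S n * A (Suc n) = - ((1/q) \<odot> A (Suc n)))"
proof (induction n rule: less_induct)
  case (less n)
  show ?case
  proof (cases "n = 0")
    case True then show ?thesis by simp
  next
    case False
    then obtain m where n: "n = Suc m" by (cases n) auto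
    have gen: "generic (Suc m)" using less.prems generic_mono n by auto
    have idem: "A n * A n = A n" using less.IH[of m] gen n by auto
    have S: "S n * A (Suc n) = - ((1/q) \<odot> A (Suc n))"
    proof (cases "m = 0")
      case True
      \<comment> \<open>For n = 1 there is no preceding factor \<open>X m\<close>. The eigenvector
        equation is checked for \<open>X 1\<close> itself, where \<open>be 1\<close> makes the
        coefficient of \<open>K 1\<close> vanish.\<close>
      have d: "dd 1 \<noteq> 0" using genericD(1)[OF less.prems, of 1] n by simp
      define a1 where "a1 = al 1"
      define b1 where "b1 = be 1"
      have a1: "a1 = - (1/q)" using lam_nz by (simp add: a1_def al_eq qnum_eq lam_def)
      have "qnum q (Suc 0) = 1" using lam_nz by (simp add: qnum_eq lam_def)
      then have b1: "b1 * (1 + \<mu> * q) = - (\<mu> * lam)"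
        using be_eq[OF d] d q0 unfolding b1_def dd_def by (simp add: power2_eq_square field_simps)
      moreover have "lam * \<mu> / q + b1 * \<mu> + b1 / q = (lam * \<mu> + b1 * (1 + \<mu> * q)) / q"
        using q0 by (simp add: field_simps)
      ultimately have b1': "lam * \<mu> / q + b1 * \<mu> + b1 / q = 0" by simp
      have "S 1 * X 1 + (1/q) \<odot> X 1 = (1 + a1 * lam + a1/q) \<odot> S 1 + (a1 + 1/q) \<odot> 1
         + (- (a1 * lam * \<mu>) + b1 * \<mu> + b1 / q) \<odot> K 1"
        by (simp add: X_def a1_def[simplified] b1_def[simplified] distrib_left quad' SK) (simp add: sm_distribs algebra_simps)
      also have "1 + a1 * lam + a1/q = 0" using q0 by (simp add: a1 lam_def field_simps)
      also have "a1 + 1/q = 0" by (simp add: a1)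
      also have "- (a1 * lam * \<mu>) + b1 * \<mu> + b1 / q = 0" using b1' by (simp add: a1)
      finally have "S 1 * X 1 = - ((1/q) \<odot> X 1)" by (simp add: eq_neg_iff_add_eq_0)
      then show ?thesis using True n by (simp add: mult.commute)
    next
      case False
      then obtain k where m: "m = Suc k" by (cases m) auto
      have adj: "adj m n" using m n by auto
      have Am: "A m * A m = A m" using less.IH[of k] gen generic_mono m n by auto
      have An: "A n = cc m \<odot> (A m * X m * A m)" using m n by simp
      have AmAn: "A m * A n = A n" unfolding An using Am by (simp flip: mult.assoc)
      have Sm: "S m * A n = - ((1/q) \<odot> A n)" using less.IH[of m] gen m n by auto
      have dn: "dd m \<noteq> 0" "dd n \<noteq> 0" using genericD(1)[OF less.prems] m n by auto
      have key: "S n * (X m * (X n * A n)) = - ((1/q) \<odot> (X m * (X n * A n)))"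
        unfolding X_def
        by (rule XX_action[OF adj Sm K_kill[OF _ Sm]]) (use coeff_step[of m] dn m n in auto)
      have e: "A n * (X n * A n) = cc m \<odot> (A m * (X m * (X n * A n)))"
      proof -
        have "A n * (X n * A n) = cc m \<odot> (A m * (X m * ((A m * X n) * A n)))"
          unfolding An by (simp add: mult.assoc)
        also have "A m * X n = X n * A m" using A_X[of m n] n by simp
        finally show ?thesis using AmAn by (simp add: mult.assoc)
      qed
      have "S n * (A n * (X n * A n)) = cc m \<odot> ((S n * A m) * (X m * (X n * A n)))"
        unfolding e by (simp add: mult.assoc)
      also have "\<dots> = cc m \<odot> (A m * (S n * (X m * (X n * A n))))"
        using A_S[of m n] n by (simp add: mult.assoc)
      also have "\<dots> = - ((1/q) \<odot> (A n * (X n * A n)))" unfolding e key by (simp add: mult.commute)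
      finally have "S n * (A n * (X n * A n)) = - ((1/q) \<odot> (A n * (X n * A n)))" .
      then show ?thesis by (simp add: n mult.assoc mult.commute)
    qed
    have K: "K n * A (Suc n) = 0" using S n by (intro K_kill) auto
    have e: "A (Suc n) = cc n \<odot> (A n * X n * A n)" using n by simp
    have AA: "A n * A (Suc n) = A (Suc n)" unfolding e using idem by (simp flip: mult.assoc)
    have "A (Suc n) * A (Suc n) = cc n \<odot> (A n * (X n * (A n * A (Suc n))))"
      by (subst (1) e) (simp add: mult.assoc)
    also have "X n * (A n * A (Suc n)) = (1 - al n / q) \<odot> A (Suc n)"
      unfolding AA by (simp add: X_def distrib_right S K sm_diff_left)
    also have "cc n \<odot> (A n * ((1 - al n / q) \<odot> A (Suc n))) = A (Suc n)"
      using cc_al[OF less.prems] AA by simp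
    finally show ?thesis using S by simp
  qed
qed

lemma A_idem: "generic n \<Longrightarrow> A n * A n = A n"
  using A_props[of "n - 1"] by (cases n) auto

end

section \<open>Trace functionals on the BMW algebra\<close>

context bmw begin

definition word :: "nat list \<Rightarrow> 'e" where "word js = prod_list (map S js)"

lemma word_Nil [simp]: "word [] = 1" and word_Cons [simp]: "word (j # js) = S j * word js"
  and word_append [simp]: "word (xs @ ys) = word xs * word ys"
  by (simp_all add: word_def)

text \<open>The image of the algebra W_n. Words in the \<open>S j\<close> suffice, since
  \<open>K j\<close> and \<open>Si j\<close> are polynomials in \<open>S j\<close>.\<close>

inductive_set W :: "nat \<Rightarrow> 'e set" for n where
  W_word: "set js \<subseteq> {1..<n} \<Longrightarrow> word js \<in> W n"
| W_add: "x \<in> W n \<Longrightarrow> y \<in> W n \<Longrightarrow> x + y \<in> W n"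
| W_sm: "x \<in> W n \<Longrightarrow> c \<odot> x \<in> W n"

lemma W_mono: "x \<in> W m \<Longrightarrow> m \<le> n \<Longrightarrow> x \<in> W n"
  by (induction rule: W.induct) (fastforce intro: W.intros)+

lemma W_minus: "x \<in> W n \<Longrightarrow> - x \<in> W n"
  using W_sm[of x n "-1"] by simp

lemma W_diff: "x \<in> W n \<Longrightarrow> y \<in> W n \<Longrightarrow> x - y \<in> W n"
  using W_add[of x n "- y"] W_minus[of y n] by simp

lemma W_1: "1 \<in> W n" using W_word[of "[]" n] by simp

lemma W_S: "1 \<le> k \<Longrightarrow> k < n \<Longrightarrow> S k \<in> W n" using W_word[of "[k]" n] by simp

lemma W_mult: "x \<in> W n \<Longrightarrow> y \<in> W n \<Longrightarrow> x * y \<in> W n"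
proof (induction rule: W.induct)
  case (W_word js)
  from W_word(2) show ?case
  proof (induction rule: W.induct)
    case (W_word ls)
    then show ?case using W.W_word[of "js @ ls" n] \<open>set js \<subseteq> {1..<n}\<close> by simp
  qed (auto simp: distrib_left intro: W.intros)
qed (auto simp: distrib_right intro: W.intros)

lemma W_K: "1 \<le> k \<Longrightarrow> k < n \<Longrightarrow> K k \<in> W n"
  by (simp only: K_eq) (intro W_sm W_diff W_add W_1 W_mult W_S)

lemma W_A: "n \<le> m \<Longrightarrow> A n \<in> W m"
proof (induction n rule: A.induct)
  case (3 k)
  then show ?case by (auto simp: X_def intro!: W_sm W_mult W_add W_1 W_S W_K)
qed (auto intro: W_1)

text \<open>The braid of the power sum p_(n-i), moved i strands to the right.\<close>

definition tail :: "nat \<Rightarrow> nat \<Rightarrow> 'e" where "tail i n = word (rev [i+1..<n])"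

lemma tail_empty [simp]: "n \<le> Suc i \<Longrightarrow> tail i n = 1" by (simp add: tail_def)

lemma tail_split: "Suc (Suc i) \<le> n \<Longrightarrow> tail i n = tail (Suc i) n * S (Suc i)"
  by (simp add: tail_def upt_conv_Cons)

lemma W_tail: "tail i n \<in> W n" unfolding tail_def by (rule W_word) auto

lemma word_comm: "(\<And>j. j \<in> set js \<Longrightarrow> x * S j = S j * x) \<Longrightarrow> x * word js = word js * x"
  by (induction js) (simp, simp, metis mult.assoc)

lemma tail_comm: "(\<And>j. i < j \<Longrightarrow> j < n \<Longrightarrow> x * S j = S j * x) \<Longrightarrow> x * tail i n = tail i n * x"
  unfolding tail_def by (rule word_comm) auto

lemma A_tail: "A i * tail i n = tail i n * A i"
  by (rule tail_comm) (use A_S in auto)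

lemma tail_K: "1 \<le> k \<Longrightarrow> k + 2 \<le> i + 1 \<Longrightarrow> K k * tail i n = tail i n * K k"
  by (rule tail_comm) (rule sym, rule K_commI, auto intro!: far')

lemma KK_far: "1 \<le> i \<Longrightarrow> 1 \<le> j \<Longrightarrow> i + 2 \<le> j \<or> j + 2 \<le> i \<Longrightarrow> K i * K j = K j * K i"
  by (intro K_commI) (auto intro!: sym[OF K_commI] far')

lemma SK_far: "1 \<le> i \<Longrightarrow> 1 \<le> j \<Longrightarrow> i + 2 \<le> j \<or> j + 2 \<le> i \<Longrightarrow> S i * K j = K j * S i"
  by (intro K_commI) (auto intro!: far')

end

text \<open>What the Newton and Wronski relations need to know about the characteristic map. Its
  values are placed in the same ring as its arguments, so that one scalar action serves both;
  cyclicity is required for generators and multiplicativity for words only, since both extend by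
  linearity.\<close>

locale bmw_trace = bmw sw q \<mu> S Si K for sw :: "complex \<Rightarrow> 'e::ring_1" and q \<mu> S Si K +
  fixes ch :: "nat \<Rightarrow> 'e \<Rightarrow> 'e"
  assumes ch_add: "ch n (x + y) = ch n x + ch n y"
    and ch_sm [simp]: "ch n (c \<odot> x) = c \<odot> ch n x"
    and ch_S: "1 \<le> k \<Longrightarrow> k < n \<Longrightarrow> ch n (S k * x) = ch n (x * S k)"
    and ch_word: "1 \<le> n \<Longrightarrow> 1 \<le> m \<Longrightarrow> set js \<subseteq> {1..<n} \<Longrightarrow> set ls \<subseteq> {1..<m} \<Longrightarrow>
      ch (n + m) (word js * word (map (\<lambda>l. l + n) ls)) = ch n (word js) * ch m (word ls)"
begin

lemma ch_minus: "ch n (- x) = - ch n x" using ch_sm[of n "-1" x] by simp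
lemma ch_diff: "ch n (x - y) = ch n x - ch n y" using ch_add[of n x "-y"] ch_minus by simp

lemma ch_cyc: "y \<in> W n \<Longrightarrow> ch n (y * x) = ch n (x * y)"
proof (induction arbitrary: x rule: W.induct)
  case (W_word js)
  then show ?case
  proof (induction js arbitrary: x)
    case (Cons j js)
    have "ch n (S j * (word js * x)) = ch n (word js * (x * S j))"
      using Cons.prems by (simp add: ch_S mult.assoc)
    also have "\<dots> = ch n (x * S j * word js)" using Cons by simp
    finally show ?case by (simp add: mult.assoc)
  qed simp
qed (auto simp: distrib_left distrib_right ch_add)

lemma ch_K: "1 \<le> k \<Longrightarrow> k < n \<Longrightarrow> ch n (K k * x) = ch n (x * K k)"
  by (intro ch_cyc W_K)

lemma ch_mult_word: "x \<in> W n \<Longrightarrow> 1 \<le> n \<Longrightarrow> 1 \<le> m \<Longrightarrow> set ls \<subseteq> {1..<m} \<Longrightarrow>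
   ch (n + m) (x * word (map (\<lambda>l. l + n) ls)) = ch n x * ch m (word ls)"
  by (induction rule: W.induct) (auto simp: ch_word ch_add distrib_right)

definition gg :: 'e where "gg = (1/eta') \<odot> ch 2 (K 1)"

text \<open>\<open>K (Suc n)\<close> is a combination of the words [], [1] and [1, 1] shifted by n,
  so multiplicativity on words suffices; \<open>eta'\<close> undoes the normalisation of
  \<open>gg\<close>.\<close>

lemma ch_mult_K: assumes "x \<in> W n" "1 \<le> n"
  shows "ch (n + 2) (x * K (Suc n)) = eta' \<odot> (ch n x * gg)"
proof -
  have K: "K (Suc n) = (1 / (lam * \<mu>)) \<odot> (word (map (\<lambda>l. l + n) []) + lam \<odot> word (map (\<lambda>l. l + n) [1])
      - word (map (\<lambda>l. l + n) [1, 1]))" for n by (subst K_eq) auto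
  have K1: "K 1 = (1 / (lam * \<mu>)) \<odot> (word [] + lam \<odot> word [1] - word [1, 1])" by (subst K_eq) auto
  have "ch (n + 2) (x * K (Suc n)) = ch n x * ch 2 (K 1)"
    unfolding K K1 distrib_left right_diff_distrib sm_mult_right ch_sm ch_add ch_diff
    by (subst (1 2 3) ch_mult_word) (use assms in auto)
  then show ?thesis using eta_nz by (simp add: gg_def)
qed

section \<open>The families a, p, T, U, V and the removal of contractions\<close>

definition aa :: "nat \<Rightarrow> 'e" where "aa n = (if n = 0 then 1 else ch n (A n))"
definition pp :: "nat \<Rightarrow> 'e" where "pp n = ch n (tail 0 n)"
definition TT :: "nat \<Rightarrow> nat \<Rightarrow> 'e" where "TT i n = ch n (A i * tail i n)"
definition UU :: "nat \<Rightarrow> nat \<Rightarrow> 'e" where "UU i n = ch n (A i * tail (i - 1) n)"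
definition VV :: "nat \<Rightarrow> nat \<Rightarrow> 'e" where "VV i n = ch n (A i * tail i n * K i)"

text \<open>\<open>tail i n\<close> is \<open>tail 0 (n - i)\<close> shifted by i, so
  \<open>ch\<close> factorizes.\<close>

lemma TT_eq: assumes "i < n" shows "TT i n = aa i * pp (n - i)"
proof (cases "i = 0")
  case True then show ?thesis by (simp add: TT_def aa_def pp_def)
next
  case False
  have "map (\<lambda>l. l + i) (rev [1..<n - i]) = rev [i + 1..<n]"
    unfolding rev_map[symmetric] rev_is_rev_conv
    by (rule nth_equalityI) (use assms in \<open>auto simp del: upt_Suc\<close>)
  then have "tail i n = word (map (\<lambda>l. l + i) (rev [1..<n - i]))" by (simp add: tail_def)
  then have "TT i n = ch (i + (n - i)) (A i * word (map (\<lambda>l. l + i) (rev [1..<n - i])))"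
    using assms by (simp add: TT_def)
  also have "\<dots> = ch i (A i) * ch (n - i) (word (rev [1..<n - i]))"
    by (rule ch_mult_word) (use assms False W_A[of i i] in auto)
  finally show ?thesis using False by (simp add: aa_def pp_def tail_def)
qed

text \<open>Cyclicity brings the left \<open>A i\<close> to the right end, where it passes
  \<open>tail i n\<close> and merges with the second \<open>A i\<close> by idempotency; the three
  terms of \<open>X i\<close> then give T, U and V.\<close>

lemma U_recursion:
  assumes "generic i" "1 \<le> i" "i < n"
  shows "UU (Suc i) n = cc i \<odot> (TT i n + al i \<odot> UU i n + be i \<odot> VV i n)"
proof -
  obtain k where k: "i = Suc k" using assms(2) by (cases i) auto
  have Aw: "A i \<in> W n" using W_A assms by simp
  have idem: "A i * A i = A i" using A_idem assms by simp
  have "UU (Suc i) n = cc i \<odot> ch n (A i * (X i * A i * tail i n))"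
    by (simp add: UU_def k mult.assoc)
  also have "ch n (A i * (X i * A i * tail i n)) = ch n (X i * A i * (tail i n * A i))"
    using ch_cyc[OF Aw] by (simp add: mult.assoc)
  also have "X i * A i * (tail i n * A i) = X i * (A i * tail i n)"
    by (simp add: A_tail[symmetric] mult.assoc idem_left[OF idem])
  also have "ch n (X i * (A i * tail i n)) = TT i n + al i \<odot> UU i n + be i \<odot> VV i n"
  proof -
    have "tail (i - 1) n = tail i n * S i" using tail_split[of "i - 1" n] assms by simp
    then have "ch n (S i * (A i * tail i n)) = UU i n"
      using ch_S[of i n "A i * tail i n"] assms by (simp add: UU_def mult.assoc)
    moreover have "ch n (K i * (A i * tail i n)) = VV i n"
      using ch_K[of i n "A i * tail i n"] assms by (simp add: VV_def)
    ultimately show ?thesis by (simp add: X_def distrib_right ch_add TT_def)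
  qed
  finally show ?thesis .
qed

lemma UU_1: "UU 1 n = pp n" by (simp add: UU_def pp_def)
lemma UU_n: "1 \<le> n \<Longrightarrow> UU n n = aa n" by (simp add: UU_def aa_def)

lemma ch_eq_cancel_eta: "eta' \<odot> x = eta' \<odot> y \<Longrightarrow> x = y"
  using eta_nz sm_cancel by blast

text \<open>Each step carries the pair of contractions one strand to the right. Trading the crossing
  \<open>S (i + 2)\<close> for contractions and using cyclicity produces
  \<open>K (i + 1) * K i * K (i + 1)\<close>, which collapses, and a crossing \<open>S i\<close> is
  left over at the front. These crossings build up \<open>tail (i - 1) (n - 2)\<close>; the
  arbitrary factor Q is there to absorb them during the induction.\<close>

lemma transport:
  assumes "1 \<le> i" "i + 2 \<le> n" "\<And>j. i < j \<Longrightarrow> Q * S j = S j * Q"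
  shows "ch n (Q * tail (Suc i) n * K i * K (Suc i)) = ch n (tail (i - 1) (n - 2) * Q * K (n - 2) * K (n - 1))"
  using assms
proof (induction "n - (i + 2)" arbitrary: i Q)
  case 0
  then have "n = i + 2" by simp
  then show ?case by simp
next
  case (Suc k)
  let ?i1 = "Suc i" and ?i2 = "Suc (Suc i)" and ?r = "tail (Suc (Suc i)) n"
  have adj: "adj ?i1 ?i2" "adj i ?i1" "adj ?i1 i" using Suc.prems by auto
  have n: "i + 3 \<le> n" using Suc by auto
  have "tail ?i1 n = ?r * S ?i2" using n by (intro tail_split) simp
  then have "Q * tail ?i1 n * K i * K ?i1 = Q * ?r * (S ?i2 * K i) * K ?i1" by (simp add: mult.assoc)
  also have "S ?i2 * K i = K i * S ?i2" using Suc.prems by (intro SK_far) auto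
  also have "Q * ?r * (K i * S ?i2) * K ?i1 = Q * ?r * (K i * Si ?i1) * K ?i2 * K ?i1"
    using SjK[OF adj(1)] by (simp add: mult.assoc)
  also have "\<dots> = Q * ?r * K i * K ?i1 * S i * K ?i2 * K ?i1"
    using KSij[OF adj(2)] by (simp add: mult.assoc)
  also have "ch n \<dots> = ch n (K ?i1 * (Q * ?r * K i * K ?i1 * S i * K ?i2))"
    using ch_K[of ?i1 n] n by simp
  also have "K ?i1 * (Q * ?r * K i * K ?i1 * S i * K ?i2) = (K ?i1 * (Q * ?r)) * (K i * K ?i1 * S i * K ?i2)"
    by (simp add: mult.assoc)
  also have "K ?i1 * (Q * ?r) = Q * ?r * K ?i1"
  proof -
    have "K ?i1 * ?r = ?r * K ?i1" by (rule tail_K) auto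
    moreover have "K ?i1 * Q = Q * K ?i1" using Suc.prems by (intro sym[OF K_commI]) auto
    ultimately show ?thesis using comm_mult by blast
  qed
  also have "Q * ?r * K ?i1 * (K i * K ?i1 * S i * K ?i2) = Q * ?r * (K ?i1 * K i * K ?i1) * (S i * K ?i2)"
    by (simp add: mult.assoc)
  also have "\<dots> = (Q * ?r * K ?i1 * K ?i2) * S i"
    using KKK[OF adj(3)] SK_far[of i ?i2] Suc.prems by (simp add: mult.assoc)
  also have "ch n \<dots> = ch n (S i * (Q * ?r * K ?i1 * K ?i2))" using ch_S[of i n] Suc.prems n by simp
  also have "\<dots> = ch n ((S i * Q) * tail (Suc ?i1) n * K ?i1 * K (Suc ?i1))" by (simp add: mult.assoc)
  also have "\<dots> = ch n (tail (?i1 - 1) (n - 2) * (S i * Q) * K (n - 2) * K (n - 1))"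
  proof (rule Suc.hyps(1))
    show "k = n - (Suc i + 2)" using Suc.hyps(2) by simp
    show "?i1 + 2 \<le> n" using n by simp
    fix j assume "?i1 < j"
    then show "S i * Q * S j = S j * (S i * Q)"
      using Suc.prems(3)[of j] far[of i j] Suc.prems(1) by (intro sym[OF comm_mult]) auto
  qed simp
  also have "tail (?i1 - 1) (n - 2) * (S i * Q) = tail (i - 1) (n - 2) * Q"
    using tail_split[of "i - 1" "n - 2"] n Suc.prems by (simp add: mult.assoc)
  finally show ?case .
qed

text \<open>After \<open>transport\<close> the contractions sit on the last strands; let n = m + 2.
  Doubling \<open>K (m + 1)\<close> at the price of \<open>eta'\<close> and carrying one copy round
  the trace gives \<open>K (m + 1) * K m * K (m + 1)\<close>, that is \<open>K (m + 1)\<close>. This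
  lies to the right of the remaining factor, an element of \<open>W m\<close>, and splits off as
  \<open>gg\<close>.\<close>

lemma contract:
  assumes "1 \<le> i" "i + 2 \<le> n" "\<And>j. i < j \<Longrightarrow> Q * S j = S j * Q" "Q \<in> W i"
  shows "ch n (Q * tail (Suc i) n * K i * K (Suc i)) = ch (n - 2) (Q * tail (i - 1) (n - 2)) * gg"
proof -
  obtain m where n: "n = m + 2" using assms(2) by (metis add.commute le_Suc_ex add.assoc)
  have mi: "i \<le> m" "1 \<le> m" using assms n by auto
  let ?Q = "tail (i - 1) m * Q"
  have QW: "?Q \<in> W m" using W_tail W_mono[OF assms(4)] mi by (intro W_mult) auto
  have adj: "adj (Suc m) m" using mi by auto
  have QK: "K (Suc m) * ?Q = ?Q * K (Suc m)"
  proof -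
    have "K (Suc m) * tail (i - 1) m = tail (i - 1) m * K (Suc m)"
      by (rule tail_comm, rule sym, rule SK_far) auto
    moreover have "K (Suc m) * Q = Q * K (Suc m)" using assms mi by (intro sym[OF K_commI]) auto
    ultimately show ?thesis by (rule comm_mult)
  qed
  have "eta' \<odot> ch n (?Q * K m * K (Suc m)) = ch n ((?Q * K m * K (Suc m)) * K (Suc m))"
    using K2[of "Suc m"] by (simp add: mult.assoc)
  also have "\<dots> = ch n (K (Suc m) * (?Q * K m * K (Suc m)))"
    using ch_K[of "Suc m" n] n by simp
  also have "K (Suc m) * (?Q * K m * K (Suc m)) = ?Q * (K (Suc m) * K m * K (Suc m))"
    by (rule comm3[OF QK])
  also have "\<dots> = ?Q * K (Suc m)" using KKK[OF adj] by simp
  also have "ch n \<dots> = eta' \<odot> (ch m ?Q * gg)" unfolding n by (rule ch_mult_K) (use QW mi in auto)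
  finally have "ch n (?Q * K m * K (Suc m)) = ch m ?Q * gg" by (rule ch_eq_cancel_eta)
  moreover have "ch m ?Q = ch m (Q * tail (i - 1) m)" using ch_cyc[OF W_tail] by simp
  ultimately show ?thesis using transport[OF assms(1-3)] n by simp
qed

text \<open>A doubled \<open>K 1\<close> encloses the crossing \<open>S 2\<close>, a curl worth
  1/\<mu>; the remaining \<open>K 1\<close> is written as \<open>K 1 * K 2 * K 1\<close> so that
  \<open>contract\<close> applies.\<close>

lemma V_1: assumes "3 \<le> n" shows "VV 1 n = (1/\<mu>) \<odot> (pp (n - 2) * gg)"
proof -
  let ?r = "tail 2 n"
  have adj: "adj 1 2" by auto
  have t: "tail 1 n = ?r * S 2" using tail_split[of 1 n] assms by (simp add: numeral_2_eq_2)
  have r: "K 1 * ?r = ?r * K 1" by (rule tail_K) auto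
  have "eta' \<odot> VV 1 n = ch n (?r * S 2 * K 1 * K 1)" 
    using K2[of 1] by (simp add: VV_def t[simplified] mult.assoc)
  also have "\<dots> = ch n (K 1 * (?r * S 2 * K 1))" using ch_K[of 1 n] assms by simp
  also have "K 1 * (?r * S 2 * K 1) = ?r * (K 1 * S 2 * K 1)" by (rule comm3[OF r])
  also have "\<dots> = (1/\<mu>) \<odot> (?r * K 1 * K 2 * K 1)" using KSK[OF adj] KKK[OF adj] by (simp add: mult.assoc)
  also have "ch n \<dots> = (1/\<mu>) \<odot> ch n (K 1 * (?r * K 1 * K 2))" using ch_K[of 1 n "?r * K 1 * K 2"] assms by simp
  also have "K 1 * (?r * K 1 * K 2) = eta' \<odot> (1 * ?r * K 1 * K 2)"
    unfolding comm3[OF r] using K2[of 1] by (simp flip: mult.assoc)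
  also have "ch n \<dots> = eta' \<odot> (ch (n - 2) (1 * tail (1 - 1) (n - 2)) * gg)"
    using contract[of 1 n 1] assms W_1 by (simp add: numeral_2_eq_2)
  finally have "eta' \<odot> VV 1 n = eta' \<odot> ((1/\<mu>) \<odot> (pp (n - 2) * gg))"
    by (simp add: pp_def mult.commute)
  then show ?thesis by (rule ch_eq_cancel_eta)
qed

text \<open>Here the tail is empty. Doubling the contraction and unfolding \<open>A (m + 1)\<close>
  leaves \<open>X m\<close> between two contractions, where its three terms become the numbers
  \<open>eta'\<close>, \<open>al m / \<mu>\<close> and \<open>be m\<close>.\<close>

lemma V_last: assumes "generic (m + 1)" "1 \<le> m"
  shows "VV (m + 1) (m + 2) = (cc m * (eta' + al m / \<mu> + be m)) \<odot> (aa m * gg)"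
proof -
  obtain k where k: "m = Suc k" using assms by (cases m) auto
  let ?K = "K (Suc m)"
  have adj: "adj (Suc m) m" using assms by auto
  have idem: "A m * A m = A m" using A_idem assms generic_mono by auto
  have A: "?K * A m = A m * ?K" by (rule A_K) simp
  have "eta' \<odot> VV (m+1) (m+2) = ch (m+2) (A (Suc m) * ?K * ?K)"
    using K2[of "Suc m"] by (simp add: VV_def mult.assoc)
  also have "\<dots> = ch (m+2) (?K * (A (Suc m) * ?K))" using ch_K[of "Suc m" "m+2"] by simp
  also have "?K * (A (Suc m) * ?K) = cc m \<odot> ((?K * A m) * X m * (A m * ?K))" using k by (simp add: mult.assoc)
  also have "\<dots> = cc m \<odot> (A m * (?K * X m * ?K) * A m)" by (simp add: A comm_left[OF A] mult.assoc)
  also have "?K * X m * ?K = (eta' + al m / \<mu> + be m) \<odot> ?K"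
    using K2[of "Suc m"] KSK[OF adj] KKK[OF adj] by (simp add: X_def distrib_left distrib_right sm_distribs)
  also have "cc m \<odot> (A m * ((eta' + al m / \<mu> + be m) \<odot> ?K) * A m) = (cc m * (eta' + al m / \<mu> + be m)) \<odot> (A m * ?K)"
    by (simp add: mult.assoc A idem_left[OF idem])
  also have "ch (m+2) \<dots> = (cc m * (eta' + al m / \<mu> + be m)) \<odot> (eta' \<odot> (ch m (A m) * gg))"
    using ch_mult_K[OF W_A[of m m]] assms by simp
  finally have "eta' \<odot> VV (m+1) (m+2) = eta' \<odot> ((cc m * (eta' + al m / \<mu> + be m)) \<odot> (aa m * gg))"
    using assms by (simp add: aa_def mult.commute)
  then show ?thesis by (rule ch_eq_cancel_eta)
qed

text \<open>Prepares \<open>contract\<close>: in each of the three terms of \<open>X k\<close> the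
  crossing \<open>S (k+2)\<close> is traded for \<open>K (k+2)\<close>, so that the pair
  \<open>K (k+1) * K (k+2)\<close> appears.\<close>

lemma slide: assumes "1 \<le> k"
  shows "K (Suc k) * X k * S (k+2) * K (Suc k) = K (Suc k) * K (k+2) *
    ((1/\<mu>) \<odot> 1 + (al k \<odot> (K k - lam \<odot> S k + (lam/\<mu>) \<odot> 1) + be k \<odot> S k)) * K (Suc k)"
proof -
  let ?K = "K (Suc k)" and ?L = "K (k+2)"
  have adj: "adj (Suc k) (k+2)" "adj (Suc k) k" using assms by auto
  have c: "K k * ?L = ?L * K k" "S k * ?L = ?L * S k" using assms by (auto intro!: KK_far SK_far)
  have 1: "?K * S (k+2) * ?K = (1/\<mu>) \<odot> (?K * ?L * ?K)" using KSK[OF adj(1)] KKK[OF adj(1)] by simp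
  have s: "S (k+2) * ?K = Si (Suc k) * ?L * ?K" by (rule SjK[OF adj(1)])
  have e1: "?K * K k = ?K * S k * S (Suc k)"
    using KKS'[of k "Suc k"] adj by auto
  have "?K * K k * S (k+2) * ?K = ?K * S k * (S (Suc k) * Si (Suc k)) * ?L * ?K"
    by (simp only: mult.assoc s) (simp only: mult.assoc[symmetric] e1)
  also have "\<dots> = ?K * ?L * S k * ?K" using S_Si[of "Suc k"] by (simp add: mult.assoc comm_left[OF c(2), simplified])
  finally have 2: "?K * K k * S (k+2) * ?K = ?K * ?L * S k * ?K" .
  have e2: "?K * S k * Si (Suc k) = ?K * K k - lam \<odot> (?K * S k) + (lam/\<mu>) \<odot> ?K"
    using KSK[OF adj(2)] e1 by (simp add: Si_eq algebra_simps)
  have "?K * S k * S (k+2) * ?K = ?K * S k * Si (Suc k) * ?L * ?K"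
    by (simp only: mult.assoc s)
  also have "\<dots> = (?K * (K k * ?L) - lam \<odot> (?K * (S k * ?L)) + (lam/\<mu>) \<odot> (?K * ?L)) * ?K" 
    unfolding e2 by (simp add: distrib_right left_diff_distrib mult.assoc)
  also have "\<dots> = ?K * ?L * (K k - lam \<odot> S k + (lam/\<mu>) \<odot> 1) * ?K" 
    unfolding c by (simp add: distrib_right distrib_left left_diff_distrib right_diff_distrib mult.assoc)
  finally have 3: "?K * S k * S (k+2) * ?K = ?K * ?L * (K k - lam \<odot> S k + (lam/\<mu>) \<odot> 1) * ?K" .
  have "?K * X k * S (k+2) * ?K = ?K * S (k+2) * ?K + (al k \<odot> (?K * S k * S (k+2) * ?K) + be k \<odot> (?K * K k * S (k+2) * ?K))"
    by (simp add: X_def distrib_left distrib_right)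
  then show ?thesis unfolding 1 2 3 by (simp add: distrib_left distrib_right)
qed

text \<open>Double the contraction, apply \<open>slide\<close> between the two copies, and send the
  right-hand contraction and \<open>A k\<close> round the trace. After \<open>contract\<close> the
  bracket of \<open>slide\<close> stands next to \<open>A k\<close>, and its terms in 1,
  \<open>S k\<close> and \<open>K k\<close> give T, U and V for m strands.\<close>

lemma V_recursion: assumes gen: "generic (Suc k)" and k: "1 \<le> k" "k < m"
  shows "VV (Suc k) (m + 2) = cc k \<odot> (((1 + al k * lam) / \<mu>) \<odot> TT k m + (be k - al k * lam) \<odot> UU k m + al k \<odot> VV k m) * gg"
proof -
  obtain l where l: "k = Suc l" using k by (cases k) auto
  let ?n = "m + 2" and ?K = "K (Suc k)" and ?r = "tail (k+2) (m+2)"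
  let ?Z = "(1/\<mu>) \<odot> 1 + (al k \<odot> (K k - lam \<odot> S k + (lam/\<mu>) \<odot> 1) + be k \<odot> S k)"
  have idem: "A k * A k = A k" using A_idem gen generic_mono by auto
  have AK: "?K * A k = A k * ?K" by (rule A_K) simp
  have AS: "S (k+2) * A k = A k * S (k+2)" by (rule A_S) simp
  have Ar: "A k * ?r = ?r * A k" by (rule tail_comm) (use A_S in auto)
  have Kr: "?K * ?r = ?r * ?K" by (rule tail_K) auto
  have Xr: "X k * ?r = ?r * X k" by (rule tail_comm) (rule sym, rule X_comm, use k in \<open>auto intro!: far'\<close>)
  have t: "tail (Suc k) ?n = ?r * S (k+2)" using tail_split[of "Suc k" ?n] k by simp
  have ZW: "?Z \<in> W (Suc k)" using k by (auto intro!: W_add W_sm W_diff W_1 W_K W_S)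
  have Zc: "?Z * S j = S j * ?Z" if "Suc k < j" for j
  proof -
    have "K k * S j = S j * K k" "S k * S j = S j * S k"
      using that k by (auto intro!: sym[OF SK_far] far')
    then show ?thesis by (simp add: distrib_left distrib_right left_diff_distrib right_diff_distrib)
  qed
  have "eta' \<odot> VV (Suc k) ?n = ch ?n (A (Suc k) * ?r * S (k+2) * ?K * ?K)"
    using K2[of "Suc k"] by (simp add: VV_def t[simplified] mult.assoc)
  also have "\<dots> = ch ?n (?K * (A (Suc k) * ?r * S (k+2) * ?K))"
    using ch_K[of "Suc k" ?n] k by simp
  also have "?K * (A (Suc k) * ?r * S (k+2) * ?K) = cc k \<odot> (A k * ?r * (?K * X k * S (k+2) * ?K) * A k)"
  proof -
    have "?K * (A k * (X k * (A k * (?r * (S (k+2) * ?K))))) = A k * (?r * (?K * (X k * (S (k+2) * (?K * A k)))))"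
      by (simp add: comm_left[OF AK] comm_left[OF Ar, simplified] comm_left[OF AS[symmetric], simplified]
          AK[symmetric] comm_left[OF Xr, simplified] comm_left[OF Kr, simplified])
    then show ?thesis using l by (simp add: mult.assoc)
  qed
  also have "\<dots> = cc k \<odot> (A k * ?r * ?K * K (k+2) * ?Z * ?K * A k)"
    unfolding slide[OF k(1)] by (simp add: mult.assoc)
  also have "ch ?n \<dots> = cc k \<odot> ch ?n (?K * A k * (A k * ?r * ?K * K (k+2) * ?Z))"
  proof -
    have "?K * A k \<in> W ?n" using k by (intro W_mult W_K W_A) auto
    from ch_cyc[OF this, of "A k * ?r * ?K * K (k+2) * ?Z"] show ?thesis by (simp add: mult.assoc)
  qed
  \<comment> \<open>The contraction that went round the trace meets the first one and yields the
    \<open>eta'\<close> that balances the doubling.\<close>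
  also have "?K * A k * (A k * ?r * ?K * K (k+2) * ?Z) = eta' \<odot> (A k * ?r * ?K * K (k+2) * ?Z)"
  proof -
    have "?K * A k * (A k * ?r * ?K * K (k+2) * ?Z) = ?K * (A k * A k) * ?r * ?K * K (k+2) * ?Z"
      by (simp only: mult.assoc)
    also have "\<dots> = A k * ?r * (?K * ?K) * K (k+2) * ?Z" unfolding idem by (simp add: mult.assoc comm_left[OF AK] comm_left[OF Kr, simplified])
    also have "?K * ?K = eta' \<odot> ?K" by (rule K2) simp
    finally show ?thesis by (simp add: mult.assoc)
  qed
  also have "ch ?n (eta' \<odot> (A k * ?r * ?K * K (k+2) * ?Z)) = eta' \<odot> ch ?n (?Z * A k * ?r * ?K * K (k+2))"
    using ch_cyc[OF W_mono[OF ZW], of ?n "A k * ?r * ?K * K (k+2)"] k by (simp only: ch_sm mult.assoc)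
  also have "ch ?n (?Z * A k * ?r * ?K * K (k+2)) = ch m (?Z * A k * tail k m) * gg"
  proof -
    have "ch ?n ((?Z * A k) * tail (Suc (Suc k)) ?n * K (Suc k) * K (Suc (Suc k))) = ch (?n - 2) ((?Z * A k) * tail (Suc k - 1) (?n - 2)) * gg"
    proof (rule contract)
      show "?Z * A k \<in> W (Suc k)" using ZW by (intro W_mult W_A) auto
      fix j assume j: "Suc k < j"
      have "A k * S j = S j * A k" using A_S[of k j] j by simp
      then show "?Z * A k * S j = S j * (?Z * A k)" using comm_mult[OF Zc[OF j, symmetric], of "A k"] by simp
    qed (use k in auto)
    then show ?thesis by simp
  qed
  also have "ch m (?Z * A k * tail k m) = ((1 + al k * lam) / \<mu>) \<odot> TT k m + (be k - al k * lam) \<odot> UU k m + al k \<odot> VV k m"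
  proof -
    have "tail (k - 1) m = tail k m * S k" using tail_split[of "k - 1" m] k by simp
    then have S: "ch m (S k * (A k * tail k m)) = UU k m"
      using ch_S[of k m "A k * tail k m"] k by (simp add: UU_def mult.assoc)
    have K: "ch m (K k * (A k * tail k m)) = VV k m"
      using ch_K[of k m "A k * tail k m"] k by (simp add: VV_def)
    have T: "ch m (A k * tail k m) = TT k m" by (simp add: TT_def)
    show ?thesis
      by (simp add: distrib_right left_diff_distrib mult.assoc ch_add ch_diff S K T)
        (simp add: sm_distribs add_divide_distrib algebra_simps)
  qed
  finally have "eta' \<odot> VV (Suc k) ?n = eta' \<odot> (cc k \<odot> (((1 + al k * lam) / \<mu>) \<odot> TT k m + (be k - al k * lam) \<odot> UU k m + al k \<odot> VV k m) * gg)"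
    by (simp add: mult.commute mult.left_commute)
  then show ?thesis by (rule ch_eq_cancel_eta)
qed

end

section \<open>Telescoping and the Newton relations\<close>

context bmw_trace begin

text \<open>The coefficient of the boundary term \<open>UU (Suc k) m\<close> in
  \<open>V_partial_sum\<close>; the last two identities of \<open>V_coeffs\<close> say that these
  coefficients telescope.\<close>

definition ee :: "nat \<Rightarrow> complex" where
  "ee k = (-1)^k * q^2 * qnum q (Suc k) * dd k / dd (Suc k)"

lemma dd_eq: "dd k = 1 + \<mu> * (q^k * q^k) / q"
  by (simp add: dd_def mult_2 power_add)

lemma be_cc: assumes "dd (Suc k) \<noteq> 0" "qnum q (Suc k) \<noteq> 0"
  shows "be (Suc k) * cc k = - (\<mu> * q ^ k * q ^ k * lam / dd (Suc k))"
  using assms q0 by (simp add: be_eq cc_def)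

text \<open>z is the weight of \<open>VV (Suc k) (m + 2)\<close> after \<open>V_recursion\<close>,
  and y the factor with which \<open>U_recursion'\<close> eliminates the \<open>VV k m\<close>
  produced there. The identities say in turn that V is eliminated, that T gets its weight in the
  Newton sum up to sign, and that the U terms telescope.\<close>

lemma V_coeffs:
  assumes "dd k \<noteq> 0" "dd (Suc k) \<noteq> 0" "qnum q (Suc k) \<noteq> 0" "1 \<le> k"
  defines "y \<equiv> (-1)^k * q^2 * dd k / dd (Suc k)" and "z \<equiv> (-q)^Suc k * (be (Suc k) * cc k)"
  shows "z * al k = y * (q^k * be k)"
    and "z * ((1 + al k * lam) / \<mu>) - y * q ^ k = - ((-q)^k)"
    and "z * (be k - al k * lam) + y * qnum q k = - ee (k - 1)"
    and "y * qnum q (Suc k) = ee k"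
proof -
  obtain l where l: "k = Suc l" using assms(4) by (cases k) auto
  define Q s where "Q = q ^ k" and "s = ((-1)^k :: complex)"
  have Q: "Q \<noteq> 0" using q0 by (simp add: Q_def)
  have Ql: "q ^ l = Q / q" using q0 by (simp add: Q_def l)
  have sl: "(-1) ^ l = - s" by (simp add: s_def l)
  have d: "dd k = 1 + \<mu> * (Q*Q) / q" "dd (Suc k) = 1 + \<mu> * (Q*Q) * q" "dd l = 1 + \<mu> * (Q*Q) / (q*q*q)"
    using q0 by (simp_all only: dd_eq power_Suc Ql) (simp_all add: Q_def)
  have n1: "q + \<mu> * (Q*Q) \<noteq> 0" using assms(1) q0 unfolding d by (auto simp: field_simps)
  have n2: "1 + \<mu> * (Q*Q) * q \<noteq> 0" using assms(2) unfolding d by simp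
  have mq: "(-q) ^ k = s * Q" "(-q) ^ Suc k = - s * q * Q" by (simp_all add: s_def Q_def power_minus[of q])
  have qn: "qnum q (Suc l) = (Q - 1/Q)/lam" "qnum q k = (Q - 1/Q)/lam" by (simp_all add: qnum_eq Q_def l)
  note e = qn d sl Q_def[symmetric] s_def[symmetric] power2_eq_square
  show "z * al k = y * (q^k * be k)"
    unfolding y_def z_def be_cc[OF assms(2,3)] al_eq be_eq[OF assms(1)] mq e using Q q0 lam_nz n1 n2 mu
    by (simp add: divide_simps)
  show "z * ((1 + al k * lam) / \<mu>) - y * q ^ k = - ((-q)^k)"
    unfolding y_def z_def be_cc[OF assms(2,3)] al_eq mq e using Q q0 lam_nz n1 n2 mu
    by (simp add: divide_simps) (simp add: lam_def field_simps)
  show "z * (be k - al k * lam) + y * qnum q k = - ee (k - 1)"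
    unfolding y_def z_def be_cc[OF assms(2,3)] al_eq be_eq[OF assms(1)] mq ee_def
    apply (simp only: l diff_Suc_1) apply (simp only: l[symmetric])
    unfolding e using Q q0 lam_nz n1 n2 mu
    by (simp add: divide_simps) (simp add: lam_def field_simps)
  show "y * qnum q (Suc k) = ee k" by (simp add: y_def ee_def)
qed

lemma U_recursion':
  assumes "generic (Suc i)" "1 \<le> i" "i < n"
  shows "(q^i * be i) \<odot> VV i n = qnum q (Suc i) \<odot> UU (Suc i) n - q^i \<odot> TT i n + qnum q i \<odot> UU i n"
proof -
  have qn: "qnum q (Suc i) \<noteq> 0" using genericD(2)[OF assms(1)] by simp
  have "qnum q (Suc i) \<odot> UU (Suc i) n = q^i \<odot> (TT i n + al i \<odot> UU i n + be i \<odot> VV i n)"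
    using U_recursion[of i n] generic_mono[OF assms(1)] assms qn by (simp add: cc_def)
  moreover have "q ^ i * al i = - qnum q i" using q0 by (simp add: al_eq)
  ultimately show ?thesis by (simp add: sm_add_right)
qed

text \<open>The new term is lowered to m strands by \<open>V_recursion\<close>, its V part is
  replaced through \<open>U_recursion'\<close>, and the old boundary term with \<open>ee j\<close>
  cancels.\<close>

lemma V_partial_sum:
  assumes gen: "generic (m + 1)"
  shows "j < m \<Longrightarrow> (\<Sum>i=1..Suc j. ((-q)^i * be i) \<odot> VV i (m + 2)) =
    (ee j \<odot> UU (Suc j) m - (\<Sum>i\<le>j. (-q)^i \<odot> TT i m)) * gg"
proof (induction j)
  case 0
  have d: "dd (Suc 0) \<noteq> 0" using genericD(1)[OF gen, of 1] 0 by simp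
  have qn: "qnum q (Suc 0) = 1" using lam_nz by (simp add: qnum_eq lam_def)
  have n2: "1 + \<mu> * q \<noteq> 0" using d q0 by (simp add: dd_def power2_eq_square)
  have c: "- (q * be (Suc 0)) / \<mu> = ee 0 - 1"
    unfolding ee_def be_eq[OF d] qn using d q0 mu n2
    by (simp add: dd_def power2_eq_square divide_simps) (simp add: lam_def field_simps)
  have V: "VV (Suc 0) (m+2) = (1/\<mu>) \<odot> (pp m * gg)" using V_1[of "m+2"] 0 by simp
  have U: "UU (Suc 0) m = pp m" "TT 0 m = pp m" using UU_1 by (simp_all add: TT_def pp_def)
  have "(\<Sum>i=1..Suc 0. ((-q)^i * be i) \<odot> VV i (m + 2)) = (- (q * be (Suc 0)) / \<mu>) \<odot> (pp m * gg)"
    using V by simp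
  also have "\<dots> = (ee 0 \<odot> UU (Suc 0) m - (\<Sum>i\<le>0. (-q)^i \<odot> TT i m)) * gg"
    unfolding c by (simp add: U sm_diff_left left_diff_distrib)
  finally show ?case .
next
  case (Suc j)
  let ?k = "Suc j"
  have d: "dd ?k \<noteq> 0" "dd (Suc ?k) \<noteq> 0" using genericD(1)[OF gen] Suc.prems by auto
  have qn: "qnum q (Suc ?k) \<noteq> 0" using genericD(2)[OF gen] Suc.prems by auto
  have g1: "generic (Suc ?k)" using gen Suc.prems generic_mono by auto
  define z where "z = (-q)^Suc ?k * (be (Suc ?k) * cc ?k)"
  define y where "y = (-1)^?k * q^2 * dd ?k / dd (Suc ?k)"
  have c1: "z * al ?k = y * (q^?k * be ?k)"
    and c2: "z * ((1 + al ?k * lam) / \<mu>) - y * q ^ ?k = - ((-q)^?k)"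
    and c3: "z * (be ?k - al ?k * lam) + y * qnum q ?k = - ee j"
    and c4: "y * qnum q (Suc ?k) = ee ?k"
    using V_coeffs[OF d qn] unfolding y_def z_def by simp_all
  have "((-q)^Suc ?k * be (Suc ?k)) \<odot> VV (Suc ?k) (m + 2) =
     z \<odot> (((1 + al ?k * lam) / \<mu>) \<odot> TT ?k m + (be ?k - al ?k * lam) \<odot> UU ?k m + al ?k \<odot> VV ?k m) * gg"
    using V_recursion[OF g1, of m] Suc.prems by (simp add: z_def mult.assoc)
  also have "z \<odot> (((1 + al ?k * lam) / \<mu>) \<odot> TT ?k m + (be ?k - al ?k * lam) \<odot> UU ?k m + al ?k \<odot> VV ?k m) 
     = (z * ((1 + al ?k * lam) / \<mu>)) \<odot> TT ?k m + (z * (be ?k - al ?k * lam)) \<odot> UU ?k m + (z * al ?k) \<odot> VV ?k m"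
    by (simp only: sm_add_right sm_sm)
  also have "(z * al ?k) \<odot> VV ?k m = y \<odot> ((q^?k * be ?k) \<odot> VV ?k m)" by (simp only: c1 sm_sm)
  also have "\<dots> = y \<odot> (qnum q (Suc ?k) \<odot> UU (Suc ?k) m - q^?k \<odot> TT ?k m + qnum q ?k \<odot> UU ?k m)"
    using U_recursion'[OF g1, of m] Suc.prems by simp
  also have "\<dots> = ee ?k \<odot> UU (Suc ?k) m - (y * q^?k) \<odot> TT ?k m + (y * qnum q ?k) \<odot> UU ?k m"
    by (simp only: sm_add_right sm_diff_right sm_sm c4)
  also have "(z * ((1 + al ?k * lam) / \<mu>)) \<odot> TT ?k m + (z * (be ?k - al ?k * lam)) \<odot> UU ?k m
     + (ee ?k \<odot> UU (Suc ?k) m - (y * q^?k) \<odot> TT ?k m + (y * qnum q ?k) \<odot> UU ?k m)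
     = ee ?k \<odot> UU (Suc ?k) m + (z * ((1 + al ?k * lam) / \<mu>) - y * q ^ ?k) \<odot> TT ?k m
       + (z * (be ?k - al ?k * lam) + y * qnum q ?k) \<odot> UU ?k m"
    by (simp only: sm_add_left sm_diff_left) (simp add: algebra_simps)
  also have "\<dots> = ee ?k \<odot> UU (Suc ?k) m - (-q)^?k \<odot> TT ?k m - ee j \<odot> UU ?k m"
    unfolding c2 c3 by simp
  finally have step: "((-q)^Suc ?k * be (Suc ?k)) \<odot> VV (Suc ?k) (m + 2) =
    (ee ?k \<odot> UU (Suc ?k) m - (-q)^?k \<odot> TT ?k m - ee j \<odot> UU ?k m) * gg" .
  have IH: "(\<Sum>i=1..Suc j. ((-q)^i * be i) \<odot> VV i (m + 2)) = (ee j \<odot> UU (Suc j) m - (\<Sum>i\<le>j. (-q)^i \<odot> TT i m)) * gg"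
    using Suc by simp
  have "(\<Sum>i=1..Suc ?k. ((-q)^i * be i) \<odot> VV i (m + 2)) = (\<Sum>i=1..Suc j. ((-q)^i * be i) \<odot> VV i (m + 2))
     + ((-q)^Suc ?k * be (Suc ?k)) \<odot> VV (Suc ?k) (m + 2)"
    by (rule sum.cl_ivl_Suc[of _ 1 ?k, THEN trans]) simp
  then show ?case unfolding step IH by (simp del: power_Suc add: left_diff_distrib distrib_right)
qed

text \<open>The part of the Newton sum \<open>NN n\<close> that does not telescope, see
  \<open>NN_eq\<close>.\<close>

definition SS :: "nat \<Rightarrow> 'e" where "SS n = (\<Sum>i=1..<n. ((-q)^i * be i) \<odot> VV i n)"
definition NN :: "nat \<Rightarrow> 'e" where "NN n = (\<Sum>i<n. (-q)^i \<odot> (aa i * pp (n - i)))"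

text \<open>This is \<open>U_recursion'\<close> summed with alternating signs: consecutive U terms
  cancel, the V terms accumulate.\<close>

lemma NN_partial: assumes gen: "generic n"
  shows "j < n \<Longrightarrow> (\<Sum>i\<le>j. (-q)^i \<odot> TT i n) =
    ((-1)^j * qnum q (Suc j)) \<odot> UU (Suc j) n - (\<Sum>i=1..j. ((-q)^i * be i) \<odot> VV i n)"
proof (induction j)
  case 0
  have qn: "qnum q (Suc 0) = 1" using lam_nz by (simp add: qnum_eq lam_def)
  show ?case using UU_1 qn by (simp add: TT_def pp_def)
next
  case (Suc j)
  have g1: "generic (Suc (Suc j))" using gen Suc.prems generic_mono by auto
  have "((-q)^Suc j * be (Suc j)) \<odot> VV (Suc j) n = (-1)^Suc j \<odot> ((q^Suc j * be (Suc j)) \<odot> VV (Suc j) n)"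
    by (simp add: power_minus[of q] ac_simps)
  also have "\<dots> = (-1)^Suc j \<odot> (qnum q (Suc (Suc j)) \<odot> UU (Suc (Suc j)) n - q^Suc j \<odot> TT (Suc j) n + qnum q (Suc j) \<odot> UU (Suc j) n)"
    using U_recursion'[OF g1, of n] Suc.prems by simp
  finally have "((-q)^Suc j * be (Suc j)) \<odot> VV (Suc j) n = ((-1)^Suc j * qnum q (Suc (Suc j))) \<odot> UU (Suc (Suc j)) n
     - (-q)^Suc j \<odot> TT (Suc j) n - ((-1)^j * qnum q (Suc j)) \<odot> UU (Suc j) n"
    by (simp add: sm_add_right sm_diff_right power_minus[of q j] mult.left_commute)
  then show ?case using Suc by (simp add: algebra_simps)
qed

lemma NN_eq: assumes "generic n" shows "NN n = (- ((-1)^n * qnum q n)) \<odot> aa n - SS n"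
proof (cases n)
  case 0 then show ?thesis by (simp add: NN_def SS_def qnum_def)
next
  case (Suc j)
  have "NN n = (\<Sum>i\<le>j. (-q)^i \<odot> TT i n)"
    unfolding NN_def Suc lessThan_Suc_atMost by (rule sum.cong) (auto simp: TT_eq)
  then show ?thesis using NN_partial[OF assms, of j] UU_n[of n] Suc
    by (simp add: SS_def atLeastLessThanSuc_atLeastAtMost)
qed

text \<open>Collects the three contributions to \<open>aa m * gg\<close> in \<open>SS_rec\<close>:
  the last summand of \<open>SS (m + 2)\<close> by \<open>V_last\<close>, the boundary term of
  \<open>V_partial_sum\<close>, and the top term of \<open>NN m\<close>.\<close>

lemma last_coeff: assumes "dd (Suc m) \<noteq> 0" "dd m \<noteq> 0" "qnum q (Suc m) \<noteq> 0" "1 \<le> m"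
  shows "(-q)^(m+1) * be (m+1) * (cc m * (eta' + al m / \<mu> + be m)) + ee (m - 1) + (-1)^m * qnum q m
     = - ((-1)^m * (\<mu> * q^m - q / q^m))"
proof -
  obtain l where l: "m = Suc l" using assms(4) by (cases m) auto
  define Q s where "Q = q ^ m" and "s = ((-1)^m :: complex)"
  have Q: "Q \<noteq> 0" using q0 by (simp add: Q_def)
  have Ql: "q ^ l = Q / q" using q0 by (simp add: Q_def l)
  have sl: "(-1) ^ l = - s" by (simp add: s_def l)
  have d: "dd m = 1 + \<mu> * (Q*Q) / q" "dd (Suc m) = 1 + \<mu> * (Q*Q) * q" "dd l = 1 + \<mu> * (Q*Q) / (q*q*q)"
    using q0 by (simp_all only: dd_eq power_Suc Ql) (simp_all add: Q_def)
  have n1: "q + \<mu> * (Q*Q) \<noteq> 0" using assms(2) q0 unfolding d by (auto simp: field_simps)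
  have n2: "1 + \<mu> * (Q*Q) * q \<noteq> 0" using assms(1) unfolding d by simp
  have mq: "(-q) ^ Suc m = - s * q * Q" by (simp_all add: s_def Q_def power_minus[of q])
  have qn: "qnum q m = (Q - 1/Q)/lam" by (simp_all add: qnum_eq Q_def)
  have e1: "ee (m - 1) = - s * q^2 * ((Q - 1/Q)/lam) * (1 + \<mu> * (Q*Q) / (q*q*q)) / (1 + \<mu> * (Q*Q) / q)"
    using qn d by (simp add: ee_def l sl)
  have e2: "(-q)^(m+1) * be (m+1) * (cc m * (eta' + al m / \<mu> + be m)) = 
      s * q * Q * (\<mu> * Q * Q * lam / (1 + \<mu> * (Q*Q) * q)) * ((q - \<mu>) * (1/q + \<mu>) / (\<mu> * lam) - (Q - 1/Q)/lam / Q / \<mu>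
        - (\<mu> * Q / q * lam * ((Q - 1/Q)/lam) / (1 + \<mu> * (Q*Q) / q)))"
  proof -
    have "(-q)^(m+1) * be (m+1) * (cc m * (eta' + al m / \<mu> + be m)) = (-q)^Suc m * (be (Suc m) * cc m) * (eta' + al m / \<mu> + be m)"
      by simp
    then show ?thesis unfolding be_cc[OF assms(1,3)] al_eq be_eq[OF assms(2)] mq eta'_def lam_def[symmetric]
       d qn Q_def[symmetric] by simp
  qed
  show ?thesis unfolding e1 e2 qn Q_def[symmetric] s_def[symmetric]
    using Q q0 lam_nz n1 n2 mu by (simp add: divide_simps) (simp add: lam_def field_simps power2_eq_square)
qed

text \<open>The summands with i at most m are lowered by \<open>V_partial_sum\<close>, whose T sum
  is the Newton sum \<open>NN m\<close> and thus reproduces \<open>SS m\<close> through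
  \<open>NN_eq\<close>; the summand i = m + 1 is evaluated by \<open>V_last\<close>.\<close>

lemma SS_rec: assumes gen: "generic (m + 2)"
  shows "SS (m + 2) = SS m * gg - ((-1)^m * (\<mu> * q^m - q / q^m)) \<odot> (aa m * gg)"
proof (cases "m = 0")
  case True
  \<comment> \<open>For m = 0 the only summand is \<open>VV 1 2\<close>, which is
    \<open>eta' \<odot> gg\<close> by the definition of \<open>gg\<close>.\<close>
  have d: "dd 1 \<noteq> 0" using genericD(1)[OF gen, of 1] by simp
  have n2: "1 + \<mu> * q \<noteq> 0" using d q0 by (simp add: dd_def power2_eq_square)
  have qn: "qnum q 1 = 1" using lam_nz by (simp add: qnum_eq lam_def)
  have c: "q * be 1 * eta' = \<mu> - q"
  proof -
    have "q * be 1 * eta' = - (q * (\<mu> * q / q * lam / dd 1)) * ((q - \<mu>) * (1/q + \<mu>) / (\<mu> * lam))"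
      by (simp add: be_eq[OF d] qn eta'_def lam_def[symmetric] del: One_nat_def)
    then show ?thesis using q0 n2 mu lam_nz by (simp add: dd_def power2_eq_square divide_simps)
  qed
  have V: "VV 1 2 = eta' \<odot> gg" using eta_nz by (simp add: VV_def gg_def)
  have "SS 2 = - ((q * be 1) \<odot> VV 1 2)" by (simp add: SS_def numeral_2_eq_2)
  also have "\<dots> = - ((q * be 1 * eta') \<odot> gg)" using V by (simp only: sm_sm sm_minus_left)
  also have "\<dots> = - ((\<mu> - q) \<odot> gg)" by (simp only: c)
  finally have "SS 2 = - ((\<mu> - q) \<odot> gg)" .
  moreover have "SS 0 = 0" by (simp add: SS_def)
  ultimately show ?thesis using True by (simp add: aa_def flip: numeral_2_eq_2)
next
  case False
  then obtain j where j: "m = Suc j" by (cases m) auto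
  have g1: "generic (m + 1)" "generic m" using gen generic_mono by auto
  have d: "dd m \<noteq> 0" "dd (Suc m) \<noteq> 0" using genericD(1)[OF gen] False by auto
  have qn: "qnum q (Suc m) \<noteq> 0" using genericD(2)[OF gen] by auto
  have NN: "(\<Sum>i\<le>j. (-q)^i \<odot> TT i m) = (- ((-1)^m * qnum q m)) \<odot> aa m - SS m"
  proof -
    have "NN m = (\<Sum>i\<le>j. (-q)^i \<odot> TT i m)"
      unfolding NN_def j lessThan_Suc_atMost by (rule sum.cong) (auto simp: TT_eq)
    then show ?thesis using NN_eq[OF g1(2)] by simp
  qed
  have "SS (m + 2) = (\<Sum>i=1..Suc j. ((-q)^i * be i) \<odot> VV i (m + 2)) + ((-q)^(m+1) * be (m+1)) \<odot> VV (m+1) (m+2)"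
    by (simp add: SS_def j atLeastLessThanSuc_atLeastAtMost)
  also have "\<dots> = (ee j \<odot> aa m + (((-1)^m * qnum q m) \<odot> aa m + SS m)) * gg
     + ((-q)^(m+1) * be (m+1) * (cc m * (eta' + al m / \<mu> + be m))) \<odot> (aa m * gg)"
  proof -
    have P: "(\<Sum>i=1..Suc j. ((-q)^i * be i) \<odot> VV i (m + 2)) = (ee j \<odot> UU (Suc j) m - (\<Sum>i\<le>j. (-q)^i \<odot> TT i m)) * gg"
      using V_partial_sum[OF g1(1), of j] j by simp
    have V: "VV (m + 1) (m + 2) = (cc m * (eta' + al m / \<mu> + be m)) \<odot> (aa m * gg)"
      using V_last[OF g1(1)] j by simp
    have U: "UU (Suc j) m = aa m" using UU_n[of m] j by simp
    show ?thesis unfolding P V U NN by (simp add: algebra_simps)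
  qed
  also have "\<dots> = SS m * gg + ((-q)^(m+1) * be (m+1) * (cc m * (eta' + al m / \<mu> + be m)) + ee j + (-1)^m * qnum q m) \<odot> (aa m * gg)"
    by (simp only: sm_add_left distrib_right sm_mult_left) (simp add: algebra_simps)
  also have "(-q)^(m+1) * be (m+1) * (cc m * (eta' + al m / \<mu> + be m)) + ee j + (-1)^m * qnum q m
     = - ((-1)^m * (\<mu> * q^m - q / q^m))"
    using last_coeff[OF d(2,1) qn] j by simp
  finally show ?thesis by simp
qed

text \<open>Eliminates \<open>SS\<close> between \<open>NN_eq\<close> and \<open>SS_rec\<close>; in
  this two-step form the Newton relation enters the Wronski argument.\<close>

lemma NN_rec: assumes gen: "generic (m + 2)"
  shows "NN (m + 2) = NN m * gg - ((-1)^m * qnum q (m+2)) \<odot> aa (m+2)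
    + ((-1)^m * (qnum q m + \<mu> * q^m - q / q^m)) \<odot> (aa m * gg)"
proof -
  have "generic m" using gen generic_mono by auto
  then show ?thesis
    by (simp add: NN_eq[OF gen, simplified] NN_eq SS_rec[OF gen, simplified] sm_distribs algebra_simps)
qed

text \<open>Iterates \<open>SS_rec\<close>, each step by two contributing one power of
  \<open>gg\<close>. Integer exponents are needed because 1 - n + 2i may be negative.\<close>

lemma SS_closed: "generic n \<Longrightarrow> SS n = - ((-1)^n \<odot> (\<Sum>i=1..n div 2.
     (\<mu> * q powi (int n - 2 * int i) - q powi (1 - int n + 2 * int i)) \<odot> (aa (n - 2 * i) * gg ^ i)))"
proof (induction n rule: less_induct)
  case (less n)
  show ?case
  proof (cases "n < 2")
    case True
    then have "n = 0 \<or> n = 1" by auto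
    then show ?thesis by (auto simp: SS_def)
  next
    case False
    then obtain m where n: "n = m + 2" by (metis add.commute le_Suc_ex not_less)
    let ?f = "\<lambda>n i. (\<mu> * q powi (int n - 2 * int i) - q powi (1 - int n + 2 * int i)) \<odot> (aa (n - 2 * i) * gg ^ i)"
    have IH: "SS m = - ((-1)^m \<odot> (\<Sum>i=1..m div 2. ?f m i))"
      using less.IH[of m] less.prems generic_mono n by auto
    have "(\<Sum>i=1..n div 2. ?f n i) = ?f n 1 + (\<Sum>i=Suc 1..Suc (m div 2). ?f n i)"
      using n by (subst sum.atLeast_Suc_atMost) auto
    also have "(\<Sum>i=Suc 1..Suc (m div 2). ?f n i) = (\<Sum>i=1..m div 2. ?f n (Suc i))"
      by (rule sum.shift_bounds_cl_Suc_ivl)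
    also have "\<dots> = (\<Sum>i=1..m div 2. ?f m i) * gg"
      unfolding sum_distrib_right
      by (rule sum.cong) (auto simp: n mult.assoc power_commutes algebra_simps)
    also have "?f n 1 = (\<mu> * q^m - q / q^m) \<odot> (aa m * gg)"
      using q0 by (simp add: n power_int_diff)
    finally have sum: "(\<Sum>i=1..n div 2. ?f n i) = (\<mu> * q^m - q / q^m) \<odot> (aa m * gg) + (\<Sum>i=1..m div 2. ?f m i) * gg" .
    have "SS n = SS m * gg - ((-1)^m * (\<mu> * q^m - q / q^m)) \<odot> (aa m * gg)"
      using SS_rec[of m] less.prems n by simp
    then show ?thesis unfolding sum IH by (simp only: n) (simp add: sm_add_right)
  qed
qed

lemma Newton: "generic n \<Longrightarrow> NN n = (- ((-1)^n * qnum q n)) \<odot> aa n + (-1)^n \<odot> (\<Sum>i=1..n div 2.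
     (\<mu> * q powi (int n - 2 * int i) - q powi (1 - int n + 2 * int i)) \<odot> (aa (n - 2 * i) * gg ^ i))"
  by (simp add: NN_eq SS_closed)

section \<open>Commutativity of the characteristic elements\<close>

text \<open>The block braid \<open>t\<^sup>m\<close> with \<open>t = S\<^sub>1 \<cdots> S\<^sub>n\<^sub>+\<^sub>m\<^sub>-\<^sub>1\<close> exchanges the first \<open>n\<close> with the last \<open>m\<close> strands.\<close>

definition tt :: "nat \<Rightarrow> 'e" where "tt k = word [1..<k]"

lemma tt_Suc: "1 \<le> k \<Longrightarrow> tt (Suc k) = tt k * S k"
  by (simp add: tt_def)

lemma tt_shift: "1 \<le> j \<Longrightarrow> Suc j < k \<Longrightarrow> tt k * S j = S (Suc j) * tt k"
proof (induction k)
  case (Suc k)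
  show ?case
  proof (cases "Suc j = k")
    case True
    then have t: "tt (Suc k) = tt j * S j * S (Suc j)"
      using Suc.prems tt_Suc[of j] tt_Suc[of k] by auto
    have c: "S (Suc j) * tt j = tt j * S (Suc j)"
      unfolding tt_def by (rule word_comm) (auto intro!: far')
    have "tt (Suc k) * S j = tt j * (S j * S (Suc j) * S j)" by (simp add: t mult.assoc)
    also have "\<dots> = S (Suc j) * tt (Suc k)" using braid[of j] Suc by (simp add: t comm_left[OF c] mult.assoc)
    finally show ?thesis .
  next
    case False
    then have k: "Suc j < k" using Suc by simp
    have "tt (Suc k) * S j = tt k * (S k * S j)" using k tt_Suc by (simp add: mult.assoc)
    also have "S k * S j = S j * S k" using k Suc by (intro far') auto
    also have "tt k * (S j * S k) = S (Suc j) * tt (Suc k)"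
      using Suc.IH k Suc.prems tt_Suc by (simp flip: mult.assoc)
    finally show ?thesis .
  qed
qed auto

lemma tt_word_shift: "set js \<subseteq> {1..<k - 1} \<Longrightarrow> tt k * word js = word (map Suc js) * tt k"
proof (induction js)
  case (Cons j js)
  then have "tt k * S j = S (Suc j) * tt k" by (intro tt_shift) auto
  then show ?case using Cons by (simp add: mult.assoc) (metis mult.assoc)
qed simp

text \<open>\<open>tt k\<close> cannot shift the last generator, but its square carries it to the
  first: write \<open>tt k\<close> once as \<open>tt (k - 1) * S (k - 1)\<close> and once as
  \<open>S 1\<close> times a shifted word, and compare.\<close>

lemma tt_last: assumes "2 \<le> k" shows "tt k * tt k * S (k - 1) = S 1 * (tt k * tt k)"
proof -
  obtain l where k: "k = Suc l" "1 \<le> l" using assms by (cases k) auto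
  have h: "tt k = S 1 * word (map Suc [1..<l])"
    using k upt_conv_Cons[of 1 k] by (simp add: tt_def map_Suc_upt del: upt_Suc)
  have tk: "tt k = tt l * S l" using k tt_Suc by simp
  have "tt k * tt k * S l = tt k * tt l * S l * S l" by (subst (2) tk) (simp only: mult.assoc)
  also have "tt k * tt l = word (map Suc [1..<l]) * tt k"
    unfolding tt_def[of l] by (rule tt_word_shift) (use k in auto)
  finally have a: "tt k * tt k * S l = word (map Suc [1..<l]) * tt k * S l * S l" .
  have "S 1 * (tt k * tt k) = S 1 * (word (map Suc [1..<l]) * (tt k * S l))"
  proof -
    have "tt k * tt k = tt k * tt l * S l" by (subst (2) tk) (simp only: mult.assoc)
    also have "tt k * tt l = word (map Suc [1..<l]) * tt k"
      unfolding tt_def[of l] by (rule tt_word_shift) (use k in auto)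
    finally show ?thesis by (simp add: mult.assoc)
  qed
  also have "\<dots> = tt k * tt k * S l" unfolding mult.assoc[symmetric] h[symmetric] ..
  finally show ?thesis using k by simp
qed

lemma tt_pow_up: "1 \<le> j \<Longrightarrow> j + m < k \<Longrightarrow> tt k ^ m * S j = S (j + m) * tt k ^ m"
proof (induction m)
  case (Suc m)
  have "tt k ^ Suc m * S j = tt k * (tt k ^ m * S j)" by (simp add: mult.assoc)
  also have "\<dots> = (tt k * S (j + m)) * tt k ^ m" using Suc by (simp add: mult.assoc)
  also have "\<dots> = S (j + Suc m) * tt k ^ Suc m" using tt_shift[of "j + m" k] Suc.prems by (simp add: mult.assoc)
  finally show ?case .
qed simp

text \<open>With d = m - j - 1, the first d factors shift \<open>S (n + j)\<close> to the last
  generator, two more wrap it round to \<open>S 1\<close>, and the remaining j - 1 take it to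
  \<open>S j\<close>.\<close>

lemma tt_pow_wrap: assumes "1 \<le> j" "j < m" shows "tt (n + m) ^ m * S (n + j) = S j * tt (n + m) ^ m"
proof -
  let ?t = "tt (n + m)"
  obtain d where d: "m = j + d + 1" using assms(2) by (metis less_iff_Suc_add add_Suc_right Suc_eq_plus1)
  obtain i where i: "j = Suc i" using assms(1) by (cases j) auto
  have m: "?t ^ m = ?t ^ i * (?t * ?t) * ?t ^ d"
  proof -
    have "m = i + (2 + d)" using d i by simp
    then show ?thesis by (simp only: power_add power2_eq_square mult.assoc)
  qed
  have "?t ^ d * S (n + j) = S (n + m - 1) * ?t ^ d" using tt_pow_up[of "n + j" d "n + m"] d i by (simp add: add.assoc)
  then have "?t ^ m * S (n + j) = ?t ^ i * (?t * ?t * S (n + m - 1)) * ?t ^ d" by (simp add: m mult.assoc)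
  also have "\<dots> = ?t ^ i * (S 1 * (?t * ?t)) * ?t ^ d" using tt_last[of "n + m"] d i by simp
  also have "\<dots> = (?t ^ i * S 1) * (?t * ?t) * ?t ^ d" by (simp add: mult.assoc)
  also have "?t ^ i * S 1 = S j * ?t ^ i" using tt_pow_up[of 1 i "n + m"] i d by simp
  finally show ?thesis by (simp add: m mult.assoc)
qed

lemma tt_inv: "\<exists>u. tt k * u = 1 \<and> u * tt k = 1"
proof (induction k)
  case 0 then show ?case by (auto simp: tt_def)
next
  case (Suc k)
  then obtain u where u: "tt k * u = 1" "u * tt k = 1" by auto
  show ?case
  proof (cases "k = 0")
    case True then show ?thesis by (auto simp: tt_def)
  next
    case False
    have "tt k * (S k * (Si k * u)) = 1" "Si k * (u * (tt k * S k)) = 1"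
      using False u S_Si[of k] Si_S[of k] by (simp_all flip: mult.assoc)
    then show ?thesis using False tt_Suc[of k] by (intro exI[of _ "Si k * u"]) (auto simp: mult.assoc)
  qed
qed

lemma tt_pow_inv: "\<exists>u. tt k ^ m * u = 1 \<and> u * tt k ^ m = 1"
proof -
  obtain u where u: "tt k * u = 1" "u * tt k = 1" using tt_inv by blast
  have "tt k ^ m * u ^ m = 1" "u ^ m * tt k ^ m = 1"
    using u left_right_inverse_power by blast+
  then show ?thesis by blast
qed

text \<open>Conjugation by \<open>tt (n + m) ^ m\<close> turns the juxtaposition of js and ls into
  that of ls and js, and the trace is invariant under it.\<close>

lemma ch_word_comm:
  assumes nm: "1 \<le> n" "1 \<le> m" and js: "set js \<subseteq> {1..<n}" and ls: "set ls \<subseteq> {1..<m}"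
  shows "ch n (word js) * ch m (word ls) = ch m (word ls) * ch n (word js)"
proof -
  let ?t = "tt (n + m) ^ m"
  have "tt (n + m) \<in> W (n + m)" unfolding tt_def by (rule W_word) auto
  then have tW: "tt (n + m) ^ i \<in> W (n + m)" for i by (induction i) (auto intro: W_mult W_1)
  obtain u where u: "?t * u = 1" "u * ?t = 1" using tt_pow_inv by blast
  have 1: "?t * word js = word (map (\<lambda>j. j + m) js) * ?t"
    using js
  proof (induction js)
    case (Cons j js)
    have "?t * S j = S (j + m) * ?t" using Cons.prems by (intro tt_pow_up) auto
    then have "?t * (S j * word js) = S (j + m) * (?t * word js)" by (simp flip: mult.assoc)
    then show ?case using Cons by (simp add: mult.assoc)
  qed simp
  have 2: "?t * word (map (\<lambda>l. l + n) ls) = word ls * ?t"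
    using ls
  proof (induction ls)
    case (Cons j js)
    have "?t * S (j + n) = S j * ?t" using tt_pow_wrap[of j m n] Cons.prems by (simp add: add.commute)
    then have "?t * (S (j + n) * word (map (\<lambda>l. l + n) js)) = S j * (?t * word (map (\<lambda>l. l + n) js))" by (simp flip: mult.assoc)
    then show ?case using Cons by (simp add: mult.assoc)
  qed simp
  have c: "word (map (\<lambda>j. j + m) js) * word ls = word ls * word (map (\<lambda>j. j + m) js)"
  proof (rule word_comm)
    fix l assume l: "l \<in> set ls"
    show "word (map (\<lambda>j. j + m) js) * S l = S l * word (map (\<lambda>j. j + m) js)"
    proof (rule sym, rule word_comm)
      fix j' assume "j' \<in> set (map (\<lambda>j. j + m) js)"
      then obtain j where j: "j \<in> set js" "j' = j + m" by auto
      have "1 \<le> j" "1 \<le> l" "l < m" using j(1) js l ls by (auto simp: subset_iff)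
      then show "S l * S j' = S j' * S l" using j(2) by (intro far') auto
    qed
  qed
  have "ch n (word js) * ch m (word ls) = ch (n + m) (word js * word (map (\<lambda>l. l + n) ls))"
    using ch_word nm js ls by simp
  also have "\<dots> = ch (n + m) (word js * word (map (\<lambda>l. l + n) ls) * u * ?t)"
    using u by (simp add: mult.assoc)
  also have "\<dots> = ch (n + m) (?t * (word js * word (map (\<lambda>l. l + n) ls) * u))"
    using ch_cyc[OF tW] by simp
  also have "?t * (word js * word (map (\<lambda>l. l + n) ls) * u) = (?t * word js) * word (map (\<lambda>l. l + n) ls) * u"
    by (simp only: mult.assoc)
  also have "\<dots> = word (map (\<lambda>j. j + m) js) * word ls * (?t * u)"
    unfolding 1 mult.assoc by (subst 2[unfolded mult.assoc[symmetric], THEN arg_cong[of _ _ "\<lambda>z. z * u"], unfolded mult.assoc]) (rule refl)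
  also have "\<dots> = word ls * word (map (\<lambda>j. j + m) js)" unfolding u using c by simp
  also have "ch (n + m) \<dots> = ch m (word ls) * ch n (word js)"
    using ch_word[OF nm(2,1) ls js] by (simp add: add.commute)
  finally show ?thesis .
qed

lemma ch_comm:
  assumes nm: "1 \<le> n" "1 \<le> m" and x: "x \<in> W n" and y: "y \<in> W m"
  shows "ch n x * ch m y = ch m y * ch n x"
  using x
proof (induction rule: W.induct)
  case (W_word js)
  from y show ?case
    by (induction rule: W.induct) (auto simp: ch_word_comm[OF nm W_word, simplified] ch_add distrib_left distrib_right)
qed (auto simp: ch_add distrib_left distrib_right)

end

section \<open>Wronski relations\<close>

text \<open>Both groupings of the sum of \<open>(-q)\<^sup>i q\<^sup>-\<^sup>k a\<^sub>i p\<^sub>j s\<^sub>k\<close> over \<open>i + j + k = m\<close>, \<open>j \<ge> 1\<close>, are evaluated by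
  the Newton relations; comparing them gives a two-term recursion for the Wronski sums.\<close>

lemma (in complex_alg) wronski_of_newton:
  fixes a s p NN MM :: "nat \<Rightarrow> 'e" and g :: 'e and q \<mu> :: complex
  assumes q: "q \<noteq> 0" "q - 1/q \<noteq> 0"
    and NN: "\<And>n. NN n = (\<Sum>i<n. (-q)^i \<odot> (a i * p (n - i)))"
    and MM: "\<And>n. MM n = (\<Sum>i<n. (1/q)^i \<odot> (s i * p (n - i)))"
    and NN_rec: "\<And>l. l + 2 \<le> n \<Longrightarrow> NN (l + 2) = NN l * g - ((-1)^l * qnum q (l+2)) \<odot> a (l+2)
        + ((-1)^l * (qnum q l + \<mu> * q^l - q / q^l)) \<odot> (a l * g)"
    and MM_rec: "\<And>l. l + 2 \<le> n \<Longrightarrow> MM (l + 2) = MM l * g + qnum q (l+2) \<odot> s (l+2)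
        + (\<mu> / q^l + q^l / q - qnum q l) \<odot> (s l * g)"
    and one: "a 0 = 1" "s 0 = 1" "1 \<le> n \<Longrightarrow> p 1 = a 1" "1 \<le> n \<Longrightarrow> p 1 = s 1"
    and comm: "\<And>i j. 1 \<le> i \<Longrightarrow> i + j \<le> n \<Longrightarrow> p i * s j = s j * p i" "\<And>j. g * s j = s j * g"
    and qn: "\<And>m. 1 \<le> m \<Longrightarrow> m \<le> n \<Longrightarrow> qnum q m \<noteq> 0"
    and m: "m \<le> n"
  shows "(\<Sum>i\<le>m. (-1)^i \<odot> (a i * s (m - i))) = (if m = 0 then 1 else 0) - (if m = 2 then g else 0)"
  using m
proof (induction m rule: less_induct)
  case (less m)
  let ?c = "1/q"
  define w where "w m = (\<Sum>i\<le>m. (-1)^i \<odot> (a i * s (m - i)))" for m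
  define X where "X m = (\<Sum>k\<le>m. ?c^k \<odot> (NN (m - k) * s k))" for m
  consider "m = 0" | "m = 1" | l where "m = l + 2"
    by (metis One_nat_def add_2_eq_Suc' not0_implies_Suc)
  then show ?case
  proof cases
    case 1 then show ?thesis using one by simp
  next
    case 2 then show ?thesis using one less.prems by simp
  next
    case 3
    define t :: "nat \<Rightarrow> nat \<Rightarrow> 'e" where "t i k = a i * s k" for i k
    \<comment> \<open>The other grouping: exchange the sums over i and k, then move s past p, which
      is where commutativity enters.\<close>
    have X_alt: "X m = (\<Sum>i\<le>m. (-q)^i \<odot> (a i * MM (m - i)))" if "m \<le> n" for m
    proof -
      define f where "f k i = (?c^k * (-q)^i) \<odot> (a i * p (m - k - i) * s k)" for k i
      have "X m = (\<Sum>k\<le>m. \<Sum>i\<in>{i. i \<in> {..m} \<and> i + k < m}. f k i)"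
        unfolding X_def
      proof (rule sum.cong)
        fix k
        have "?c^k \<odot> (NN (m - k) * s k) = (\<Sum>i<m - k. f k i)"
          by (simp add: NN f_def sum_distrib_right sm_sum_right)
        also have "{..<m - k} = {i. i \<in> {..m} \<and> i + k < m}" by auto
        finally show "?c^k \<odot> (NN (m - k) * s k) = (\<Sum>i\<in>{i. i \<in> {..m} \<and> i + k < m}. f k i)" .
      qed simp
      also have "\<dots> = (\<Sum>i\<le>m. \<Sum>k\<in>{k. k \<in> {..m} \<and> i + k < m}. f k i)"
        by (rule sum.swap_restrict) auto
      also have "\<dots> = (\<Sum>i\<le>m. (-q)^i \<odot> (a i * MM (m - i)))"
      proof (rule sum.cong)
        fix i
        have "(-q)^i \<odot> (a i * MM (m - i)) = (\<Sum>k<m - i. f k i)"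
          unfolding MM sum_distrib_left sm_sum_right
        proof (rule sum.cong)
          fix k assume k: "k \<in> {..<m - i}"
          have "s k * p (m - i - k) = p (m - k - i) * s k"
            using comm(1)[of "m - i - k" k] k that by (simp add: diff_commute add.commute)
          then show "(-q)^i \<odot> (a i * ?c^k \<odot> (s k * p (m - i - k))) = f k i"
            by (simp add: f_def mult.assoc mult.commute)
        qed simp
        also have "{..<m - i} = {k. k \<in> {..m} \<and> i + k < m}" by auto
        finally show "(\<Sum>k\<in>{k. k \<in> {..m} \<and> i + k < m}. f k i) = (-q)^i \<odot> (a i * MM (m - i))" by simp
      qed simp
      finally show ?thesis .
    qed
    have NN1: "NN 0 = 0" "NN 1 = a 1" "MM 0 = 0" "MM 1 = s 1"
      using one less.prems 3 by (simp_all add: NN MM)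
    have qn01: "qnum q 0 = 0" "qnum q 1 = 1" using q by (simp_all add: qnum_def)
    define L where "L = q - 1/q"
    have qe: "qnum q n = (q^n - 1/q^n) / L" and L: "L \<noteq> 0" for n
      using q(2) by (simp_all add: qnum_def L_def power_one_over)
    have ln: "l + 2 \<le> n" using 3 less.prems by simp
    have sg: "x * g * s k = x * s k * g" for x k by (simp add: mult.assoc comm(2))
    define u where "u i = (-1)^i * (qnum q i + \<mu> * q^i - q / q^i)" for i
    define v where "v i = \<mu> / q^i + q^i / q - qnum q i" for i
    \<comment> \<open>\<open>NN_rec\<close> starts in degree 2: the summand with \<open>NN 0\<close>
      vanishes and the one with \<open>NN 1\<close> is kept apart.\<close>
    have "X m = (\<Sum>k\<le>l. ?c^k \<odot> (NN (l - k + 2) * s k)) + ?c^(l+1) \<odot> (a 1 * s (l+1))"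
      unfolding X_def 3 using NN1 by (simp add: Suc_diff_le numeral_2_eq_2)
    also have "(\<Sum>k\<le>l. ?c^k \<odot> (NN (l - k + 2) * s k)) = (\<Sum>k\<le>l. ?c^k \<odot> (NN (l - k) * s k) * g
        - (?c^k * ((-1)^(l-k) * qnum q (l - k + 2))) \<odot> t (l - k + 2) k + (?c^k * u (l - k)) \<odot> t (l - k) k * g)"
    proof (rule sum.cong)
      fix k assume "k \<in> {..l}"
      then have "NN (l - k + 2) = NN (l - k) * g - ((-1)^(l-k) * qnum q (l-k+2)) \<odot> a (l-k+2) + u (l-k) \<odot> (a (l-k) * g)"
        unfolding u_def using ln by (intro NN_rec) auto
      then show "?c^k \<odot> (NN (l - k + 2) * s k) = ?c^k \<odot> (NN (l - k) * s k) * g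
        - (?c^k * ((-1)^(l-k) * qnum q (l - k + 2))) \<odot> t (l - k + 2) k + (?c^k * u (l - k)) \<odot> t (l - k) k * g"
        by (simp only: distrib_right left_diff_distrib sm_add_right sm_diff_right sm_mult_left sg sm_sm t_def)
    qed simp
    also have "\<dots> = X l * g - (\<Sum>k\<le>l. (?c^k * ((-1)^(l-k) * qnum q (l - k + 2))) \<odot> t (l - k + 2) k)
       + (\<Sum>k\<le>l. (?c^k * u (l - k)) \<odot> t (l - k) k) * g"
      by (simp only: sum.distrib sum_subtractf X_def sum_distrib_right)
    finally have X1: "X m = X l * g - (\<Sum>k\<le>l. (?c^k * ((-1)^(l-k) * qnum q (l - k + 2))) \<odot> t (l - k + 2) k)
       + (\<Sum>k\<le>l. (?c^k * u (l - k)) \<odot> t (l - k) k) * g + ?c^(l+1) \<odot> t 1 (l+1)" by (simp add: t_def)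
    \<comment> \<open>The summand i = 0 is zero because 0_q = 0, and i = 1 is the summand kept apart
      above.\<close>
    have main1: "(\<Sum>i\<le>l+2. (?c^(l + 2 - i) * ((-1)^i * qnum q i)) \<odot> t i (l + 2 - i)) =
       (\<Sum>k\<le>l. (?c^k * ((-1)^(l-k) * qnum q (l - k + 2))) \<odot> t (l - k + 2) k) - ?c^(l+1) \<odot> t 1 (l+1)"
    proof -
      have "(\<Sum>i\<le>l+2. (?c^(l + 2 - i) * ((-1)^i * qnum q i)) \<odot> t i (l + 2 - i)) =
        (\<Sum>k\<le>l+2. (?c^k * ((-1)^(l + 2 - k) * qnum q (l + 2 - k))) \<odot> t (l + 2 - k) k)"
        by (rule sum.reindex_bij_witness[of _ "\<lambda>k. l + 2 - k" "\<lambda>k. l + 2 - k"]) auto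
      also have "\<dots> = (\<Sum>k\<le>l. (?c^k * ((-1)^(l + 2 - k) * qnum q (l + 2 - k))) \<odot> t (l + 2 - k) k) - ?c^(l+1) \<odot> t 1 (l+1)"
        using qn01 by (simp add: numeral_2_eq_2)
      also have "(\<Sum>k\<le>l. (?c^k * ((-1)^(l + 2 - k) * qnum q (l + 2 - k))) \<odot> t (l + 2 - k) k) =
         (\<Sum>k\<le>l. (?c^k * ((-1)^(l-k) * qnum q (l - k + 2))) \<odot> t (l - k + 2) k)"
        by (rule sum.cong) (auto simp: Suc_diff_le)
      finally show ?thesis .
    qed
    have re1: "(\<Sum>k\<le>l. (?c^k * u (l - k)) \<odot> t (l - k) k) = (\<Sum>i\<le>l. (?c^(l-i) * u i) \<odot> t i (l - i))"
      by (rule sum.reindex_bij_witness[of _ "\<lambda>k. l - k" "\<lambda>k. l - k"]) auto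
    have "X m = (\<Sum>i\<le>l. (-q)^i \<odot> (a i * MM (l - i + 2))) + (-q)^(l+1) \<odot> (a (l+1) * s 1)"
      unfolding X_alt[OF less.prems] unfolding 3 using NN1 by (simp add: Suc_diff_le numeral_2_eq_2)
    also have "(\<Sum>i\<le>l. (-q)^i \<odot> (a i * MM (l - i + 2))) = (\<Sum>i\<le>l. (-q)^i \<odot> (a i * MM (l - i)) * g
        + ((-q)^i * qnum q (l - i + 2)) \<odot> t i (l - i + 2) + ((-q)^i * v (l - i)) \<odot> t i (l - i) * g)"
    proof (rule sum.cong)
      fix i assume "i \<in> {..l}"
      then have "MM (l - i + 2) = MM (l - i) * g + qnum q (l-i+2) \<odot> s (l-i+2) + v (l-i) \<odot> (s (l-i) * g)"
        unfolding v_def using ln by (intro MM_rec) auto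
      then show "(-q)^i \<odot> (a i * MM (l - i + 2)) = (-q)^i \<odot> (a i * MM (l - i)) * g
        + ((-q)^i * qnum q (l - i + 2)) \<odot> t i (l - i + 2) + ((-q)^i * v (l - i)) \<odot> t i (l - i) * g"
        by (simp only: distrib_left sm_add_right sm_mult_left sm_mult_right sm_sm t_def mult.assoc)
    qed simp
    also have "\<dots> = X l * g + (\<Sum>i\<le>l. ((-q)^i * qnum q (l - i + 2)) \<odot> t i (l - i + 2))
       + (\<Sum>i\<le>l. ((-q)^i * v (l - i)) \<odot> t i (l - i)) * g"
      using X_alt[of l] ln by (simp only: sum.distrib sum_distrib_right)
    finally have X2: "X m = X l * g + (\<Sum>i\<le>l. ((-q)^i * qnum q (l - i + 2)) \<odot> t i (l - i + 2))
       + (\<Sum>i\<le>l. ((-q)^i * v (l - i)) \<odot> t i (l - i)) * g + (-q)^(l+1) \<odot> t (l+1) 1" by (simp add: t_def)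
    have main2: "(\<Sum>i\<le>l+2. ((-q)^i * qnum q (l + 2 - i)) \<odot> t i (l + 2 - i)) =
       (\<Sum>i\<le>l. ((-q)^i * qnum q (l - i + 2)) \<odot> t i (l - i + 2)) + (-q)^(l+1) \<odot> t (l+1) 1"
      using qn01 by (simp add: numeral_2_eq_2 Suc_diff_le)
    have "(\<Sum>i\<le>l+2. ((-q)^i * qnum q (l + 2 - i)) \<odot> t i (l + 2 - i)) +
       (\<Sum>i\<le>l+2. (?c^(l + 2 - i) * ((-1)^i * qnum q i)) \<odot> t i (l + 2 - i)) =
       ((\<Sum>i\<le>l. (?c^(l-i) * u i) \<odot> t i (l - i)) - (\<Sum>i\<le>l. ((-q)^i * v (l - i)) \<odot> t i (l - i))) * g"
      unfolding main1 main2 left_diff_distrib re1[symmetric] using X1 X2 by (simp add: algebra_simps)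
    also have "(\<Sum>i\<le>l+2. ((-q)^i * qnum q (l + 2 - i)) \<odot> t i (l + 2 - i)) +
       (\<Sum>i\<le>l+2. (?c^(l + 2 - i) * ((-1)^i * qnum q i)) \<odot> t i (l + 2 - i)) = qnum q (l+2) \<odot> w (l+2)"
      unfolding sum.distrib[symmetric] w_def sm_sum_right
    proof (rule sum.cong)
      fix i assume i: "i \<in> {..l+2}"
      define k where "k = l + 2 - i"
      have ik: "l + 2 = i + k" using i by (simp add: k_def)
      \<comment> \<open>The addition rule q^i k_q + q^(-k) i_q = (i+k)_q.\<close>
      have "(-q)^i * qnum q k + ?c^k * ((-1)^i * qnum q i) = qnum q (i + k) * (-1)^i"
        unfolding qe power_minus[of q i] power_one_over power_add
        using q(1) L by (simp add: divide_simps) (simp add: algebra_simps)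
      then show "((-q)^i * qnum q (l + 2 - i)) \<odot> t i (l + 2 - i) + (?c^(l + 2 - i) * ((-1)^i * qnum q i)) \<odot> t i (l + 2 - i)
        = qnum q (l + 2) \<odot> (-1)^i \<odot> (a i * s (l + 2 - i))"
        unfolding k_def[symmetric] ik by (simp add: t_def flip: sm_add_left)
    qed simp
    also have "(\<Sum>i\<le>l. (?c^(l-i) * u i) \<odot> t i (l - i)) - (\<Sum>i\<le>l. ((-q)^i * v (l - i)) \<odot> t i (l - i))
      = (qnum q l - q / q^l - q^l / q) \<odot> w l"
      unfolding sum_subtractf[symmetric] w_def sm_sum_right
    proof (rule sum.cong)
      fix i assume i: "i \<in> {..l}"
      define k where "k = l - i"
      have ik: "l = i + k" using i by (simp add: k_def)
      \<comment> \<open>The \<mu> terms of u and v cancel; apart from the sign, what remains depends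
        on i + k only.\<close>
      have "?c^k * u i - (-q)^i * v k = (qnum q (i + k) - q / q^(i+k) - q^(i+k) / q) * (-1)^i"
        unfolding qe u_def v_def power_minus[of q i] power_one_over power_add
        using q(1) L by (simp add: divide_simps) (simp add: algebra_simps)
      then show "(?c^(l-i) * u i) \<odot> t i (l - i) - ((-q)^i * v (l - i)) \<odot> t i (l - i) = (qnum q l - q / q^l - q^l / q) \<odot> (-1)^i \<odot> (a i * s (l - i))"
        unfolding k_def[symmetric] unfolding ik by (simp add: t_def flip: sm_diff_left)
    qed simp
    finally have rec: "qnum q (l+2) \<odot> w (l+2) = (qnum q l - q / q^l - q^l / q) \<odot> w l * g" .
    have IH: "w l = (if l = 0 then 1 else 0) - (if l = 2 then g else 0)"
      unfolding w_def using less.IH[of l] 3 less.prems by simp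
    have nz: "qnum q (l+2) \<noteq> 0" using qn[of "l+2"] ln by simp
    have target: "w (l + 2) = (if l = 0 then - g else 0)"
    proof (cases "l = 0")
      case True
      have "qnum q 2 = q + 1/q" using q by (simp add: qnum_def power2_eq_square square_diff_square_factored[symmetric] field_simps)
      then have c: "qnum q l - q / q^l - q^l / q = - qnum q (l + 2)"
        using True qn01 by (simp add: numeral_2_eq_2)
      have "qnum q (l+2) \<odot> w (l+2) = qnum q (l+2) \<odot> (- g)"
        using rec IH True unfolding c by simp
      then show ?thesis using nz True sm_cancel[OF nz] by (metis (full_types))
    next
      case False
      \<comment> \<open>For l = 2 the sum \<open>w l\<close> is \<open>- g\<close>, but its
        coefficient 2_q - 1/q - q vanishes; for every other l > 0 already \<open>w l\<close> is
        0.\<close>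
      have "qnum q 2 - q / q^2 - q^2 / q = 0" using q by (simp add: qnum_def power2_eq_square field_simps)
      then have "qnum q (l+2) \<odot> w (l+2) = qnum q (l+2) \<odot> 0"
        using rec IH False by (cases "l = 2") auto
      then show ?thesis using False sm_cancel[OF nz] by (metis (full_types))
    qed
    then show ?thesis unfolding w_def using 3 by auto
  qed
qed

section \<open>Duality between antisymmetrizers and symmetrizers\<close>

text \<open>A separate locale, since a sublocale declaration for \<open>bmw_trace\<close> itself would iterate the passage
  from \<open>q\<close> to \<open>-1/q\<close> forever.\<close>

locale bmw_trace_dual = bmw_trace sw q \<mu> S Si K ch
  for sw :: "complex \<Rightarrow> 'e::ring_1" and q \<mu> S Si K ch
begin

text \<open>The relations of \<open>bmw\<close> contain q only through q - 1/q, which is unchanged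
  under q to -1/q, and the two excluded values of \<mu> that depend on q change places.\<close>

lemma dual_mult: "- (1/(- (1/q))) = q" "- (1/q) - 1/(- (1/q)) = q - 1/q" by simp_all

sublocale dual: bmw_trace sw "- (1/q)" \<mu> S Si K ch
proof unfold_locales
  show "- (1/q) \<noteq> 0" "- (1/q) \<noteq> 1" "- (1/q) \<noteq> -1" using q0 q2 by (auto simp: field_simps)
  show "\<mu> \<noteq> 0" "\<mu> \<noteq> - (1/q)" "\<mu> \<noteq> - (1 / (- (1/q)))" using mu q0 by auto
qed (use far braid quad SK S_Si Si_S KK0 KKi0 KKK0 ch_add ch_S ch_word in \<open>auto simp: dual_mult add.commute\<close>)

lemma dual_eta: "dual.eta' = eta'" 
proof -
  have "(- (1/q) - \<mu>) * (1/(- (1/q)) + \<mu>) = (q - \<mu>) * (1/q + \<mu>)"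
    by (simp add: algebra_simps diff_divide_distrib)
  then show ?thesis unfolding eta'_def dual.eta'_def dual_mult by simp
qed

lemma dual_gg: "dual.gg = gg" by (simp add: gg_def dual.gg_def dual_eta)

lemma dual_qnum: "qnum (- (1/q)) k = (-1)^k * - qnum q k"
  by (simp add: qnum_def power_minus[of q] power_minus[of "1/q"] power_one_over divide_simps)
    (simp add: algebra_simps)

lemma signed_dual_qnum: "(-1)^l * qnum (- (1/q)) l = - qnum q l"
  by (simp add: dual_qnum flip: mult.assoc power_mult_distrib)

lemma dual_NN_rec: assumes "dual.generic (l + 2)"
  shows "dual.NN (l + 2) = dual.NN l * gg + qnum q (l+2) \<odot> dual.aa (l+2)
        + (\<mu> / q^l + q^l / q - qnum q l) \<odot> (dual.aa l * gg)"
proof -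
  have 1: "(-1)^l * qnum (- (1/q)) (l+2) = - qnum q (l+2)"
    using signed_dual_qnum[of "l+2"] by simp
  have s: "(-1)^l * (-1)^l = (1::complex)" by (simp flip: power_mult_distrib)
  have 2: "(-1)^l * (qnum (- (1/q)) l + \<mu> * (- (1/q))^l - (- (1/q)) / (- (1/q))^l)
     = \<mu> / q^l + q^l / q - qnum q l"
  proof -
    have "(-1)^l * (qnum (- (1/q)) l + \<mu> * (- (1/q))^l - (- (1/q)) / (- (1/q))^l)
      = (-1)^l * qnum (- (1/q)) l + ((-1)^l * (-1)^l) * \<mu> / q^l + ((-1)^l / (-1)^l) * (q^l / q)"
      by (simp add: power_minus[of "1/q"] power_one_over algebra_simps)
    then show ?thesis unfolding signed_dual_qnum s by simp
  qed
  show ?thesis using dual.NN_rec[OF assms] unfolding 1 2 dual_gg by simp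
qed

lemma dual_Newton: assumes "dual.generic n"
  shows "(\<Sum>i<n. (1/q)^i \<odot> (dual.aa i * pp (n - i))) = qnum q n \<odot> dual.aa n + (\<Sum>i=1..n div 2.
     (\<mu> * q powi (2 * int i - int n) + q powi (int n - 2 * int i - 1)) \<odot> (dual.aa (n - 2 * i) * gg ^ i))"
proof -
  have "(\<Sum>i<n. (1/q)^i \<odot> (dual.aa i * pp (n - i))) = dual.NN n"
    by (simp add: dual.NN_def)
  also have "\<dots> = qnum q n \<odot> dual.aa n + (-1)^n \<odot> (\<Sum>i=1..n div 2.
     (\<mu> * (- (1/q)) powi (int n - 2 * int i) - (- (1/q)) powi (1 - int n + 2 * int i)) \<odot> (dual.aa (n - 2 * i) * gg ^ i))"
    using dual.Newton[OF assms] signed_dual_qnum[of n] unfolding dual_gg by simp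
  also have "(-1)^n \<odot> (\<Sum>i=1..n div 2.
     (\<mu> * (- (1/q)) powi (int n - 2 * int i) - (- (1/q)) powi (1 - int n + 2 * int i)) \<odot> (dual.aa (n - 2 * i) * gg ^ i))
     = (\<Sum>i=1..n div 2.
     (\<mu> * q powi (2 * int i - int n) + q powi (int n - 2 * int i - 1)) \<odot> (dual.aa (n - 2 * i) * gg ^ i))"
    unfolding sm_sum_right
  proof (rule sum.cong)
    fix i assume "i \<in> {1..n div 2}"
    \<comment> \<open>In terms of l every power of -1/q is a power of q with a sign determined by l,
      and (-1)^n = (-1)^l removes that sign.\<close>
    then obtain l where l: "n = 2 * i + l" by (metis atLeastAtMost_iff le_Suc_ex mult.commute times_div_less_eq_dividend le_trans mult_le_mono2)
    have e1: "(- (1/q)) powi (int n - 2 * int i) = (-1)^l / q^l"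
      by (simp add: l power_minus[of "1/q"] power_one_over)
    have e2: "(- (1/q)) powi (1 - int n + 2 * int i) = - ((-1)^l * (q^l / q))"
    proof -
      have "(- (1/q)) powi (1 - int n + 2 * int i) = (- (1/q)) / (- (1/q)) ^ l"
        using q0 by (simp add: l power_int_diff)
      then show ?thesis by (cases "even l") (simp_all add: power_one_over)
    qed
    have e3: "q powi (2 * int i - int n) = 1 / q^l" using q0 by (simp add: l power_int_minus divide_inverse)
    have e4: "q powi (int n - 2 * int i - 1) = q^l / q" using q0 by (simp add: l power_int_diff)
    have "(-1)^n = ((-1)^l :: complex)" by (simp add: l power_add power_mult)
    then have "(-1)^n * (\<mu> * (- (1/q)) powi (int n - 2 * int i) - (- (1/q)) powi (1 - int n + 2 * int i))
      = \<mu> * q powi (2 * int i - int n) + q powi (int n - 2 * int i - 1)"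
      unfolding e1 e2 e3 e4 by (cases "even l") simp_all
    then show "(-1)^n \<odot> (\<mu> * (- (1/q)) powi (int n - 2 * int i) - (- (1/q)) powi (1 - int n + 2 * int i)) \<odot> (dual.aa (n - 2 * i) * gg ^ i)
       = (\<mu> * q powi (2 * int i - int n) + q powi (int n - 2 * int i - 1)) \<odot> (dual.aa (n - 2 * i) * gg ^ i)"
      by (simp only: sm_sm)
  qed simp
  finally show ?thesis .
qed

lemma pp_comm: "1 \<le> i \<Longrightarrow> pp i * dual.aa j = dual.aa j * pp i"
  using ch_comm[of i j "tail 0 i" "dual.A j"] W_tail dual.W_A[of j j]
  by (cases "j = 0") (auto simp: pp_def dual.aa_def)

lemma gg_comm: "gg * dual.aa j = dual.aa j * gg"
  using ch_comm[of 2 j "K 1" "dual.A j"] W_K[of 1 2] dual.W_A[of j j]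
  by (cases "j = 0") (auto simp: gg_def dual.aa_def)

lemma Wronski: assumes "generic n" "dual.generic n" "m \<le> n"
  shows "(\<Sum>i\<le>m. (-1)^i \<odot> (aa i * dual.aa (m - i))) = (if m = 0 then 1 else 0) - (if m = 2 then gg else 0)"
proof (rule wronski_of_newton[where n = n and q = q and \<mu> = \<mu> and p = pp and NN = NN and MM = dual.NN])
  show "q - 1/q \<noteq> 0" using lam_nz by (simp add: lam_def)
  show "dual.NN n = (\<Sum>i<n. (1/q)^i \<odot> (dual.aa i * pp (n - i)))" for n
    by (simp add: dual.NN_def)
  show "NN (l + 2) = NN l * gg - ((-1)^l * qnum q (l+2)) \<odot> aa (l+2)
        + ((-1)^l * (qnum q l + \<mu> * q^l - q / q^l)) \<odot> (aa l * gg)" if "l + 2 \<le> n" for l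
    using NN_rec generic_mono[OF assms(1) that] by blast
  show "dual.NN (l + 2) = dual.NN l * gg + qnum q (l+2) \<odot> dual.aa (l+2)
        + (\<mu> / q^l + q^l / q - qnum q l) \<odot> (dual.aa l * gg)" if "l + 2 \<le> n" for l
    using dual_NN_rec dual.generic_mono[OF assms(2) that] by blast
  show "1 \<le> m \<Longrightarrow> m \<le> n \<Longrightarrow> qnum q m \<noteq> 0" for m using genericD(2)[OF assms(1)] by blast
qed (use q0 assms pp_comm gg_comm in \<open>auto simp: NN_def aa_def dual.aa_def pp_def\<close>)

end

section \<open>Matrix units and partial traces\<close>

lemma idx_0 [simp]: "idx N 0 = {[]}"
  by (auto simp: idx_def)

lemma idx_Suc: "idx N (Suc n) = (\<lambda>(x, I). x # I) ` ({..<N} \<times> idx N n)"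
  by (auto simp: idx_def image_iff length_Suc_conv)

lemma finite_idx [simp]: "finite (idx N n)"
  by (induction n) (auto simp: idx_Suc)

lemma sum_idx_Suc: "(\<Sum>I\<in>idx N (Suc n). h I) = (\<Sum>x<N. \<Sum>I\<in>idx N n. h (x # I))"
proof -
  have "inj_on (\<lambda>(x, I). x # I) ({..<N} \<times> idx N n)" by (auto simp: inj_on_def)
  then show ?thesis unfolding idx_Suc by (simp add: sum.reindex sum.cartesian_product split_def)
qed

lemma Cons_in_idx [simp]: "x # I \<in> idx N (Suc n) \<longleftrightarrow> x < N \<and> I \<in> idx N n"
  by (auto simp: idx_def)

lemma idx_length: "I \<in> idx N n \<Longrightarrow> length I = n"
  by (simp add: idx_def)

lemma idx_2: "I \<in> idx N 2 \<longleftrightarrow> (\<exists>a<N. \<exists>b<N. I = [a, b])"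
  by (auto simp: idx_def length_Suc_conv numeral_2_eq_2)

text \<open>The elements \<^term>\<open>E k x y\<close> are the matrix units on the \<open>k\<close>-th tensor factor, so the ring plays the
  role of \<open>A \<otimes> Mat\<^sub>N \<otimes> Mat\<^sub>N \<otimes> \<cdots>\<close>. Strands are numbered from 1; the factor 0 is spare.\<close>

locale matrix_units = complex_alg sw for sw :: "complex \<Rightarrow> 'e::ring_1" +
  fixes N :: nat and E :: "nat \<Rightarrow> nat \<Rightarrow> nat \<Rightarrow> 'e" and io :: "'a::ring_1 \<Rightarrow> 'e"
    and sc :: "complex \<Rightarrow> 'a"
  assumes E_mult: "x < N \<Longrightarrow> y < N \<Longrightarrow> z < N \<Longrightarrow> w < N \<Longrightarrow> E k x y * E k z w = (if y = z then E k x w else 0)"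
    and E_sum: "(\<Sum>x<N. E k x x) = 1"
    and E_comm: "j \<noteq> k \<Longrightarrow> x < N \<Longrightarrow> y < N \<Longrightarrow> z < N \<Longrightarrow> w < N \<Longrightarrow> E j x y * E k z w = E k z w * E j x y"
    and io_add: "io (a + b) = io a + io b" and io_mult: "io (a * b) = io a * io b" and io_1 [simp]: "io 1 = 1"
    and io_E: "io a * E k x y = E k x y * io a"
    and sc_map: "complex_algebra_map sc" and sw_io: "sw c = io (sc c)"
begin

lemma io_0 [simp]: "io 0 = 0" using io_add[of 0 0] by simp
lemma io_sum: "io (sum h A) = (\<Sum>x\<in>A. io (h x))"
  by (induction A rule: infinite_finite_induct) (auto simp: io_add)

lemma sc_1 [simp]: "sc 1 = 1" and sc_add: "sc (a + b) = sc a + sc b" and sc_mult: "sc (a * b) = sc a * sc b"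
  using sc_map unfolding complex_algebra_map_def by blast+
lemma sc_0 [simp]: "sc 0 = 0" using sc_add[of 0 0] by simp
lemma sc_sum: "sc (sum h A) = (\<Sum>x\<in>A. sc (h x))"
  by (induction A rule: infinite_finite_induct) (auto simp: sc_add)

text \<open>Expresses that x does not involve strand k; coefficients from A qualify.\<close>

definition cE :: "nat \<Rightarrow> 'e \<Rightarrow> bool" where
  "cE k x \<longleftrightarrow> (\<forall>a<N. \<forall>b<N. x * E k a b = E k a b * x)"

lemma cED: "cE k x \<Longrightarrow> a < N \<Longrightarrow> b < N \<Longrightarrow> x * E k a b = E k a b * x"
  by (simp add: cE_def)

lemma cE_simps: "cE k 0" "cE k 1" "cE k (io a)"
  by (auto simp: cE_def io_E)

lemma cE_add: "cE k x \<Longrightarrow> cE k y \<Longrightarrow> cE k (x + y)"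
  by (simp add: cE_def distrib_left distrib_right)

lemma cE_mult: "cE k x \<Longrightarrow> cE k y \<Longrightarrow> cE k (x * y)"
  unfolding cE_def by (metis mult.assoc)

lemma cE_sm: "cE k x \<Longrightarrow> cE k (c \<odot> x)"
  by (simp add: cE_def)

lemma cE_sum: "(\<And>i. i \<in> A \<Longrightarrow> cE k (h i)) \<Longrightarrow> cE k (sum h A)"
  by (induction A rule: infinite_finite_induct) (auto intro: cE_add cE_simps)

lemma cE_prod_list: "(\<And>x. x \<in> set xs \<Longrightarrow> cE k x) \<Longrightarrow> cE k (prod_list xs)"
  by (induction xs) (auto intro: cE_mult cE_simps)

lemma cE_E: "j \<noteq> k \<Longrightarrow> a < N \<Longrightarrow> b < N \<Longrightarrow> cE k (E j a b)"
  by (simp add: cE_def E_comm)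

lemmas cE_intros = cE_simps cE_add cE_mult cE_sm cE_sum cE_prod_list cE_E

text \<open>Expresses that x is supported on the strands in A and has scalar coefficients: each
  \<open>io a\<close> satisfies \<open>cE j\<close> for every j, so x must commute with it too.
  Defined by commutation, the notion is closed under sums and products without any normal
  form.\<close>

definition locat :: "nat set \<Rightarrow> 'e \<Rightarrow> bool" where
  "locat A x \<longleftrightarrow> (\<forall>c. (\<forall>j\<in>A. cE j c) \<longrightarrow> c * x = x * c)"

lemma locat_comm: "locat A x \<Longrightarrow> (\<And>j. j \<in> A \<Longrightarrow> cE j c) \<Longrightarrow> c * x = x * c"
  by (simp add: locat_def)

lemma locat_E: "j \<in> A \<Longrightarrow> a < N \<Longrightarrow> b < N \<Longrightarrow> locat A (E j a b)"
  by (auto simp: locat_def cE_def)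

lemma locat_mono: "locat A x \<Longrightarrow> A \<subseteq> B \<Longrightarrow> locat B x"
  by (auto simp: locat_def)

lemma locat_1: "locat A 1" and locat_0: "locat A 0" by (auto simp: locat_def)

lemma locat_add: "locat A x \<Longrightarrow> locat A y \<Longrightarrow> locat A (x + y)"
  by (simp add: locat_def distrib_left distrib_right)

lemma locat_mult: "locat A x \<Longrightarrow> locat A y \<Longrightarrow> locat A (x * y)"
  unfolding locat_def by (metis mult.assoc)

lemma locat_sm: "locat A x \<Longrightarrow> locat A (c \<odot> x)"
  by (simp add: locat_def)

lemma locat_sum: "(\<And>i. i \<in> S \<Longrightarrow> locat A (h i)) \<Longrightarrow> locat A (sum h S)"
  by (induction S rule: infinite_finite_induct) (auto intro: locat_add locat_0)

lemma locat_prod_list: "(\<And>x. x \<in> set xs \<Longrightarrow> locat A x) \<Longrightarrow> locat A (prod_list xs)"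
  by (induction xs) (auto intro: locat_mult locat_1)

lemma locat_cE: "locat A x \<Longrightarrow> j \<notin> A \<Longrightarrow> cE j x"
  unfolding cE_def[of j] by (auto intro!: sym[OF locat_comm] cE_E)

text \<open>The coefficient of \<open>E k x y\<close> in Z, see \<open>cf_expand\<close>; the sum
  over z makes it commute with strand k.\<close>

definition cf :: "nat \<Rightarrow> nat \<Rightarrow> nat \<Rightarrow> 'e \<Rightarrow> 'e" where
  "cf k x y Z = (\<Sum>z<N. E k z x * Z * E k y z)"

definition pt :: "nat \<Rightarrow> 'e \<Rightarrow> 'e" where
  "pt k Z = (\<Sum>a<N. cf k a a Z)"

lemma cf_add: "cf k x y (Z + Z') = cf k x y Z + cf k x y Z'"
  by (simp add: cf_def distrib_left distrib_right sum.distrib)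

lemma cf_0 [simp]: "cf k x y 0 = 0" by (simp add: cf_def)

lemma cf_sum: "cf k x y (sum h A) = (\<Sum>i\<in>A. cf k x y (h i))"
  by (induction A rule: infinite_finite_induct) (auto simp: cf_add)

lemma cf_left: "cE k c \<Longrightarrow> x < N \<Longrightarrow> cf k x y (c * Z) = c * cf k x y Z"
  unfolding cf_def sum_distrib_left
  by (rule sum.cong) (auto simp: cED[of k c, symmetric] mult.assoc[symmetric])

lemma cf_right: "cE k c \<Longrightarrow> y < N \<Longrightarrow> cf k x y (Z * c) = cf k x y Z * c"
  unfolding cf_def sum_distrib_right
  by (rule sum.cong) (auto simp: cED[of k c] mult.assoc)

lemma cf_cE: assumes "x < N" "y < N" shows "cE k (cf k x y Z)"
  unfolding cE_def
proof (intro allI impI)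
  fix a b assume ab: "a < N" "b < N"
  have "cf k x y Z * E k a b = (\<Sum>z<N. if z = a then E k z x * Z * E k y b else 0)"
    unfolding cf_def sum_distrib_right by (rule sum.cong) (use ab assms in \<open>auto simp: mult.assoc E_mult\<close>)
  also have "\<dots> = (\<Sum>z<N. if z = b then E k a x * Z * E k y z else 0)" using ab by simp
  also have "\<dots> = E k a b * cf k x y Z"
    unfolding cf_def sum_distrib_left by (rule sum.cong) (use ab assms in \<open>auto simp: mult.assoc[symmetric] E_mult\<close>)
  finally show "cf k x y Z * E k a b = E k a b * cf k x y Z" .
qed

lemma cf_E: assumes "x < N" "y < N" "a < N" "b < N"
  shows "cf k x y (E k a b) = (if x = a \<and> y = b then 1 else 0)"
proof -
  have "cf k x y (E k a b) = (\<Sum>z<N. if x = a \<and> y = b then E k z z else 0)"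
    unfolding cf_def by (rule sum.cong) (use assms in \<open>auto simp: E_mult\<close>)
  then show ?thesis by (cases "x = a \<and> y = b") (simp_all add: E_sum)
qed

lemma cf_expand: "Z = (\<Sum>x<N. \<Sum>y<N. cf k x y Z * E k x y)"
proof -
  have "(\<Sum>x<N. \<Sum>y<N. cf k x y Z * E k x y) = (\<Sum>x<N. \<Sum>y<N. E k x x * Z * E k y y)"
  proof (intro sum.cong refl)
    fix x y assume "x \<in> {..<N}" "y \<in> {..<N}"
    then have "cf k x y Z * E k x y = (\<Sum>z<N. if z = x then E k z x * Z * E k y y else 0)"
      unfolding cf_def sum_distrib_right by (intro sum.cong refl) (auto simp: mult.assoc E_mult)
    then show "cf k x y Z * E k x y = E k x x * Z * E k y y" using \<open>x \<in> {..<N}\<close> by simp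
  qed
  also have "\<dots> = (\<Sum>x<N. E k x x) * Z * (\<Sum>y<N. E k y y)"
    by (simp only: sum_distrib_right) (simp only: sum_distrib_left)
  finally show ?thesis by (simp add: E_sum)
qed

section \<open>Partial traces and their restricted cyclicity\<close>

lemma pt_add: "pt k (Z + Z') = pt k Z + pt k Z'"
  by (simp add: pt_def cf_add sum.distrib)

lemma pt_0 [simp]: "pt k 0 = 0" by (simp add: pt_def)

lemma pt_sum: "pt k (sum h A) = (\<Sum>i\<in>A. pt k (h i))"
  by (induction A rule: infinite_finite_induct) (auto simp: pt_add)

lemma pt_left: "cE k c \<Longrightarrow> pt k (c * Z) = c * pt k Z"
  by (simp add: pt_def cf_left sum_distrib_left)

lemma pt_right: "cE k c \<Longrightarrow> pt k (Z * c) = pt k Z * c"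
  by (simp add: pt_def cf_right sum_distrib_right)

lemma pt_sm: "pt k (c \<odot> Z) = c \<odot> pt k Z"
  unfolding sm_def sw_io by (rule pt_left) (rule cE_simps)

lemma pt_E: assumes "a < N" "b < N" shows "pt k (E k a b) = (if a = b then 1 else 0)"
proof -
  have "pt k (E k a b) = (\<Sum>x<N. if x = a then (if a = b then 1 else 0) else 0)"
    unfolding pt_def by (rule sum.cong) (use assms in \<open>auto simp: cf_E\<close>)
  then show ?thesis using assms by simp
qed

lemma pt_cE_self: "cE k (pt k Z)"
  unfolding pt_def by (auto intro!: cE_sum cf_cE)

lemma pt_cE: "cE j Z \<Longrightarrow> j \<noteq> k \<Longrightarrow> cE j (pt k Z)"
  unfolding pt_def cf_def by (auto intro!: cE_intros)

lemma pt_cyc_E: assumes "a < N" "b < N" shows "pt k (E k a b * Z) = pt k (Z * E k a b)"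
proof -
  have "pt k (E k a b * Z) = (\<Sum>x<N. if x = a then (\<Sum>z<N. E k z b * Z * E k a z) else 0)"
    unfolding pt_def cf_def by (intro sum.cong refl) (use assms in \<open>auto simp: mult.assoc[symmetric] E_mult\<close>)
  also have "\<dots> = (\<Sum>x<N. if x = b then (\<Sum>z<N. E k z b * Z * E k a z) else 0)"
    using assms by simp
  also have "\<dots> = pt k (Z * E k a b)"
    unfolding pt_def cf_def by (intro sum.cong refl) (use assms in \<open>auto simp: mult.assoc E_mult\<close>)
  finally show ?thesis .
qed

primrec trs :: "nat \<Rightarrow> nat \<Rightarrow> 'e \<Rightarrow> 'e" where
  "trs m 0 Z = Z"
| "trs m (Suc n) Z = trs m n (pt (Suc (m + n)) Z)"

lemma trs_add: "trs m n (Z + Z') = trs m n Z + trs m n Z'"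
  by (induction n arbitrary: Z Z') (auto simp: pt_add)

lemma trs_0 [simp]: "trs m n 0 = 0" by (induction n) auto

lemma trs_sum: "trs m n (sum h A) = (\<Sum>i\<in>A. trs m n (h i))"
  by (induction A rule: infinite_finite_induct) (auto simp: trs_add)

lemma trs_left: "(\<And>k. m < k \<Longrightarrow> k \<le> m + n \<Longrightarrow> cE k c) \<Longrightarrow> trs m n (c * Z) = c * trs m n Z"
  by (induction n arbitrary: Z) (auto simp: pt_left)

lemma trs_right: "(\<And>k. m < k \<Longrightarrow> k \<le> m + n \<Longrightarrow> cE k c) \<Longrightarrow> trs m n (Z * c) = trs m n Z * c"
  by (induction n arbitrary: Z) (auto simp: pt_right)

lemma trs_sm: "trs m n (c \<odot> Z) = c \<odot> trs m n Z"
  by (induction n arbitrary: Z) (auto simp: pt_sm)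

lemma trs_split: "trs m (n + l) Z = trs m n (trs (m + n) l Z)"
  by (induction l arbitrary: Z) (auto simp: add.assoc)

lemma trs_Suc_front: "trs m (Suc n) Z = pt (Suc m) (trs (Suc m) n Z)"
  using trs_split[of m 1 n Z] by simp

lemma trs_cE: "cE j Z \<Longrightarrow> cE j (trs m n Z)"
proof (induction n arbitrary: Z)
  case (Suc n)
  then show ?case using pt_cE_self pt_cE by (cases "j = Suc (m + n)") auto
qed simp

lemma trs_cE_self: "m < j \<Longrightarrow> j \<le> m + n \<Longrightarrow> cE j (trs m n Z)"
proof (induction n arbitrary: Z)
  case (Suc n)
  then show ?case using trs_cE[OF pt_cE_self] by (cases "j = Suc (m + n)") auto
qed simp

text \<open>Singles out the factors that may be carried round the trace; because A need not be
  commutative, not every element can.\<close>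

definition cyc :: "nat \<Rightarrow> 'e \<Rightarrow> bool" where
  "cyc n x \<longleftrightarrow> (\<forall>Z. trs 0 n (x * Z) = trs 0 n (Z * x))"

lemma cyc_add: "cyc n x \<Longrightarrow> cyc n y \<Longrightarrow> cyc n (x + y)"
  by (simp add: cyc_def distrib_left distrib_right trs_add)

lemma cyc_sm: "cyc n x \<Longrightarrow> cyc n (c \<odot> x)"
  by (simp add: cyc_def trs_sm)

lemma cyc_0: "cyc n 0" by (simp add: cyc_def)

lemma cyc_mult: "cyc n x \<Longrightarrow> cyc n y \<Longrightarrow> cyc n (x * y)"
  unfolding cyc_def by (metis mult.assoc)

lemma cyc_sum: "(\<And>i. i \<in> A \<Longrightarrow> cyc n (h i)) \<Longrightarrow> cyc n (sum h A)"
  by (induction A rule: infinite_finite_induct) (auto intro: cyc_add cyc_0)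

lemma cyc_E: "1 \<le> j \<Longrightarrow> j \<le> n \<Longrightarrow> a < N \<Longrightarrow> b < N \<Longrightarrow> cyc n (E j a b)"
proof (induction n)
  case (Suc n)
  show ?case
  proof (cases "j = Suc n")
    case True then show ?thesis using Suc.prems by (simp add: cyc_def pt_cyc_E)
  next
    case False
    then have "cyc n (E j a b)" "cE (Suc n) (E j a b)" using Suc by (auto intro: cE_E)
    then show ?thesis by (simp add: cyc_def pt_left pt_right)
  qed
qed simp

section \<open>Operators on tensor powers as elements of the ring\<close>

fun eu :: "nat \<Rightarrow> nat list \<Rightarrow> nat list \<Rightarrow> 'e" where
  "eu k [] [] = 1"
| "eu k (x # I) (y # J) = E k x y * eu (Suc k) I J"
| "eu k _ _ = 0"

lemma eu_locat: "I \<in> idx N n \<Longrightarrow> J \<in> idx N n \<Longrightarrow> locat {k..<k + n} (eu k I J)"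
proof (induction n arbitrary: k I J)
  case 0 then show ?case by (simp add: locat_1)
next
  case (Suc n)
  then obtain x I' y J' where e: "I = x # I'" "J = y # J'" "x < N" "y < N" "I' \<in> idx N n" "J' \<in> idx N n"
    by (auto simp: idx_Suc)
  then have "locat {Suc k..<Suc k + n} (eu (Suc k) I' J')" using Suc.IH by blast
  then have "locat {k..<k + Suc n} (eu (Suc k) I' J')" by (rule locat_mono) auto
  then show ?case using e by (auto intro!: locat_mult locat_E)
qed

lemma eu_mult: "I \<in> idx N n \<Longrightarrow> J \<in> idx N n \<Longrightarrow> K \<in> idx N n \<Longrightarrow> L \<in> idx N n \<Longrightarrow>
  eu k I J * eu k K L = (if J = K then eu k I L else 0)"
proof (induction n arbitrary: k I J K L)
  case 0 then show ?case by simp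
next
  case (Suc n)
  then obtain x I' y J' z K' w L' where e: "I = x # I'" "J = y # J'" "K = z # K'" "L = w # L'"
    "x < N" "y < N" "z < N" "w < N" "I' \<in> idx N n" "J' \<in> idx N n" "K' \<in> idx N n" "L' \<in> idx N n"
    by (auto simp: idx_Suc)
  have "cE k (eu (Suc k) I' J')" using eu_locat[OF e(9,10)] by (rule locat_cE) simp
  then have "eu k I J * eu k K L = (E k x y * E k z w) * (eu (Suc k) I' J' * eu (Suc k) K' L')"
    using e cED[of k "eu (Suc k) I' J'" z w] by (simp add: mult.assoc) (metis mult.assoc)
  then show ?case using e Suc.IH[of I' J' K' L' "Suc k"] by (simp add: E_mult)
qed

text \<open>Places an operator with entries in A on the strands k, ..., k + n - 1. It respects
  \<open>op_eq\<close>, sums and products, so operator identities become identities in the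
  ring.\<close>

definition Phi :: "nat \<Rightarrow> nat \<Rightarrow> 'a op \<Rightarrow> 'e" where
  "Phi k n X = (\<Sum>I\<in>idx N n. \<Sum>J\<in>idx N n. io (X I J) * eu k I J)"

lemma io_eu: "io a * eu k I J = eu k I J * io a"
proof (induction k I J rule: eu.induct)
  case (2 k x I y J)
  then show ?case by (simp add: mult.assoc[symmetric] io_E) (simp add: mult.assoc)
qed auto

lemma Phi_cong: "op_eq N n X Y \<Longrightarrow> Phi k n X = Phi k n Y"
  unfolding Phi_def op_eq_def by (intro sum.cong refl) auto

lemma Phi_add: "Phi k n (oadd X Y) = Phi k n X + Phi k n Y"
  by (simp add: Phi_def oadd_def io_add distrib_right sum.distrib)

lemma Phi_osmul: "Phi k n (osmul (sc c) X) = c \<odot> Phi k n X"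
  by (simp add: Phi_def osmul_def io_mult sm_def sw_io sum_distrib_left mult.assoc)

lemma Phi_mult: "Phi k n (mmul N n X Y) = Phi k n X * Phi k n Y"
proof -
  have "Phi k n X * Phi k n Y = (\<Sum>I\<in>idx N n. \<Sum>J\<in>idx N n. \<Sum>K\<in>idx N n. \<Sum>L\<in>idx N n.
     io (X I J) * eu k I J * (io (Y K L) * eu k K L))"
    unfolding Phi_def by (simp only: sum_distrib_right) (simp only: sum_distrib_left)
  also have "\<dots> = (\<Sum>I\<in>idx N n. \<Sum>J\<in>idx N n. \<Sum>K\<in>idx N n. \<Sum>L\<in>idx N n.
     if J = K then io (X I J * Y K L) * eu k I L else 0)"
  proof (intro sum.cong refl)
    fix I J K L assume i: "I \<in> idx N n" "J \<in> idx N n" "K \<in> idx N n" "L \<in> idx N n"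
    have "io (X I J) * eu k I J * (io (Y K L) * eu k K L) = io (X I J) * io (Y K L) * (eu k I J * eu k K L)"
      using io_eu[of "Y K L" k I J] by (metis mult.assoc)
    then show "io (X I J) * eu k I J * (io (Y K L) * eu k K L) = (if J = K then io (X I J * Y K L) * eu k I L else 0)"
      using eu_mult[OF i] by (simp add: io_mult)
  qed
  also have "\<dots> = (\<Sum>I\<in>idx N n. \<Sum>J\<in>idx N n. \<Sum>K\<in>idx N n. if J = K then (\<Sum>L\<in>idx N n. io (X I J * Y K L) * eu k I L) else 0)"
    (is "_ = sum (\<lambda>I. sum (\<lambda>J. sum (?h I J) _) _) _")
  proof (intro sum.cong refl)
    fix I J K
    show "(\<Sum>L\<in>idx N n. if J = K then io (X I J * Y K L) * eu k I L else 0) = ?h I J K"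
      by (cases "J = K") simp_all
  qed
  also have "\<dots> = (\<Sum>I\<in>idx N n. \<Sum>J\<in>idx N n. \<Sum>L\<in>idx N n. io (X I J * Y J L) * eu k I L)"
    by (rule sum.cong, rule refl, rule sum.cong, rule refl) simp
  also have "\<dots> = (\<Sum>I\<in>idx N n. \<Sum>L\<in>idx N n. \<Sum>J\<in>idx N n. io (X I J * Y J L) * eu k I L)"
    by (rule sum.cong, rule refl, rule sum.swap)
  also have "\<dots> = Phi k n (mmul N n X Y)"
    by (simp add: Phi_def mmul_def io_sum sum_distrib_right)
  finally show ?thesis ..
qed

lemma eu_trace: "(\<Sum>I\<in>idx N n. eu k I I) = 1"
proof (induction n arbitrary: k)
  case (Suc n)
  then show ?case by (simp add: sum_idx_Suc sum_distrib_left[symmetric] E_sum)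
qed simp

lemma Phi_diag: "Phi k n (\<lambda>I J. if I = J then h I else 0) = (\<Sum>I\<in>idx N n. io (h I) * eu k I I)"
proof -
  have "Phi k n (\<lambda>I J. if I = J then h I else 0) = (\<Sum>I\<in>idx N n. \<Sum>J\<in>idx N n. if I = J then io (h I) * eu k I I else 0)"
    unfolding Phi_def by (intro sum.cong refl) auto
  then show ?thesis by simp
qed

lemma Phi_id: "Phi k n idop = 1"
  unfolding idop_def by (subst Phi_diag) (simp add: eu_trace)

lemma Phi_mprod: "Phi k n (mprod N n Xs) = prod_list (map (Phi k n) Xs)"
  by (induction Xs) (auto simp: mprod_def Phi_id Phi_mult)

lemma Phi_Suc: "Phi k (Suc n) X = (\<Sum>x<N. \<Sum>y<N. E k x y * Phi (Suc k) n (\<lambda>I J. X (x # I) (y # J)))"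
proof -
  have "Phi k (Suc n) X = (\<Sum>x<N. \<Sum>I\<in>idx N n. \<Sum>y<N. \<Sum>J\<in>idx N n. io (X (x # I) (y # J)) * (E k x y * eu (Suc k) I J))"
    by (simp add: Phi_def sum_idx_Suc)
  also have "\<dots> = (\<Sum>x<N. \<Sum>y<N. \<Sum>I\<in>idx N n. \<Sum>J\<in>idx N n. E k x y * (io (X (x # I) (y # J)) * eu (Suc k) I J))"
    by (intro sum.cong refl, subst sum.swap) (simp add: mult.assoc[symmetric] io_E)
  finally show ?thesis by (simp add: Phi_def sum_distrib_left)
qed

text \<open>The identity on the first factor contributes the sum of the diagonal matrix units, which
  is 1. This is the induction step of \<open>Phi_at2\<close> and \<open>Phi_at1\<close>.\<close>

lemma Phi_cons_diag: 
  assumes "\<And>x y I J. x < N \<Longrightarrow> y < N \<Longrightarrow> I \<in> idx N n \<Longrightarrow> J \<in> idx N n \<Longrightarrow> X (x # I) (y # J) = (if x = y then Y I J else 0)"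
  shows "Phi k (Suc n) X = Phi (Suc k) n Y"
proof -
  have "Phi (Suc k) n (\<lambda>I J. X (x # I) (y # J)) = (if x = y then Phi (Suc k) n Y else 0)" if "x < N" "y < N" for x y
    using assms that by (auto simp: Phi_def)
  then have "Phi k (Suc n) X = (\<Sum>x<N. \<Sum>y<N. if x = y then E k x x * Phi (Suc k) n Y else 0)"
    unfolding Phi_Suc by (intro sum.cong refl) auto
  also have "\<dots> = (\<Sum>x<N. E k x x) * Phi (Suc k) n Y" by (simp add: sum_distrib_right)
  finally show ?thesis by (simp add: E_sum)
qed

lemma Phi_at2_1: "Phi k (Suc (Suc n)) (at2 (Suc (Suc n)) 1 X) = Phi k 2 X"
proof -
  have e: "at2 (Suc (Suc n)) 1 X (a # b # I) (c # d # J) = X [a, b] [c, d] * idop I J"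
    if "I \<in> idx N n" "J \<in> idx N n" for a b c d I J
  proof -
    have "(\<forall>k<Suc (Suc n). k \<noteq> 0 \<and> k \<noteq> 1 \<longrightarrow> (a # b # I) ! k = (c # d # J) ! k) \<longleftrightarrow> I = J"
    proof
      assume h: "\<forall>k<Suc (Suc n). k \<noteq> 0 \<and> k \<noteq> 1 \<longrightarrow> (a # b # I) ! k = (c # d # J) ! k"
      show "I = J"
      proof (rule nth_equalityI)
        show "length I = length J" using that idx_length by simp
        fix k assume "k < length I"
        then show "I ! k = J ! k" using h[rule_format, of "Suc (Suc k)"] idx_length[OF that(1)] by simp
      qed
    next
      assume "I = J"
      then show "\<forall>k<Suc (Suc n). k \<noteq> 0 \<and> k \<noteq> 1 \<longrightarrow> (a # b # I) ! k = (c # d # J) ! k"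
        by (auto simp: nth_Cons split: nat.splits)
    qed
    then show ?thesis by (simp add: at2_def idop_def)
  qed
  have p: "Phi k n (\<lambda>I J. at2 (Suc (Suc n)) 1 X (a # b # I) (c # d # J)) = io (X [a, b] [c, d])" for k a b c d
  proof -
    have "Phi k n (\<lambda>I J. at2 (Suc (Suc n)) 1 X (a # b # I) (c # d # J)) = Phi k n (osmul (X [a,b] [c,d]) idop)"
      unfolding Phi_def by (intro sum.cong refl) (simp only: e osmul_def)
    also have "\<dots> = io (X [a,b] [c,d]) * Phi k n idop"
      by (simp add: Phi_def osmul_def io_mult sum_distrib_left mult.assoc)
    finally show ?thesis by (simp add: Phi_id)
  qed
  show ?thesis
    unfolding numeral_2_eq_2 Phi_Suc p by (simp add: Phi_def)
qed

lemma Phi_at2: "1 \<le> m \<Longrightarrow> m + 1 \<le> n \<Longrightarrow> Phi k n (at2 n m X) = Phi (k + m - 1) 2 X"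
proof (induction m arbitrary: n k)
  case (Suc m)
  show ?case
  proof (cases "m = 0")
    case True
    then have "n = Suc (Suc (n - 2))" using Suc.prems by simp
    then obtain l where "n = Suc (Suc l)" by blast
    then show ?thesis using Phi_at2_1 True by simp
  next
    case False
    then obtain l where n: "n = Suc l" "m + 1 \<le> l" using Suc.prems by (cases n) auto
    obtain m' where m': "m = Suc m'" using False by (cases m) auto
    have "Phi k (Suc l) (at2 (Suc l) (Suc m) X) = Phi (Suc k) l (at2 l m X)"
    proof (rule Phi_cons_diag)
      fix x y I J assume "x < N" "y < N" "I \<in> idx N l" "J \<in> idx N l"
      have "(\<forall>k<Suc l. k \<noteq> m \<and> k \<noteq> Suc m \<longrightarrow> (x # I) ! k = (y # J) ! k) \<longleftrightarrow>
         x = y \<and> (\<forall>k<l. k \<noteq> m' \<and> k \<noteq> m \<longrightarrow> I ! k = J ! k)"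
        unfolding All_less_Suc2 by (auto simp: m')
      then show "at2 (Suc l) (Suc m) X (x # I) (y # J) = (if x = y then at2 l m X I J else 0)"
        by (simp add: at2_def m')
    qed
    also have "\<dots> = Phi (Suc k + m - 1) 2 X" using Suc.IH[of l "Suc k"] n False by simp
    finally show ?thesis using n by simp
  qed
qed simp

lemma Phi_at1: "1 \<le> m \<Longrightarrow> m \<le> n \<Longrightarrow> Phi k n (at1 n m Y) = Phi (k + m - 1) 1 Y"
proof (induction m arbitrary: n k)
  case (Suc m)
  then obtain l where n: "n = Suc l" "m \<le> l" by (cases n) auto
  show ?case
  proof (cases "m = 0")
    case True
    have e: "at1 (Suc l) 1 Y (a # I) (c # J) = Y [a] [c] * idop I J"
      if "I \<in> idx N l" "J \<in> idx N l" for a c I J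
    proof -
      have "(\<forall>k<Suc l. k \<noteq> 0 \<longrightarrow> (a # I) ! k = (c # J) ! k) \<longleftrightarrow> I = J"
        using that idx_length[OF that(1)] idx_length[OF that(2)]
        unfolding All_less_Suc2 by (auto intro: nth_equalityI)
      then show ?thesis by (simp add: at1_def idop_def)
    qed
    have p: "Phi k l (\<lambda>I J. at1 (Suc l) 1 Y (a # I) (c # J)) = io (Y [a] [c])" for k a c
    proof -
      have "Phi k l (\<lambda>I J. at1 (Suc l) 1 Y (a # I) (c # J)) = Phi k l (osmul (Y [a] [c]) idop)"
        unfolding Phi_def by (intro sum.cong refl) (simp only: e osmul_def)
      also have "\<dots> = io (Y [a] [c]) * Phi k l idop"
        by (simp add: Phi_def osmul_def io_mult sum_distrib_left mult.assoc)
      finally show ?thesis by (simp add: Phi_id)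
    qed
    have "Phi k 1 Y = (\<Sum>x<N. \<Sum>y<N. E k x y * io (Y [x] [y]))"
      unfolding One_nat_def Phi_Suc by (simp add: Phi_def)
    moreover have "Phi k (Suc l) (at1 (Suc l) 1 Y) = (\<Sum>x<N. \<Sum>y<N. E k x y * io (Y [x] [y]))"
      unfolding Phi_Suc p ..
    ultimately show ?thesis using n True by simp
  next
    case False
    then obtain m' where m': "m = Suc m'" by (cases m) auto
    have "Phi k (Suc l) (at1 (Suc l) (Suc m) Y) = Phi (Suc k) l (at1 l m Y)"
    proof (rule Phi_cons_diag)
      fix x y I J assume "x < N" "y < N" "I \<in> idx N l" "J \<in> idx N l"
      have "(\<forall>k<Suc l. k \<noteq> m \<longrightarrow> (x # I) ! k = (y # J) ! k) \<longleftrightarrow>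
         x = y \<and> (\<forall>k<l. k \<noteq> m' \<longrightarrow> I ! k = J ! k)"
        unfolding All_less_Suc2 by (auto simp: m')
      then show "at1 (Suc l) (Suc m) Y (x # I) (y # J) = (if x = y then at1 l m Y I J else 0)"
        by (simp add: at1_def m')
    qed
    also have "\<dots> = Phi (Suc k + m - 1) 1 Y" using Suc.IH[of l "Suc k"] n False by simp
    finally show ?thesis using n by simp
  qed
qed simp

lemma trs_eu: "I \<in> idx N n \<Longrightarrow> J \<in> idx N n \<Longrightarrow> trs m n (eu (Suc m) I J) = (if I = J then 1 else 0)"
proof (induction n arbitrary: m I J)
  case 0 then show ?case by simp
next
  case (Suc n)
  then obtain x I' y J' where e: "I = x # I'" "J = y # J'" "x < N" "y < N" "I' \<in> idx N n" "J' \<in> idx N n"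
    by (auto simp: idx_Suc)
  have "trs m (Suc n) (eu (Suc m) I J) = pt (Suc m) (E (Suc m) x y * trs (Suc m) n (eu (Suc (Suc m)) I' J'))"
    unfolding trs_Suc_front by (subst trs_left[symmetric]) (use e in \<open>auto intro!: cE_E\<close>)
  then show ?case using Suc.IH[OF e(5,6)] e pt_E by simp
qed

lemma trs_Phi: "trs 0 n (Phi 1 n Z) = io (otr N n Z)"
proof -
  have "trs 0 n (Phi 1 n Z) = (\<Sum>I\<in>idx N n. \<Sum>J\<in>idx N n. io (Z I J) * trs 0 n (eu 1 I J))"
    unfolding Phi_def trs_sum by (intro sum.cong refl trs_left cE_simps)
  also have "\<dots> = (\<Sum>I\<in>idx N n. \<Sum>J\<in>idx N n. if I = J then io (Z I I) else 0)"
    using trs_eu[of _ n _ 0] by (intro sum.cong refl) auto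
  finally show ?thesis by (simp add: otr_def io_sum)
qed

lemma Phi_locat: "locat {k..<k + n} (Phi k n (cop sc X))"
proof -
  have "Phi k n (cop sc X) = (\<Sum>I\<in>idx N n. \<Sum>J\<in>idx N n. X I J \<odot> eu k I J)"
    by (simp add: Phi_def cop_def sm_def sw_io)
  then show ?thesis by (auto intro!: locat_sum locat_sm eu_locat)
qed

lemma Phi_cE: "j < k \<or> k + n \<le> j \<Longrightarrow> cE j (Phi k n X)"
  unfolding Phi_def by (intro cE_sum cE_mult cE_simps) (rule locat_cE[OF eu_locat], auto)

lemma cop_mmul: "cop sc (mmul N n X Y) = mmul N n (cop sc X) (cop sc Y)"
  by (simp add: cop_def mmul_def sc_sum sc_mult)
lemma cop_idop: "cop sc idop = idop"
  by (auto simp: cop_def idop_def fun_eq_iff)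
lemma cop_oadd: "cop sc (oadd X Y) = oadd (cop sc X) (cop sc Y)"
  by (simp add: cop_def oadd_def sc_add)
lemma cop_osmul: "cop sc (osmul c X) = osmul (sc c) (cop sc X)"
  by (simp add: cop_def osmul_def sc_mult)
lemma cop_at2: "cop sc (at2 n m X) = at2 n m (cop sc X)"
  by (auto simp: cop_def at2_def fun_eq_iff)
lemma cop_at1: "cop sc (at1 n m X) = at1 n m (cop sc X)"
  by (auto simp: cop_def at1_def fun_eq_iff)
lemma cop_mprod: "cop sc (mprod N n Xs) = mprod N n (map (cop sc) Xs)"
  by (induction Xs) (auto simp: mprod_def cop_idop cop_mmul)
lemma cop_cong: "op_eq N n X Y \<Longrightarrow> op_eq N n (cop sc X) (cop sc Y)"
  by (simp add: op_eq_def cop_def)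

definition C :: "nat \<Rightarrow> nat \<Rightarrow> complex op \<Rightarrow> 'e" where "C k n X = Phi k n (cop sc X)"

lemma C_cong: "op_eq N n X Y \<Longrightarrow> C k n X = C k n Y"
  unfolding C_def by (intro Phi_cong cop_cong)

lemma C_mmul: "C k n (mmul N n X Y) = C k n X * C k n Y" by (simp add: C_def cop_mmul Phi_mult)
lemma C_idop: "C k n idop = 1" by (simp add: C_def cop_idop Phi_id)
lemma C_oadd: "C k n (oadd X Y) = C k n X + C k n Y" by (simp add: C_def cop_oadd Phi_add)
lemma C_osmul: "C k n (osmul c X) = c \<odot> C k n X" by (simp add: C_def cop_osmul Phi_osmul)
lemma C_mprod: "C k n (mprod N n Xs) = prod_list (map (C k n) Xs)"
  unfolding C_def cop_mprod Phi_mprod by (simp add: comp_def)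
lemma C_at2: "1 \<le> m \<Longrightarrow> m + 1 \<le> n \<Longrightarrow> C k n (at2 n m X) = C (k + m - 1) 2 X"
  by (simp add: C_def cop_at2 Phi_at2)
lemma C_at1: "1 \<le> m \<Longrightarrow> m \<le> n \<Longrightarrow> C k n (at1 n m X) = C (k + m - 1) 1 X"
  by (simp add: C_def cop_at1 Phi_at1)
lemma C_0: "C k n (\<lambda>I J. 0) = 0" by (simp add: C_def cop_def Phi_def)
lemma C_locat: "locat {k..<k + n} (C k n X)" unfolding C_def by (rule Phi_locat)
lemma C_2: "C k 2 X = (\<Sum>a<N. \<Sum>b<N. \<Sum>c<N. \<Sum>d<N. X [a, b] [c, d] \<odot> (E k a c * E (Suc k) b d))"
proof -
  have "C k 2 X = (\<Sum>a<N. \<Sum>b<N. \<Sum>c<N. \<Sum>d<N. io (sc (X [a, b] [c, d])) * (E k a c * E (Suc k) b d))"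
    by (simp add: C_def Phi_def cop_def numeral_2_eq_2 sum_idx_Suc)
  then show ?thesis by (simp add: sm_def sw_io)
qed

lemma C_1: "C k 1 X = (\<Sum>a<N. \<Sum>c<N. X [a] [c] \<odot> E k a c)"
  unfolding One_nat_def by (simp add: C_def Phi_def cop_def sum_idx_Suc sm_def sw_io)

lemma C_cyc: "1 \<le> k \<Longrightarrow> k + 1 \<le> n \<Longrightarrow> cyc n (C k 2 X)"
  unfolding C_2 by (auto intro!: cyc_sum cyc_sm cyc_mult cyc_E)

end

section \<open>The R-trace\<close>

lemma skew_entry:
  assumes "a < N" "e < N" "c < N" "f < (N::nat)"
  shows "ptr N 2 (mmul N 3 (at2 3 1 X) (at2 3 2 Y)) [a, e] [c, f] = (\<Sum>b<N. \<Sum>d<N. X [a, b] [c, d] * (Y [d, e] [b, f] :: complex))"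
proof -
  have "mmul N 3 (at2 3 1 X) (at2 3 2 Y) [a, b, e] [c, b, f] = (\<Sum>d<N. X [a, b] [c, d] * Y [d, e] [b, f])" for b
  proof -
    have "mmul N 3 (at2 3 1 X) (at2 3 2 Y) [a, b, e] [c, b, f] =
      (\<Sum>x<N. \<Sum>d<N. \<Sum>z<N. at2 3 1 X [a, b, e] [x, d, z] * at2 3 2 Y [x, d, z] [c, b, f])"
      by (simp add: mmul_def numeral_3_eq_3 sum_idx_Suc)
    also have "\<dots> = (\<Sum>x<N. \<Sum>d<N. \<Sum>z<N. if z = e then (if x = c then X [a, b] [x, d] * Y [d, z] [b, f] else 0) else 0)"
      by (intro sum.cong refl) (auto simp: at2_def numeral_3_eq_3 All_less_Suc2)
    also have "\<dots> = (\<Sum>x<N. \<Sum>d<N. if x = c then X [a, b] [x, d] * Y [d, e] [b, f] else 0)"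
      using assms by simp
    also have "\<dots> = (\<Sum>d<N. \<Sum>x<N. if x = c then X [a, b] [x, d] * Y [d, e] [b, f] else 0)"
      by (rule sum.swap)
    finally show ?thesis using assms by simp
  qed
  then show ?thesis by (simp add: ptr_def)
qed

lemma skew_inv_entries:
  assumes "skew_inv_by N X Psi" "a < N" "e < N" "c < N" "f < N"
  shows "(\<Sum>b<N. \<Sum>d<N. X [a, b] [c, d] * Psi [d, e] [b, f]) = (if a = f \<and> e = c then 1 else 0)"
    and "(\<Sum>b<N. \<Sum>d<N. Psi [a, b] [c, d] * X [d, e] [b, f]) = (if a = f \<and> e = c then 1 else 0)"
proof -
  have i: "[a, e] \<in> idx N 2" "[c, f] \<in> idx N 2" using assms by (auto simp: idx_2)
  have fl: "flip [a, e] [c, f] = (if a = f \<and> e = c then 1 else 0)" by (simp add: flip_def)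
  show "(\<Sum>b<N. \<Sum>d<N. X [a, b] [c, d] * Psi [d, e] [b, f]) = (if a = f \<and> e = c then 1 else 0)"
    "(\<Sum>b<N. \<Sum>d<N. Psi [a, b] [c, d] * X [d, e] [b, f]) = (if a = f \<and> e = c then 1 else 0)"
    using assms(1)[unfolded skew_inv_by_def op_eq_def, THEN conjunct1, rule_format, OF i]
      assms(1)[unfolded skew_inv_by_def op_eq_def, THEN conjunct2, rule_format, OF i]
    by (simp_all only: fl skew_entry[OF assms(2-5)])
qed

context matrix_units begin

lemma pt_E_left: assumes "b < N" "d < N" shows "pt k (E k b d * T) = cf k d b T"
proof -
  have "pt k (E k b d * T) = (\<Sum>a<N. if a = b then cf k d b T else 0)"
    unfolding pt_def
  proof (intro sum.cong refl)
    fix a assume "a \<in> {..<N}"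
    then have "cf k a a (E k b d * T) = (\<Sum>z<N. if a = b then E k z d * T * E k a z else 0)"
      unfolding cf_def by (intro sum.cong refl) (use assms in \<open>auto simp: mult.assoc[symmetric] E_mult\<close>)
    then show "cf k a a (E k b d * T) = (if a = b then cf k d b T else 0)"
      by (cases "a = b") (simp_all add: cf_def)
  qed
  then show ?thesis using assms by simp
qed

lemma cf_one: "x < N \<Longrightarrow> y < N \<Longrightarrow> cf k x y 1 = (if x = y then 1 else 0)"
proof -
  assume xy: "x < N" "y < N"
  have "cf k x y 1 = (\<Sum>a<N. cf k x y (E k a a))"
    using E_sum[of k] by (metis cf_sum)
  also have "\<dots> = (\<Sum>a<N. if a = x then (if x = y then 1 else 0) else 0)"
    using xy by (intro sum.cong refl) (auto simp: cf_E)
  finally show ?thesis using xy by simp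
qed

end

locale skew_R = matrix_units sw N E io sc
  for sw :: "complex \<Rightarrow> 'e::ring_1" and N E and io :: "'a::ring_1 \<Rightarrow> 'e" and sc +
  fixes R Psi :: "complex op"
  assumes skew: "skew_inv_by N R Psi"
begin

definition DM :: "complex op" where "DM = ptr N 2 Psi"

definition r :: "nat \<Rightarrow> 'e" where "r k = C k 2 R"
definition dk :: "nat \<Rightarrow> 'e" where "dk k = C k 1 DM"

lemma DM_entry: "DM [i] [j] = (\<Sum>c<N. Psi [i, c] [j, c])"
  by (simp add: DM_def ptr_def)

text \<open>The second skew inversion identity says that Psi inverts R, read as a matrix from index
  pairs (b, d) to pairs (a, c). The unknowns G may be ring elements; the exchanges of sums only
  bring the summation over a and c inside.\<close>

lemma psi_invert:
  assumes H: "\<And>a c. a < N \<Longrightarrow> c < N \<Longrightarrow> (\<Sum>b<N. \<Sum>d<N. R [a, b] [c, d] \<odot> G b d) = H a c"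
    and ij: "i < N" "j < N"
  shows "G j i = (\<Sum>c<N. \<Sum>a<N. Psi [i, c] [j, a] \<odot> H a c)"
proof -
  have "(\<Sum>c<N. \<Sum>a<N. Psi [i, c] [j, a] \<odot> H a c) =
     (\<Sum>c<N. \<Sum>a<N. \<Sum>b<N. \<Sum>d<N. (Psi [i, c] [j, a] * R [a, b] [c, d]) \<odot> G b d)"
    by (intro sum.cong refl) (simp add: H[symmetric] sm_sum_right)
  also have "\<dots> = (\<Sum>c<N. \<Sum>b<N. \<Sum>a<N. \<Sum>d<N. (Psi [i, c] [j, a] * R [a, b] [c, d]) \<odot> G b d)"
    by (rule sum.cong, rule refl, rule sum.swap)
  also have "\<dots> = (\<Sum>b<N. \<Sum>c<N. \<Sum>a<N. \<Sum>d<N. (Psi [i, c] [j, a] * R [a, b] [c, d]) \<odot> G b d)"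
    by (rule sum.swap)
  also have "\<dots> = (\<Sum>b<N. \<Sum>c<N. \<Sum>d<N. \<Sum>a<N. (Psi [i, c] [j, a] * R [a, b] [c, d]) \<odot> G b d)"
    by (rule sum.cong, rule refl, rule sum.cong, rule refl, rule sum.swap)
  also have "\<dots> = (\<Sum>b<N. \<Sum>d<N. \<Sum>c<N. \<Sum>a<N. (Psi [i, c] [j, a] * R [a, b] [c, d]) \<odot> G b d)"
    by (rule sum.cong, rule refl, rule sum.swap)
  also have "\<dots> = (\<Sum>b<N. \<Sum>d<N. if d = i then (if b = j then G b d else 0) else 0)"
  proof (rule sum.cong, rule refl, rule sum.cong, rule refl)
    fix b d assume "b \<in> {..<N}" "d \<in> {..<N}"
    then have "(\<Sum>c<N. \<Sum>a<N. Psi [i, c] [j, a] * R [a, b] [c, d]) = (if i = d \<and> b = j then 1 else 0)"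
      using skew_inv_entries(2)[OF skew, of i b j d] ij by simp
    then have "(\<Sum>c<N. \<Sum>a<N. (Psi [i, c] [j, a] * R [a, b] [c, d]) \<odot> G b d) = (if i = d \<and> b = j then 1 else 0) \<odot> G b d"
      by (simp add: sm_sum_left[symmetric])
    then show "(\<Sum>c<N. \<Sum>a<N. (Psi [i, c] [j, a] * R [a, b] [c, d]) \<odot> G b d) = (if d = i then (if b = j then G b d else 0) else 0)"
      by auto
  qed
  also have "\<dots> = G j i" using ij by simp
  finally show ?thesis ..
qed

lemma dk_eq: "dk k = (\<Sum>a<N. \<Sum>c<N. DM [a] [c] \<odot> E k a c)"
  unfolding dk_def by (rule C_1)

lemma r_eq: "r k = (\<Sum>a<N. \<Sum>b<N. \<Sum>c<N. \<Sum>d<N. R [a, b] [c, d] \<odot> (E k a c * E (Suc k) b d))"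
  by (simp add: r_def C_2)

lemma dk_E: assumes "x < N" "y < N" shows "dk k * E k x y = (\<Sum>i<N. DM [i] [x] \<odot> E k i y)"
proof -
  have "dk k * E k x y = (\<Sum>a<N. \<Sum>c<N. if c = x then DM [a] [c] \<odot> E k a y else 0)"
    unfolding dk_eq sum_distrib_right by (intro sum.cong refl) (use assms in \<open>auto simp: E_mult\<close>)
  then show ?thesis using assms by simp
qed

lemma E_dk: assumes "x < N" "y < N" shows "E k x y * dk k = (\<Sum>i<N. DM [y] [i] \<odot> E k x i)"
proof -
  have "E k x y * dk k = (\<Sum>a<N. \<Sum>c<N. if y = a then DM [a] [c] \<odot> E k x c else 0)"
    unfolding dk_eq sum_distrib_left by (intro sum.cong refl) (use assms in \<open>auto simp: E_mult\<close>)
  also have "\<dots> = (\<Sum>a<N. if y = a then (\<Sum>c<N. DM [a] [c] \<odot> E k x c) else 0)"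
    by (intro sum.cong refl) auto
  finally show ?thesis using assms by simp
qed

lemma pt_dk_E: assumes "x < N" "y < N" shows "pt k (dk k * E k x y) = DM [y] [x] \<odot> 1"
proof -
  have "pt k (dk k * E k x y) = (\<Sum>i<N. if i = y then DM [y] [x] \<odot> 1 else 0)"
    unfolding dk_E[OF assms] pt_sum pt_sm by (intro sum.cong refl) (use assms in \<open>auto simp: pt_E\<close>)
  then show ?thesis using assms by simp
qed

lemma dk_locat: "locat {k} (dk k)" and r_locat: "locat {k, Suc k} (r k)"
  using C_locat[of k 1 DM] C_locat[of k 2 R] by (simp_all add: dk_def r_def numeral_2_eq_2 atLeastLessThanSuc insert_commute)

text \<open>The first skew inversion identity with f = e, summed over e, since \<open>DM\<close> is
  the trace of Psi over its second leg.\<close>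

lemma pt_dk_r: "pt (Suc k) (dk (Suc k) * r k) = 1"
proof -
  have "pt (Suc k) (dk (Suc k) * r k) = (\<Sum>a<N. \<Sum>b<N. \<Sum>c<N. \<Sum>d<N. R [a, b] [c, d] \<odot> (E k a c * pt (Suc k) (dk (Suc k) * E (Suc k) b d)))"
    unfolding r_eq sum_distrib_left pt_sum
  proof (intro sum.cong refl)
    fix a b c d assume i: "a \<in> {..<N}" "b \<in> {..<N}" "c \<in> {..<N}" "d \<in> {..<N}"
    have "dk (Suc k) * E k a c = E k a c * dk (Suc k)"
      by (rule sym, rule locat_comm[OF dk_locat]) (use i in \<open>auto intro!: cE_E\<close>)
    then have "dk (Suc k) * (R [a, b] [c, d] \<odot> (E k a c * E (Suc k) b d)) = R [a, b] [c, d] \<odot> (E k a c * (dk (Suc k) * E (Suc k) b d))"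
      by (simp add: mult.assoc[symmetric])
    then show "pt (Suc k) (dk (Suc k) * (R [a, b] [c, d] \<odot> (E k a c * E (Suc k) b d))) =
       R [a, b] [c, d] \<odot> (E k a c * pt (Suc k) (dk (Suc k) * E (Suc k) b d))"
      by (simp only: pt_sm) (subst pt_left, use i in \<open>auto intro!: cE_E\<close>)
  qed
  also have "\<dots> = (\<Sum>a<N. \<Sum>b<N. \<Sum>c<N. \<Sum>d<N. (R [a, b] [c, d] * DM [d] [b]) \<odot> E k a c)"
    by (intro sum.cong refl) (simp add: pt_dk_E)
  also have "\<dots> = (\<Sum>a<N. \<Sum>c<N. \<Sum>b<N. \<Sum>d<N. (R [a, b] [c, d] * DM [d] [b]) \<odot> E k a c)"
    by (rule sum.cong, rule refl, rule sum.swap)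
  also have "\<dots> = (\<Sum>a<N. \<Sum>c<N. if a = c then E k a c else 0)"
  proof (rule sum.cong, rule refl, rule sum.cong, rule refl)
    fix a c assume i: "a \<in> {..<N}" "c \<in> {..<N}"
    have "(\<Sum>b<N. \<Sum>d<N. R [a, b] [c, d] * DM [d] [b]) = (\<Sum>b<N. \<Sum>d<N. \<Sum>e<N. R [a, b] [c, d] * Psi [d, e] [b, e])"
      by (simp add: DM_entry sum_distrib_left)
    also have "\<dots> = (\<Sum>b<N. \<Sum>e<N. \<Sum>d<N. R [a, b] [c, d] * Psi [d, e] [b, e])"
      by (rule sum.cong, rule refl, rule sum.swap)
    also have "\<dots> = (\<Sum>e<N. \<Sum>b<N. \<Sum>d<N. R [a, b] [c, d] * Psi [d, e] [b, e])"
      by (rule sum.swap)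
    also have "\<dots> = (\<Sum>e<N. if e = a then (if a = c then 1 else 0) else 0)"
      using i by (intro sum.cong refl) (auto simp: skew_inv_entries(1)[OF skew])
    also have "\<dots> = (if a = c then 1 else 0)" using i by simp
    finally show "(\<Sum>b<N. \<Sum>d<N. (R [a, b] [c, d] * DM [d] [b]) \<odot> E k a c) = (if a = c then E k a c else 0)"
      by (simp add: sm_sum_left[symmetric])
  qed
  finally show ?thesis by (simp add: E_sum)
qed

text \<open>The key identity \<open>Tr\<^sub>R\<^sub>(\<^sub>2\<^sub>) u Z\<^sub>1 v = Tr\<^sub>R Z\<close>: moving \<open>R\<close> past the
  strands turns the left-hand side, with \<open>Z\<close> replaced by the second leg of \<open>R\<close>, into the
  identity, and the second legs of a skew invertible \<open>R\<close> span all matrices.\<close>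

lemma slide_E:
  assumes u0: "locat {k, Suc k} u0" "locat {k, Suc k} v0" and u1: "locat {Suc k, Suc (Suc k)} u1" "locat {Suc k, Suc (Suc k)} v1"
    and inv: "v0 * u0 = 1" and rel: "u1 * r k * v1 = v0 * r (Suc k) * u0"
    and xy: "x < N" "y < N"
  shows "pt (Suc (Suc k)) (dk (Suc (Suc k)) * u1 * E (Suc k) x y * v1) = DM [y] [x] \<odot> 1"
proof -
  let ?p = "Suc (Suc k)"
  define G where "G x y = pt ?p (dk ?p * u1 * E (Suc k) x y * v1)" for x y
  have cG: "cE k (G x y)" if "x < N" "y < N" for x y
    unfolding G_def by (intro pt_cE cE_mult locat_cE[OF dk_locat] locat_cE[OF u1(1)] locat_cE[OF u1(2)] cE_E) (use that in auto)
  have "pt ?p (dk ?p * (u1 * r k * v1)) = pt ?p (v0 * (dk ?p * r (Suc k)) * u0)"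
  proof -
    have "v0 * dk ?p = dk ?p * v0" by (rule locat_comm[OF dk_locat]) (auto intro!: locat_cE[OF u0(2)])
    then show ?thesis unfolding rel by (simp add: mult.assoc[symmetric])
  qed
  also have "\<dots> = v0 * pt ?p (dk ?p * r (Suc k)) * u0"
    by (subst pt_right, rule locat_cE[OF u0(1)], simp, subst pt_left, rule locat_cE[OF u0(2)], auto)
  finally have 1: "pt ?p (dk ?p * (u1 * r k * v1)) = 1" using pt_dk_r[of "Suc k"] inv by simp
  have "pt ?p (dk ?p * (u1 * r k * v1)) = (\<Sum>a<N. \<Sum>b<N. \<Sum>c<N. \<Sum>d<N. R [a, b] [c, d] \<odot> (E k a c * G b d))"
    unfolding r_eq sum_distrib_left sum_distrib_right pt_sum
  proof (intro sum.cong refl)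
    fix a b c d assume i: "a \<in> {..<N}" "b \<in> {..<N}" "c \<in> {..<N}" "d \<in> {..<N}"
    have c1: "dk ?p * E k a c = E k a c * dk ?p"
      by (rule sym, rule locat_comm[OF dk_locat]) (use i in \<open>auto intro!: cE_E\<close>)
    have c2: "u1 * E k a c = E k a c * u1"
      by (rule sym, rule locat_comm[OF u1(1)]) (use i in \<open>auto intro!: cE_E\<close>)
    have "dk ?p * (u1 * (E k a c * E (Suc k) b d) * v1) = E k a c * (dk ?p * u1 * E (Suc k) b d * v1)"
      by (simp add: mult.assoc comm_left[OF c1] comm_left[OF c2])
    then show "pt ?p (dk ?p * (u1 * (R [a, b] [c, d] \<odot> (E k a c * E (Suc k) b d)) * v1)) = R [a, b] [c, d] \<odot> (E k a c * G b d)"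
      unfolding G_def by (simp add: pt_sm) (subst pt_left, use i in \<open>auto intro!: cE_E\<close>)
  qed
  then have 2: "(\<Sum>a<N. \<Sum>b<N. \<Sum>c<N. \<Sum>d<N. R [a, b] [c, d] \<odot> (E k a c * G b d)) = 1" using 1 by simp
  \<comment> \<open>\<open>G b d\<close> avoids strand k, so comparing coefficients of
    \<open>E k a' c'\<close> leaves a linear system for G, which \<open>psi_invert\<close>
    solves.\<close>
  have H: "(\<Sum>b<N. \<Sum>d<N. R [a', b] [c', d] \<odot> G b d) = (if a' = c' then 1 else 0)" if "a' < N" "c' < N" for a' c'
  proof -
    have "cf k a' c' (\<Sum>a<N. \<Sum>b<N. \<Sum>c<N. \<Sum>d<N. R [a, b] [c, d] \<odot> (E k a c * G b d))
      = (\<Sum>a<N. \<Sum>b<N. \<Sum>c<N. \<Sum>d<N. if c = c' then (if a = a' then R [a, b] [c, d] \<odot> G b d else 0) else 0)"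
      unfolding cf_sum
    proof (intro sum.cong refl)
      fix a b c d assume i: "a \<in> {..<N}" "b \<in> {..<N}" "c \<in> {..<N}" "d \<in> {..<N}"
      have "cf k a' c' (R [a, b] [c, d] \<odot> (E k a c * G b d)) = R [a, b] [c, d] \<odot> (cf k a' c' (E k a c) * G b d)"
        unfolding sm_def sw_io using cG[of b d] i that by (simp add: cf_left cf_right cE_simps)
      then show "cf k a' c' (R [a, b] [c, d] \<odot> (E k a c * G b d)) = (if c = c' then (if a = a' then R [a, b] [c, d] \<odot> G b d else 0) else 0)"
        using i that by (simp add: cf_E)
    qed
    also have "\<dots> = (\<Sum>a<N. if a = a' then (\<Sum>b<N. \<Sum>c<N. if c = c' then (\<Sum>d<N. R [a, b] [c, d] \<odot> G b d) else 0) else 0)"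
    proof (rule sum.cong, rule refl)
      fix a
      have i: "(\<Sum>d<N. if c = c' then (if a = a' then R [a, b] [c, d] \<odot> G b d else 0) else 0) =
         (if c = c' then (if a = a' then (\<Sum>d<N. R [a, b] [c, d] \<odot> G b d) else 0) else 0)" for b c
        by (cases "c = c'"; cases "a = a'") simp_all
      show "(\<Sum>b<N. \<Sum>c<N. \<Sum>d<N. if c = c' then (if a = a' then R [a, b] [c, d] \<odot> G b d else 0) else 0) =
         (if a = a' then (\<Sum>b<N. \<Sum>c<N. if c = c' then (\<Sum>d<N. R [a, b] [c, d] \<odot> G b d) else 0) else 0)"
        unfolding i by (cases "a = a'") (simp_all cong: if_cong)
    qed
    also have "\<dots> = (\<Sum>b<N. \<Sum>d<N. R [a', b] [c', d] \<odot> G b d)" using that by simp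
    finally show ?thesis unfolding 2 using cf_one that by simp
  qed
  have "G x y = (\<Sum>c<N. \<Sum>a<N. Psi [y, c] [x, a] \<odot> (if a = c then 1 else 0))"
    by (rule psi_invert) (use H xy in auto)
  also have "\<dots> = (\<Sum>c<N. \<Sum>a<N. if a = c then Psi [y, c] [x, a] \<odot> 1 else 0)"
    by (intro sum.cong refl) auto
  also have "\<dots> = DM [y] [x] \<odot> 1" by (simp add: DM_entry sm_sum_left)
  finally show ?thesis by (simp add: G_def)
qed

text \<open>Expand Z in matrix units of strand k + 1. The coefficients avoid the strands k + 1 and k
  + 2, so they pass out of both traces, and \<open>slide_E\<close> treats the matrix units.\<close>

lemma slide:
  assumes u0: "locat {k, Suc k} u0" "locat {k, Suc k} v0" and u1: "locat {Suc k, Suc (Suc k)} u1" "locat {Suc k, Suc (Suc k)} v1"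
    and inv: "v0 * u0 = 1" and rel: "u1 * r k * v1 = v0 * r (Suc k) * u0"
    and Z: "cE (Suc (Suc k)) Z"
  shows "pt (Suc (Suc k)) (dk (Suc (Suc k)) * u1 * Z * v1) = pt (Suc k) (dk (Suc k) * Z)"
proof -
  let ?p = "Suc (Suc k)" and ?s = "Suc k"
  have Zc: "cE ?p (cf ?s x y Z)" if "x < N" "y < N" for x y
    unfolding cf_def using that Z by (auto intro!: cE_intros)
  have cs: "cE ?s (cf ?s x y Z)" if "x < N" "y < N" for x y using that by (rule cf_cE)
  have "pt ?p (dk ?p * u1 * Z * v1) = (\<Sum>x<N. \<Sum>y<N. pt ?p (dk ?p * u1 * (cf ?s x y Z * E ?s x y) * v1))"
    by (subst (1) cf_expand[of Z ?s]) (simp only: sum_distrib_left sum_distrib_right pt_sum)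
  also have "\<dots> = (\<Sum>x<N. \<Sum>y<N. pt ?s (dk ?s * (cf ?s x y Z * E ?s x y)))"
  proof (intro sum.cong refl)
    fix x y assume "x \<in> {..<N}" "y \<in> {..<N}"
    then have xy: "x < N" "y < N" by auto
    let ?c = "cf ?s x y Z"
    have 1: "dk ?p * ?c = ?c * dk ?p" "u1 * ?c = ?c * u1" "dk ?s * ?c = ?c * dk ?s"
      using Zc[OF xy] cs[OF xy] by (auto intro!: sym[OF locat_comm[OF dk_locat]] sym[OF locat_comm[OF u1(1)]])
    have "dk ?p * u1 * (?c * E ?s x y) * v1 = ?c * (dk ?p * u1 * E ?s x y * v1)"
      by (simp add: mult.assoc comm_left[OF 1(1)] comm_left[OF 1(2)])
    then have "pt ?p (dk ?p * u1 * (?c * E ?s x y) * v1) = ?c * (DM [y] [x] \<odot> 1)"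
      using pt_left[OF Zc[OF xy]] slide_E[OF assms(1-6) xy] by simp
    moreover have "pt ?s (dk ?s * (?c * E ?s x y)) = ?c * (DM [y] [x] \<odot> 1)"
      by (simp only: comm_left[OF 1(3)] pt_left[OF cs[OF xy]] pt_dk_E[OF xy])
    ultimately show "pt ?p (dk ?p * u1 * (?c * E ?s x y) * v1) = pt ?s (dk ?s * (?c * E ?s x y))" by simp
  qed
  also have "\<dots> = pt ?s (dk ?s * Z)"
    by (subst (2) cf_expand[of Z ?s]) (simp only: sum_distrib_left pt_sum)
  finally show ?thesis .
qed

lemma dk_cyc: "pt k (dk k * Z) = pt k (Z * dk k)"
  unfolding dk_eq by (simp add: sum_distrib_left sum_distrib_right pt_sum pt_sm pt_cyc_E)

text \<open>Let Q be Psi with its two legs exchanged. Then \<open>ri1 * dk ?p = dk ?s * Q\<close>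
  and \<open>dk ?p * ri1 = Q * dk ?s\<close>, and multiplying the first by \<open>dk ?s\<close> on
  the right and the second on the left gives the same element.\<close>

lemma dk_dk_r:
  assumes ri: "locat {k, Suc k} ri0" "locat {Suc k, Suc (Suc k)} ri1"
    and inv: "r k * ri0 = 1" "ri0 * r k = 1" "r (Suc k) * ri1 = 1" "ri1 * r (Suc k) = 1"
    and braid: "r k * r (Suc k) * r k = r (Suc k) * r k * r (Suc k)"
  shows "dk (Suc k) * dk (Suc (Suc k)) * ri1 = ri1 * (dk (Suc k) * dk (Suc (Suc k)))"
proof -
  let ?p = "Suc (Suc k)" and ?s = "Suc k"
  let ?r0 = "r k" and ?r1 = "r ?s"
  \<comment> \<open>The braid relation in the two forms required by \<open>slide_E\<close>, with r
    and with its inverse as conjugating element.\<close>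
  have rel1: "?r1 * ?r0 * ri1 = ri0 * ?r1 * ?r0"
  proof -
    have "ri0 * (?r0 * ?r1 * ?r0) * ri1 = ri0 * (?r1 * ?r0 * ?r1) * ri1" by (simp only: braid)
    then have "(ri0 * ?r0) * (?r1 * ?r0 * ri1) = ri0 * ?r1 * ?r0 * (?r1 * ri1)" by (simp only: mult.assoc)
    then show ?thesis using inv by simp
  qed
  have rel2: "ri1 * ?r0 * ?r1 = ?r0 * ?r1 * ri0"
  proof -
    have "ri1 * (?r0 * ?r1 * ?r0) * ri0 = ri1 * (?r1 * ?r0 * ?r1) * ri0" by (simp only: braid)
    then have "ri1 * ?r0 * ?r1 * (?r0 * ri0) = (ri1 * ?r1) * (?r0 * ?r1 * ri0)" by (simp only: mult.assoc)
    then show ?thesis using inv by simp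
  qed
  have r0: "locat {k, ?s} ?r0" and r1: "locat {?s, ?p} ?r1" by (rule r_locat)+
  define T T' where "T = ri1 * dk ?p" and "T' = dk ?p * ri1"
  \<comment> \<open>The second leg of Psi is put on strand k + 1; Q below adds the first leg on
    strand k + 2.\<close>
  define P where "P i j = (\<Sum>c<N. \<Sum>a<N. Psi [i, c] [j, a] \<odot> E ?s c a)" for i j
  have T: "cf ?p i j T = dk ?s * P i j" if ij: "i < N" "j < N" for i j
  proof -
    have A: "(\<Sum>a<N. \<Sum>b<N. \<Sum>d<N. R [a, b] [x, d] \<odot> (E ?s a y * cf ?p d b T)) = DM [y] [x] \<odot> 1"
      if "x < N" "y < N" for x y
    proof -
      have "DM [y] [x] \<odot> 1 = pt ?p (dk ?p * (?r1 * E ?s x y * ri1))"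
        using slide_E[OF r0 ri(1) r1 ri(2) inv(2) rel1 that] by (simp add: mult.assoc)
      also have "\<dots> = pt ?p ((?r1 * E ?s x y) * T)" unfolding dk_cyc T_def by (simp add: mult.assoc)
      also have "?r1 * E ?s x y = (\<Sum>a<N. \<Sum>b<N. \<Sum>c<N. \<Sum>d<N. if c = x then R [a, b] [x, d] \<odot> (E ?s a y * E ?p b d) else 0)"
        unfolding r_eq sum_distrib_right
      proof (intro sum.cong refl)
        fix a b c d assume i: "a \<in> {..<N}" "b \<in> {..<N}" "c \<in> {..<N}" "d \<in> {..<N}"
        have "E ?s a c * E ?p b d * E ?s x y = E ?s a c * E ?s x y * E ?p b d"
          using E_comm[of ?p ?s b d x y] i that by (simp add: mult.assoc)
        then show "R [a, b] [c, d] \<odot> (E ?s a c * E ?p b d) * E ?s x y = (if c = x then R [a, b] [x, d] \<odot> (E ?s a y * E ?p b d) else 0)"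
          using i that by (simp add: E_mult)
      qed
      also have "\<dots> = (\<Sum>a<N. \<Sum>b<N. \<Sum>c<N. if c = x then (\<Sum>d<N. R [a, b] [x, d] \<odot> (E ?s a y * E ?p b d)) else 0)"
        by (rule sum.cong, rule refl, rule sum.cong, rule refl, rule sum.cong, rule refl) auto
      also have "\<dots> = (\<Sum>a<N. \<Sum>b<N. \<Sum>d<N. R [a, b] [x, d] \<odot> (E ?s a y * E ?p b d))" using that by simp
      also have "pt ?p (\<dots> * T) = (\<Sum>a<N. \<Sum>b<N. \<Sum>d<N. R [a, b] [x, d] \<odot> (E ?s a y * cf ?p d b T))"
        unfolding sum_distrib_right pt_sum
      proof (intro sum.cong refl)
        fix a b d assume i: "a \<in> {..<N}" "b \<in> {..<N}" "d \<in> {..<N}"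
        show "pt ?p (R [a, b] [x, d] \<odot> (E ?s a y * E ?p b d) * T) = R [a, b] [x, d] \<odot> (E ?s a y * cf ?p d b T)"
          using i that by (simp add: pt_sm mult.assoc pt_left cE_E pt_E_left)
      qed
      finally show ?thesis ..
    qed
    \<comment> \<open>The coefficients of T may still involve strand k + 1, so the system is solved
      for their products with \<open>E ?s z y\<close>; taking z = y and summing over y recovers the
      coefficients.\<close>
    have B: "(\<Sum>b<N. \<Sum>d<N. R [a', b] [x, d] \<odot> (E ?s z y * cf ?p d b T)) = DM [y] [x] \<odot> E ?s z a'"
      if "x < N" "y < N" "z < N" "a' < N" for x y z a'
    proof -
      have "DM [y] [x] \<odot> E ?s z a' = E ?s z a' * (\<Sum>a<N. \<Sum>b<N. \<Sum>d<N. R [a, b] [x, d] \<odot> (E ?s a y * cf ?p d b T))"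
        using A that by simp
      also have "\<dots> = (\<Sum>a<N. if a = a' then (\<Sum>b<N. \<Sum>d<N. R [a, b] [x, d] \<odot> (E ?s z y * cf ?p d b T)) else 0)"
        unfolding sum_distrib_left
      proof (rule sum.cong, rule refl)
        fix a assume "a \<in> {..<N}"
        then show "(\<Sum>b<N. \<Sum>d<N. E ?s z a' * R [a, b] [x, d] \<odot> (E ?s a y * cf ?p d b T)) =
          (if a = a' then (\<Sum>b<N. \<Sum>d<N. R [a, b] [x, d] \<odot> (E ?s z y * cf ?p d b T)) else 0)"
          using that by (simp add: mult.assoc[symmetric] E_mult)
      qed
      finally show ?thesis using that by simp
    qed
    have "cf ?p i j T = (\<Sum>y<N. E ?s y y) * cf ?p i j T" by (simp add: E_sum)
    also have "\<dots> = (\<Sum>y<N. E ?s y y * cf ?p i j T)" by (rule sum_distrib_right)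
    also have "\<dots> = (\<Sum>y<N. \<Sum>c<N. \<Sum>a<N. Psi [i, c] [j, a] \<odot> DM [y] [c] \<odot> E ?s y a)"
    proof (rule sum.cong, rule refl)
      fix y assume y: "y \<in> {..<N}"
      show "E ?s y y * cf ?p i j T = (\<Sum>c<N. \<Sum>a<N. Psi [i, c] [j, a] \<odot> DM [y] [c] \<odot> E ?s y a)"
        using psi_invert[of "\<lambda>b d. E ?s y y * cf ?p d b T" "\<lambda>a c. DM [y] [c] \<odot> E ?s y a" i j] B y ij by simp
    qed
    also have "\<dots> = (\<Sum>c<N. \<Sum>y<N. \<Sum>a<N. Psi [i, c] [j, a] \<odot> DM [y] [c] \<odot> E ?s y a)" by (rule sum.swap)
    also have "\<dots> = (\<Sum>c<N. \<Sum>a<N. \<Sum>y<N. Psi [i, c] [j, a] \<odot> DM [y] [c] \<odot> E ?s y a)"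
      by (rule sum.cong, rule refl, rule sum.swap)
    also have "\<dots> = dk ?s * P i j"
      unfolding P_def sum_distrib_left by (intro sum.cong refl) (simp add: dk_E sm_sum_right)
    finally show ?thesis .
  qed
  have T': "cf ?p i j T' = P i j * dk ?s" if ij: "i < N" "j < N" for i j
  proof -
    have A: "(\<Sum>c<N. \<Sum>b<N. \<Sum>d<N. R [y, b] [c, d] \<odot> (cf ?p d b T' * E ?s x c)) = DM [y] [x] \<odot> 1"
      if "x < N" "y < N" for x y
    proof -
      have "DM [y] [x] \<odot> 1 = pt ?p (T' * (E ?s x y * ?r1))"
        using slide_E[OF ri(1) r0 ri(2) r1 inv(1) rel2 that] by (simp add: T'_def mult.assoc)
      also have "E ?s x y * ?r1 = (\<Sum>a<N. \<Sum>b<N. \<Sum>c<N. \<Sum>d<N. if y = a then R [a, b] [c, d] \<odot> (E ?s x c * E ?p b d) else 0)"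
        unfolding r_eq sum_distrib_left
        by (intro sum.cong refl) (use that in \<open>simp add: mult.assoc[symmetric] E_mult\<close>)
      also have "\<dots> = (\<Sum>a<N. if y = a then (\<Sum>b<N. \<Sum>c<N. \<Sum>d<N. R [a, b] [c, d] \<odot> (E ?s x c * E ?p b d)) else 0)"
        by (rule sum.cong, rule refl) auto
      also have "\<dots> = (\<Sum>b<N. \<Sum>c<N. \<Sum>d<N. R [y, b] [c, d] \<odot> (E ?s x c * E ?p b d))" using that by simp
      also have "\<dots> = (\<Sum>c<N. \<Sum>b<N. \<Sum>d<N. R [y, b] [c, d] \<odot> (E ?s x c * E ?p b d))" by (rule sum.swap)
      also have "pt ?p (T' * \<dots>) = (\<Sum>c<N. \<Sum>b<N. \<Sum>d<N. R [y, b] [c, d] \<odot> (cf ?p d b T' * E ?s x c))"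
        unfolding sum_distrib_left pt_sum
      proof (intro sum.cong refl)
        fix b c d assume i: "b \<in> {..<N}" "c \<in> {..<N}" "d \<in> {..<N}"
        have "pt ?p (T' * (E ?s x c * E ?p b d)) = pt ?p ((T' * E ?p b d) * E ?s x c)"
          using E_comm[of ?s ?p x c b d] i that by (simp add: mult.assoc)
        also have "\<dots> = pt ?p (T' * E ?p b d) * E ?s x c" by (rule pt_right) (use i that in \<open>auto intro!: cE_E\<close>)
        also have "pt ?p (T' * E ?p b d) = cf ?p d b T'"
          using pt_cyc_E[of b d ?p T'] pt_E_left[of b d ?p T'] i by simp
        finally show "pt ?p (T' * R [y, b] [c, d] \<odot> (E ?s x c * E ?p b d)) = R [y, b] [c, d] \<odot> (cf ?p d b T' * E ?s x c)"
          by (simp add: pt_sm)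
      qed
      finally show ?thesis ..
    qed
    have B: "(\<Sum>b<N. \<Sum>d<N. R [y, b] [c', d] \<odot> (cf ?p d b T' * E ?s x z)) = DM [y] [x] \<odot> E ?s c' z"
      if "x < N" "y < N" "z < N" "c' < N" for x y z c'
    proof -
      have "DM [y] [x] \<odot> E ?s c' z = (\<Sum>c<N. \<Sum>b<N. \<Sum>d<N. R [y, b] [c, d] \<odot> (cf ?p d b T' * E ?s x c)) * E ?s c' z"
        using A that by simp
      also have "\<dots> = (\<Sum>c<N. if c = c' then (\<Sum>b<N. \<Sum>d<N. R [y, b] [c, d] \<odot> (cf ?p d b T' * E ?s x z)) else 0)"
        unfolding sum_distrib_right
      proof (rule sum.cong, rule refl)
        fix c assume "c \<in> {..<N}"
        then show "(\<Sum>b<N. \<Sum>d<N. R [y, b] [c, d] \<odot> (cf ?p d b T' * E ?s x c) * E ?s c' z) =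
          (if c = c' then (\<Sum>b<N. \<Sum>d<N. R [y, b] [c, d] \<odot> (cf ?p d b T' * E ?s x z)) else 0)"
          using that by (simp add: mult.assoc E_mult)
      qed
      finally show ?thesis using that by simp
    qed
    have "cf ?p i j T' = cf ?p i j T' * (\<Sum>x<N. E ?s x x)" by (simp add: E_sum)
    also have "\<dots> = (\<Sum>x<N. cf ?p i j T' * E ?s x x)" by (rule sum_distrib_left)
    also have "\<dots> = (\<Sum>x<N. \<Sum>c<N. \<Sum>y<N. Psi [i, c] [j, y] \<odot> DM [y] [x] \<odot> E ?s c x)"
    proof (rule sum.cong, rule refl)
      fix x assume x: "x \<in> {..<N}"
      show "cf ?p i j T' * E ?s x x = (\<Sum>c<N. \<Sum>y<N. Psi [i, c] [j, y] \<odot> DM [y] [x] \<odot> E ?s c x)"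
        using psi_invert[of "\<lambda>b d. cf ?p d b T' * E ?s x x" "\<lambda>y c. DM [y] [x] \<odot> E ?s c x" i j] B x ij by simp
    qed
    also have "\<dots> = (\<Sum>c<N. \<Sum>x<N. \<Sum>y<N. Psi [i, c] [j, y] \<odot> DM [y] [x] \<odot> E ?s c x)" by (rule sum.swap)
    also have "\<dots> = (\<Sum>c<N. \<Sum>y<N. \<Sum>x<N. Psi [i, c] [j, y] \<odot> DM [y] [x] \<odot> E ?s c x)"
      by (rule sum.cong, rule refl, rule sum.swap)
    also have "\<dots> = P i j * dk ?s"
      unfolding P_def sum_distrib_right by (intro sum.cong refl) (simp add: E_dk sm_sum_right)
    finally show ?thesis .
  qed
  define Q where "Q = (\<Sum>i<N. \<Sum>j<N. P i j * E ?p i j)"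
  have TQ: "T = dk ?s * Q"
    by (subst cf_expand[of T ?p]) (simp add: T Q_def sum_distrib_left mult.assoc)
  have T'Q: "T' = Q * dk ?s"
  proof -
    have c: "E ?p i j * dk ?s = dk ?s * E ?p i j" if "i < N" "j < N" for i j
      by (rule locat_comm[OF dk_locat]) (use that in \<open>auto intro!: cE_E\<close>)
    show ?thesis
      by (subst cf_expand[of T' ?p]) (simp add: T' Q_def sum_distrib_right mult.assoc c)
  qed
  have dd: "dk ?p * dk ?s = dk ?s * dk ?p"
    by (rule locat_comm[OF dk_locat]) (auto intro!: locat_cE[OF dk_locat])
  have "ri1 * (dk ?s * dk ?p) = T * dk ?s" by (simp add: T_def mult.assoc dd)
  also have "\<dots> = dk ?s * T'" by (simp add: TQ T'Q mult.assoc)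
  also have "\<dots> = dk ?s * dk ?p * ri1" by (simp add: T'_def mult.assoc)
  finally show ?thesis ..
qed

end

section \<open>The characteristic map\<close>

lemma opinv: assumes "op_invertible N n X"
  shows "op_eq N n (mmul N n X (opinv N n X)) idop" "op_eq N n (mmul N n (opinv N n X) X) idop"
  using someI_ex[OF assms[unfolded op_invertible_def]] by (simp_all add: opinv_def)

locale quantum_matrix_algebra = skew_R sw N E io sc R Psi
  for sw :: "complex \<Rightarrow> 'e::ring_1" and N E and io :: "'a::ring_1 \<Rightarrow> 'e" and sc R Psi +
  fixes F :: "complex op" and M :: "nat \<Rightarrow> nat \<Rightarrow> 'a" and q \<mu> :: complex
  assumes q: "q \<noteq> 0" "q \<noteq> 1" "q \<noteq> -1" and mu: "\<mu> \<noteq> 0" "\<mu> \<noteq> q" "\<mu> \<noteq> - (1/q)"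
    and R_matrix: "R_matrix N R" and F_matrix: "R_matrix N F" and BMW: "BMW_type N q \<mu> R"
    and comp: "compatible_pair N R F" and rel: "QMA_rel N sc R F M"
begin

definition ri :: "nat \<Rightarrow> 'e" where "ri k = C k 2 (opinv N 2 R)"
definition f :: "nat \<Rightarrow> 'e" where "f k = C k 2 F"
definition fi :: "nat \<Rightarrow> 'e" where "fi k = C k 2 (opinv N 2 F)"
definition kk :: "nat \<Rightarrow> 'e" where "kk k = C k 2 (Kop N q \<mu> R)"

lemma inverses: "r k * ri k = 1" "ri k * r k = 1" "f k * fi k = 1" "fi k * f k = 1"
proof -
  have R: "op_invertible N 2 R" and F: "op_invertible N 2 F"
    using R_matrix F_matrix by (auto simp: R_matrix_def)
  show "r k * ri k = 1" "ri k * r k = 1" "f k * fi k = 1" "fi k * f k = 1"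
    using opinv[OF R, THEN C_cong[of 2 _ _ k]] opinv[OF F, THEN C_cong[of 2 _ _ k]]
    by (simp_all add: C_mmul C_idop r_def ri_def f_def fi_def)
qed

lemma inverses_left: "r k * (ri k * x) = x" "ri k * (r k * x) = x" "f k * (fi k * x) = x" "fi k * (f k * x) = x"
  by (simp_all add: inverses mult.assoc[symmetric])

lemma C_3: "C k 3 (at2 3 (Suc 0) X) = C k 2 X" "C k 3 (at2 3 2 X) = C (Suc k) 2 X"
  by (simp_all add: C_at2)

lemma r_braid: "r k * r (Suc k) * r k = r (Suc k) * r k * r (Suc k)"
  using R_matrix[unfolded R_matrix_def, THEN conjunct2, THEN C_cong, of k]
  by (simp add: C_mmul C_3 r_def mult.assoc)

lemma f_braid: "f k * f (Suc k) * f k = f (Suc k) * f k * f (Suc k)"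
  using F_matrix[unfolded R_matrix_def, THEN conjunct2, THEN C_cong, of k]
  by (simp add: C_mmul C_3 f_def mult.assoc)

lemma rff: "r k * (f (Suc k) * f k) = f (Suc k) * f k * r (Suc k)"
  and rff': "r (Suc k) * (f k * f (Suc k)) = f k * f (Suc k) * r k"
  using comp[unfolded compatible_pair_def, THEN conjunct1, THEN C_cong, of k]
    comp[unfolded compatible_pair_def, THEN conjunct2, THEN C_cong, of k]
  by (simp_all add: C_mprod C_3 f_def r_def mult.assoc)

lemma C_2_locat: "locat {k, Suc k} (C k 2 X)"
  using C_locat[of k 2 X] by (simp add: numeral_2_eq_2 atLeastLessThanSuc insert_commute)

lemma locats: "locat {k, Suc k} (r k)" "locat {k, Suc k} (ri k)" "locat {k, Suc k} (f k)" "locat {k, Suc k} (fi k)"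
  "locat {k, Suc k} (kk k)"
  unfolding r_def ri_def f_def fi_def kk_def by (rule C_2_locat)+

lemma kk_eq: "kk k = (1 / (\<mu> * (q - 1/q))) \<odot> ((q \<odot> 1 - r k) * ((1/q) \<odot> 1 + r k))"
  by (simp add: kk_def Kop_def C_osmul C_mmul C_oadd C_idop r_def)

lemma lam_nz: "q - 1/q \<noteq> 0"
proof
  assume "q - 1/q = 0"
  then have "q * q = 1 * 1" using q by (simp add: field_simps)
  then show False using q by (metis square_eq_iff)
qed

lemma r_quad: "r k * r k = 1 + (q - 1/q) \<odot> r k - ((q - 1/q) * \<mu>) \<odot> kk k"
proof -
  have "((q - 1/q) * \<mu>) \<odot> kk k = (q \<odot> 1 - r k) * ((1/q) \<odot> 1 + r k)"
    using mu lam_nz by (simp add: kk_eq)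
  also have "\<dots> = 1 + (q - 1/q) \<odot> r k - r k * r k"
    using q by (simp add: distrib_left left_diff_distrib sm_diff_right sm_diff_left)
  finally show ?thesis by simp
qed

lemma kk_r: "kk k * r k = \<mu> \<odot> kk k"
proof -
  have "C k 2 (mprod N 2 [oadd (osmul q idop) (osmul (-1) R), oadd (osmul (1/q) idop) R,
                           oadd (osmul \<mu> idop) (osmul (-1) R)]) = C k 2 (\<lambda>I J. 0)"
    using BMW by (intro C_cong) (simp add: BMW_type_def)
  then have "(q \<odot> 1 - r k) * ((1/q) \<odot> 1 + r k) * (\<mu> \<odot> 1 - r k) = 0"
    by (simp add: C_mprod C_0 C_oadd C_osmul C_idop r_def mult.assoc)
  then have "kk k * (\<mu> \<odot> 1 - r k) = 0" by (simp add: kk_eq)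
  then show ?thesis by (simp add: right_diff_distrib)
qed

lemma r_kk: "r k * kk k = \<mu> \<odot> kk k"
proof -
  have "r k * kk k = kk k * r k"
    by (simp add: kk_eq distrib_left distrib_right left_diff_distrib right_diff_distrib mult.assoc)
  then show ?thesis by (simp add: kk_r)
qed

lemma kk_rels: "kk (Suc k) * kk k = r k * r (Suc k) * kk k" "kk (Suc k) * kk k = ri k * ri (Suc k) * kk k"
  "kk k * kk (Suc k) * kk k = kk k"
proof -
  have "op_eq N 3 (mmul N 3 (at2 3 2 (Kop N q \<mu> R)) (at2 3 1 (Kop N q \<mu> R))) (mprod N 3 [at2 3 1 R, at2 3 2 R, at2 3 1 (Kop N q \<mu> R)])"
    "op_eq N 3 (mmul N 3 (at2 3 2 (Kop N q \<mu> R)) (at2 3 1 (Kop N q \<mu> R))) (mprod N 3 [at2 3 1 (opinv N 2 R), at2 3 2 (opinv N 2 R), at2 3 1 (Kop N q \<mu> R)])"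
    "op_eq N 3 (mprod N 3 [at2 3 1 (Kop N q \<mu> R), at2 3 2 (Kop N q \<mu> R), at2 3 1 (Kop N q \<mu> R)]) (at2 3 1 (Kop N q \<mu> R))"
    using BMW unfolding BMW_type_def Let_def by blast+
  note this[THEN C_cong, of k]
  then show "kk (Suc k) * kk k = r k * r (Suc k) * kk k" "kk (Suc k) * kk k = ri k * ri (Suc k) * kk k"
  "kk k * kk (Suc k) * kk k = kk k"
    by (simp_all add: C_mprod C_mmul C_3 r_def ri_def kk_def mult.assoc)
qed

section \<open>The copies of M and their exchange relations\<close>

fun mb :: "nat \<Rightarrow> 'e" where
  "mb 0 = 0"
| "mb (Suc 0) = Phi 1 1 (\<lambda>I J. M (I!0) (J!0))"
| "mb (Suc (Suc k)) = f (Suc k) * mb (Suc k) * fi (Suc k)"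

lemma Phi_Mbar: "1 \<le> k \<Longrightarrow> k \<le> n \<Longrightarrow> Phi 1 n (Mbar N sc F M n k) = mb k"
proof (induction k rule: mb.induct)
  case (3 k)
  have "Phi 1 n (cop sc (at2 n (Suc k) X)) = C (Suc k) 2 X" for X
    using C_at2[of "Suc k" n 1 X] 3 by (simp add: C_def)
  then show ?case using 3 by (simp add: Phi_mprod f_def fi_def mult.assoc)
next
  case 2
  then show ?case using Phi_at1[of 1 n 1 "\<lambda>I J. M (I!0) (J!0)"] by simp
qed simp

lemma mb_cE: "k < j \<Longrightarrow> cE j (mb k)"
proof (induction k rule: mb.induct)
  case 2 then show ?case by (simp add: Phi_cE)
next
  case (3 k)
  then show ?case by (auto intro!: cE_mult locat_cE[OF locats(3)] locat_cE[OF locats(4)])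
qed (auto intro: cE_simps)

lemma rMM_1: "r 1 * (mb 1 * mb 2) = mb 1 * mb 2 * r 1"
proof -
  have m: "Phi 1 2 (Mbar N sc F M 2 1) = mb 1" "Phi 1 2 (Mbar N sc F M 2 2) = mb 2"
    by (rule Phi_Mbar; simp)+
  have c: "Phi 1 2 (cop sc (at2 2 1 R)) = r 1" using C_at2[of 1 2 1 R] by (simp add: C_def r_def)
  show ?thesis
    using rel[unfolded QMA_rel_def, THEN Phi_cong, of 1] unfolding Phi_mprod list.map m c
    by (simp add: mult.assoc)
qed

text \<open>\<^term>\<open>hF n m\<close> carries the strand \<open>n + m\<close> over the strands \<open>n, \<dots>, n + m - 1\<close>; conjugation by it shifts
  operators on the latter by one.\<close>

definition hF :: "nat \<Rightarrow> nat \<Rightarrow> 'e" where "hF n m = prod_list (map f [n..<n + m])"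
definition hFi :: "nat \<Rightarrow> nat \<Rightarrow> 'e" where "hFi n m = prod_list (map fi (rev [n..<n + m]))"

lemma hF_0 [simp]: "hF n 0 = 1" "hFi n 0 = 1" by (simp_all add: hF_def hFi_def)
lemma hF_Suc: "hF n (Suc m) = hF n m * f (n + m)" "hFi n (Suc m) = fi (n + m) * hFi n m"
  by (simp_all add: hF_def hFi_def)
lemma hF_front: "hF n (Suc m) = f n * hF (Suc n) m"
  by (simp add: hF_def upt_conv_Cons del: upt_Suc)

lemma hF_inv: "hF n m * hFi n m = 1"
  by (induction m) (simp_all add: hF_Suc mult.assoc inverses_left)

lemma hF_locat: "locat {n..n + m} (hF n m)" "locat {n..n + m} (hFi n m)"
  unfolding hF_def hFi_def by (auto intro!: locat_prod_list locat_mono[OF locats(3)] locat_mono[OF locats(4)])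

lemma f_comm_far: "locat {k, Suc k} x \<Longrightarrow> Suc k < j \<or> Suc j < k \<Longrightarrow> f j * x = x * f j"
  by (rule locat_comm, assumption) (auto intro!: locat_cE[OF locats(3)])

lemma hF_shift: 
  assumes loc: "\<And>k. locat {k, Suc k} (x k)" and sh: "\<And>k. x (Suc k) * (f k * f (Suc k)) = f k * f (Suc k) * x k"
    and j: "n \<le> j" "Suc j < n + m"
  shows "hF n m * x j = x (Suc j) * hF n m"
  using j
proof (induction m arbitrary: n)
  case (Suc m)
  show ?case
  proof (cases "n = j")
    case True
    then obtain l where m: "m = Suc l" using Suc.prems by (cases m) auto
    have c: "hF (Suc (Suc j)) l * x j = x j * hF (Suc (Suc j)) l"
      by (rule locat_comm[OF loc]) (auto intro!: locat_cE[OF hF_locat(1)])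
    have "hF n (Suc m) * x j = f j * (f (Suc j) * (hF (Suc (Suc j)) l * x j))"
      by (simp add: True m hF_front mult.assoc)
    also have "\<dots> = (f j * f (Suc j) * x j) * hF (Suc (Suc j)) l" unfolding c by (simp add: mult.assoc)
    also have "\<dots> = x (Suc j) * (f j * f (Suc j)) * hF (Suc (Suc j)) l" by (simp only: sh)
    also have "\<dots> = x (Suc j) * hF n (Suc m)" by (simp add: True m hF_front mult.assoc)
    finally show ?thesis .
  next
    case False
    have "hF n (Suc m) * x j = f n * (hF (Suc n) m * x j)" by (simp add: hF_front mult.assoc)
    also have "hF (Suc n) m * x j = x (Suc j) * hF (Suc n) m" using Suc False by simp
    also have "f n * (x (Suc j) * hF (Suc n) m) = x (Suc j) * hF n (Suc m)"
      using f_comm_far[OF loc, of "Suc j" n] False Suc.prems by (simp add: hF_front comm_left)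
    finally show ?thesis .
  qed
qed simp

lemma hF_r: "n \<le> j \<Longrightarrow> Suc j < n + m \<Longrightarrow> hF n m * r j = r (Suc j) * hF n m"
  by (rule hF_shift[OF locats(1) rff'])

lemma hF_f: "n \<le> j \<Longrightarrow> Suc j < n + m \<Longrightarrow> hF n m * f j = f (Suc j) * hF n m"
  by (rule hF_shift[OF locats(3)]) (use f_braid in \<open>simp_all add: mult.assoc\<close>)

text \<open>For j = n the first factor \<open>f n\<close> turns \<open>mb n\<close> into
  \<open>mb (n + 1)\<close> and the others commute with \<open>mb n\<close>; larger j follow from
  \<open>hF_f\<close> and the recursion of \<open>mb\<close>.\<close>

lemma hF_mb: "1 \<le> n \<Longrightarrow> n \<le> j \<Longrightarrow> j < n + m \<Longrightarrow> hF n m * mb j = mb (Suc j) * hF n m"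
proof (induction j)
  case (Suc j)
  show ?case
  proof (cases "n = Suc j")
    case True
    then obtain l where m: "m = Suc l" using Suc.prems by (cases m) auto
    have c: "mb n * hF (Suc n) l = hF (Suc n) l * mb n"
      by (rule locat_comm[OF hF_locat(1)]) (auto intro!: mb_cE)
    have "hF n m * mb n = f n * mb n * hF (Suc n) l" by (simp add: m hF_front c mult.assoc)
    also have "\<dots> = mb (Suc n) * hF n m" by (simp add: True m hF_front mult.assoc inverses_left)
    finally show ?thesis using True by simp
  next
    case False
    then obtain i where j: "j = Suc i" using Suc.prems by (cases j) auto
    have "hF n m * f j * mb j = f (Suc j) * (mb (Suc j) * hF n m)"
      using hF_f[of n j m] Suc False by (simp add: mult.assoc)
    then have "hF n m * f j * mb j * fi j = f (Suc j) * mb (Suc j) * (hF n m * fi j)"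
      by (simp add: mult.assoc)
    also have "hF n m * fi j = fi (Suc j) * hF n m"
    proof -
      have "fi (Suc j) * (hF n m * f j) * fi j = fi (Suc j) * (f (Suc j) * hF n m) * fi j"
        using hF_f[of n j m] Suc.prems False by simp
      then show ?thesis by (simp add: mult.assoc inverses_left inverses)
    qed
    finally show ?thesis by (simp add: j mult.assoc)
  qed
qed simp

lemma r_mb_low: "j < i \<Longrightarrow> r i * mb j = mb j * r i"
  by (rule sym, rule locat_comm[OF locats(1)]) (auto intro!: mb_cE)

text \<open>The first case is \<open>mb (i + 2)\<close>, which is \<open>mb i\<close> conjugated by
  \<open>f (i + 1) * f i\<close>. By compatibility \<open>r i\<close> passes this product as
  \<open>r (i + 1)\<close>, and that commutes with \<open>mb i\<close>.\<close>

lemma r_mb_high: assumes "1 \<le> i" shows "Suc i < j \<Longrightarrow> r i * mb j = mb j * r i"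
proof (induction j)
  case (Suc j)
  then obtain l where j: "j = Suc l" by (cases j) auto
  show ?case
  proof (cases "Suc i < j")
    case True
    have f: "r i * f j = f j * r i" using f_comm_far[OF locats(1), of i j] True by simp
    have fi: "r i * fi j = fi j * r i"
      by (rule locat_comm[OF locats(4)]) (use True in \<open>auto intro!: locat_cE[OF locats(1)]\<close>)
    have "r i * (f j * mb j * fi j) = f j * mb j * fi j * r i"
      using Suc True by (intro comm_mult f fi) auto
    then show ?thesis by (simp add: j)
  next
    case False
    then have ji: "j = Suc i" using Suc by simp
    then obtain i' where i': "i = Suc i'" using assms by (cases i) auto
    have e: "mb (Suc j) = (f j * f i) * mb i * (fi i * fi j)" by (simp add: ji i' mult.assoc)
    have c: "r j * mb i = mb i * r j" by (rule r_mb_low) (simp add: ji)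
    have inv: "fi i * fi j * r i = r j * (fi i * fi j)"
    proof -
      have "fi i * (fi j * (r i * (f j * f i))) * (fi i * fi j) = fi i * (fi j * (f j * f i * r j)) * (fi i * fi j)"
        using rff[of i] ji by simp
      then show ?thesis by (simp add: mult.assoc inverses_left inverses)
    qed
    have "r i * mb (Suc j) = (r i * (f j * f i)) * mb i * (fi i * fi j)" by (simp add: e mult.assoc)
    also have "\<dots> = f j * f i * (r j * mb i) * (fi i * fi j)" using rff[of i] ji by (simp add: mult.assoc)
    also have "\<dots> = f j * f i * mb i * (r j * (fi i * fi j))" by (simp add: c mult.assoc)
    also have "\<dots> = mb (Suc j) * r i" unfolding inv[symmetric] e by (simp add: mult.assoc)
    finally show ?thesis .
  qed
qed simp

text \<open>Conjugation by \<open>hF i 2\<close> moves the defining relation of the algebra one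
  strand to the right.\<close>

lemma rMM: "1 \<le> i \<Longrightarrow> r i * (mb i * mb (Suc i)) = mb i * mb (Suc i) * r i"
proof (induction i)
  case (Suc i)
  show ?case
  proof (cases "i = 0")
    case True then show ?thesis using rMM_1 by (simp add: numeral_2_eq_2)
  next
    case False
    let ?h = "hF i 2"
    have h: "?h * r i = r (Suc i) * ?h" "?h * mb i = mb (Suc i) * ?h" "?h * mb (Suc i) = mb (Suc (Suc i)) * ?h"
      by (rule hF_r hF_mb; use False in simp)+
    have "?h * (r i * (mb i * mb (Suc i))) = r (Suc i) * (mb (Suc i) * mb (Suc (Suc i))) * ?h"
      by (intro intertwine_mult h)
    moreover have "?h * (mb i * mb (Suc i) * r i) = mb (Suc i) * mb (Suc (Suc i)) * r (Suc i) * ?h"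
      by (intro intertwine_mult h)
    ultimately have "r (Suc i) * (mb (Suc i) * mb (Suc (Suc i))) * ?h * hFi i 2 = mb (Suc i) * mb (Suc (Suc i)) * r (Suc i) * ?h * hFi i 2"
      using Suc False by simp
    then show ?thesis using hF_inv[of i 2] by (simp add: mult.assoc)
  qed
qed simp

section \<open>Shifted traces, cyclicity and multiplicativity of the characteristic map\<close>

definition DD :: "nat \<Rightarrow> nat \<Rightarrow> 'e" where "DD n m = prod_list (map dk [Suc n..<Suc (n + m)])"
definition LL :: "nat \<Rightarrow> nat \<Rightarrow> 'e" where "LL n m = prod_list (map mb [Suc n..<Suc (n + m)])"

lemma DD_Suc: "DD n (Suc m) = DD n m * dk (Suc (n + m))" and DD_0 [simp]: "DD n 0 = 1"
  by (simp_all add: DD_def)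
lemma LL_Suc: "LL n (Suc m) = LL n m * mb (Suc (n + m))" and LL_0 [simp]: "LL n 0 = 1"
  by (simp_all add: LL_def)

lemma DD_locat: "locat {Suc n..n + m} (DD n m)"
  unfolding DD_def by (auto intro!: locat_prod_list locat_mono[OF dk_locat] simp del: upt_Suc)

lemma LL_cE: "n + m < j \<Longrightarrow> cE j (LL n m)"
  unfolding LL_def by (auto intro!: cE_prod_list mb_cE simp del: upt_Suc)

lemma DD_split: "DD 0 (n + m) = DD 0 n * DD n m"
  by (induction m) (simp_all add: DD_Suc mult.assoc)

lemma LL_split: "LL 0 (n + m) = LL 0 n * LL n m"
  by (induction m) (simp_all add: LL_Suc mult.assoc)

text \<open>Compatibility of R and F gives precisely the relation between f and r that
  \<open>slide\<close> demands.\<close>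

lemma slide_f: assumes "1 \<le> j" "cE (Suc j) Z"
  shows "pt (Suc j) (dk (Suc j) * f j * Z * fi j) = pt j (dk j * Z)"
proof -
  obtain k where k: "j = Suc k" using assms by (cases j) auto
  have "f (Suc k) * r k * fi (Suc k) = fi k * r (Suc k) * f k"
  proof -
    have "fi k * (r (Suc k) * (f k * f (Suc k))) * fi (Suc k) = fi k * (f k * f (Suc k) * r k) * fi (Suc k)"
      by (simp only: rff')
    then show ?thesis by (simp add: mult.assoc inverses inverses_left)
  qed
  then show ?thesis using slide[OF locats(3) locats(4) locats(3) locats(4) inverses(4)] assms unfolding k by simp
qed

text \<open>The outermost factor \<open>f (n + m)\<close> is removed by \<open>slide_f\<close>,
  which moves the last trace from strand n + m + 1 to n + m; the rest is the induction hypothesis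
  for the partially traced z.\<close>

lemma trace_shift:
  "1 \<le> n \<Longrightarrow> (\<And>k. n + m \<le> k \<Longrightarrow> cE k z) \<Longrightarrow> trs n m (DD n m * (hF n m * z * hFi n m)) = trs (n - 1) m (DD (n - 1) m * z)"
proof (induction m arbitrary: z)
  case (Suc m)
  let ?j = "n + m"
  have c: "hF n m * dk (Suc ?j) = dk (Suc ?j) * hF n m"
    by (rule locat_comm[OF dk_locat]) (auto intro!: locat_cE[OF hF_locat(1)])
  have z: "cE (Suc ?j) z" using Suc.prems by simp
  have "DD n (Suc m) * (hF n (Suc m) * z * hFi n (Suc m)) = DD n m * hF n m * (dk (Suc ?j) * f ?j * z * fi ?j) * hFi n m"
    by (simp add: DD_Suc hF_Suc mult.assoc comm_left[OF c])
  then have "pt (Suc ?j) (DD n (Suc m) * (hF n (Suc m) * z * hFi n (Suc m)))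
     = DD n m * hF n m * pt (Suc ?j) (dk (Suc ?j) * f ?j * z * fi ?j) * hFi n m"
    by (simp, subst pt_right, intro locat_cE[OF hF_locat(2)], simp, subst pt_left,
        auto intro!: cE_mult locat_cE[OF hF_locat(1)] locat_cE[OF DD_locat])
  also have "pt (Suc ?j) (dk (Suc ?j) * f ?j * z * fi ?j) = pt ?j (dk ?j * z)"
    using slide_f[of ?j z] Suc.prems z by simp
  finally have "trs n (Suc m) (DD n (Suc m) * (hF n (Suc m) * z * hFi n (Suc m))) = trs n m (DD n m * (hF n m * pt ?j (dk ?j * z) * hFi n m))"
    by (simp add: mult.assoc)
  also have "\<dots> = trs (n - 1) m (DD (n - 1) m * pt ?j (dk ?j * z))"
  proof (rule Suc.IH)
    fix k assume k: "n + m \<le> k"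
    show "cE k (pt ?j (dk ?j * z))"
    proof (cases "k = ?j")
      case True then show ?thesis using pt_cE_self by simp
    next
      case False
      then have "cE k z" "cE k (dk ?j)" using Suc.prems(2)[of k] k by (auto intro!: locat_cE[OF dk_locat])
      then show ?thesis using False by (intro pt_cE cE_mult)
    qed
  qed (use Suc.prems in simp)
  also have "\<dots> = trs (n - 1) (Suc m) (DD (n - 1) (Suc m) * z)"
  proof -
    have "Suc (n - 1 + m) = ?j" using Suc.prems by simp
    moreover have "pt ?j (DD (n - 1) m * (dk ?j * z)) = DD (n - 1) m * pt ?j (dk ?j * z)"
      by (rule pt_left, rule locat_cE[OF DD_locat]) (use Suc.prems in auto)
    ultimately show ?thesis by (simp add: DD_Suc mult.assoc)
  qed
  finally show ?case .
qed simp

definition chE :: "nat \<Rightarrow> 'e \<Rightarrow> 'e" where "chE n X = trs 0 n (DD 0 n * LL 0 n * X)"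

text \<open>The premise ties the Psi chosen inside \<open>Dop\<close> to the Psi fixed by the
  locale.\<close>

lemma io_chX: "Dop N R = DM \<Longrightarrow> io (chX N sc R F M n X) = chE n (C 1 n X)"
proof -
  assume D: "Dop N R = DM"
  have 1: "Phi 1 n (cop sc (mprod N n (map (\<lambda>k. at1 n k DM) [1..<n+1]))) = DD 0 n"
  proof -
    have "C 1 n (mprod N n (map (\<lambda>k. at1 n k DM) [1..<n+1])) = prod_list (map (\<lambda>k. C 1 n (at1 n k DM)) [1..<n+1])"
      by (simp add: C_mprod comp_def del: upt_Suc)
    also have "map (\<lambda>k. C 1 n (at1 n k DM)) [1..<n+1] = map dk [1..<n+1]"
      by (rule map_cong) (auto simp: C_at1 dk_def)
    finally show ?thesis by (simp add: C_def DD_def)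
  qed
  have 2: "Phi 1 n (mprod N n (map (Mbar N sc F M n) [1..<n+1])) = LL 0 n"
  proof -
    have "map (\<lambda>k. Phi 1 n (Mbar N sc F M n k)) [1..<n+1] = map mb [1..<n+1]"
      by (rule map_cong) (auto simp: Phi_Mbar[unfolded One_nat_def])
    then show ?thesis by (simp only: Phi_mprod map_map comp_def) (simp add: LL_def del: upt_Suc)
  qed
  show ?thesis unfolding chX_def D trs_Phi[symmetric] chE_def Phi_mult 1 2 C_def by (simp add: mult.assoc)
qed

lemma DD_r: assumes "1 \<le> i" "i < n" shows "DD 0 n * r i = r i * DD 0 n"
proof -
  obtain k where k: "i = Suc k" using assms by (cases i) auto
  have dd: "(dk i * dk (Suc i)) * r i = r i * (dk i * dk (Suc i))"
  proof -
    have "dk i * dk (Suc i) * ri i = ri i * (dk i * dk (Suc i))"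
      unfolding k by (rule dk_dk_r[OF locats(2) locats(2) inverses(1,2) inverses(1,2) r_braid])
    then have "r i * (dk i * dk (Suc i) * ri i) * r i = r i * (ri i * (dk i * dk (Suc i))) * r i" by simp
    then show ?thesis by (simp add: mult.assoc inverses inverses_left)
  qed
  have "n = k + 2 + (n - Suc (Suc k))" using assms k by simp
  then have "DD 0 n = DD 0 (k + 2 + (n - Suc (Suc k)))" by (rule arg_cong)
  also have "\<dots> = DD 0 k * (dk i * dk (Suc i)) * DD (Suc i) (n - Suc i)"
    unfolding DD_split by (simp add: k DD_Suc numeral_2_eq_2 mult.assoc)
  finally have e: "DD 0 n = DD 0 k * (dk i * dk (Suc i)) * DD (Suc i) (n - Suc i)" .
  have 1: "r i * DD 0 k = DD 0 k * r i"
    by (rule locat_comm[OF DD_locat]) (auto intro!: locat_cE[OF locats(1)] simp: k)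
  have 2: "r i * DD (Suc i) (n - Suc i) = DD (Suc i) (n - Suc i) * r i"
    by (rule locat_comm[OF DD_locat]) (auto intro!: locat_cE[OF locats(1)])
  show ?thesis unfolding e by (rule sym, intro comm_mult 1 2 dd[symmetric])
qed

lemma LL_r_far: "1 \<le> i \<Longrightarrow> i < n \<Longrightarrow> r i * LL n m = LL n m * r i"
  by (induction m) (simp_all add: LL_Suc comm_mult r_mb_high)

lemma LL_r_low: "n < i \<Longrightarrow> r i * LL 0 n = LL 0 n * r i"
  by (induction n) (simp_all add: LL_Suc comm_mult r_mb_low)

lemma LL_r: assumes "1 \<le> i" "i < n" shows "LL 0 n * r i = r i * LL 0 n"
proof -
  obtain k where k: "i = Suc k" using assms by (cases i) auto
  have "n = k + 2 + (n - Suc (Suc k))" using assms k by simp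
  then have "LL 0 n = LL 0 (k + 2 + (n - Suc (Suc k)))" by (rule arg_cong)
  also have "\<dots> = LL 0 k * (mb i * mb (Suc i)) * LL (Suc i) (n - Suc i)"
    unfolding LL_split by (simp add: k LL_Suc numeral_2_eq_2 mult.assoc)
  finally have e: "LL 0 n = LL 0 k * (mb i * mb (Suc i)) * LL (Suc i) (n - Suc i)" .
  show ?thesis unfolding e
    by (rule sym, intro comm_mult LL_r_low LL_r_far rMM) (use assms k in auto)
qed

text \<open>\<open>r i\<close> commutes with the product of the D's and with that of the M's, and
  its complex entries allow it to be carried round the trace.\<close>

lemma chE_r: assumes "1 \<le> i" "i < n" shows "chE n (r i * x) = chE n (x * r i)"
proof -
  have c: "cyc n (r i)" unfolding r_def using assms by (intro C_cyc) auto
  have "DD 0 n * LL 0 n * (r i * x) = r i * (DD 0 n * LL 0 n * x)"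
    by (simp add: mult.assoc comm_left[OF LL_r[OF assms]] comm_left[OF DD_r[OF assms]])
  then show ?thesis using c by (simp add: chE_def cyc_def mult.assoc)
qed

definition rword :: "nat list \<Rightarrow> 'e" where "rword js = prod_list (map r js)"

lemma rword_cE: assumes "set js \<subseteq> {1..<m}" "m < k" shows "cE k (rword js)"
  unfolding rword_def
proof (rule cE_prod_list)
  fix x assume "x \<in> set (map r js)"
  then obtain j where "j \<in> set js" "x = r j" by auto
  then show "cE k x" using assms by (auto intro!: locat_cE[OF locats(1)] simp: subset_iff)
qed

text \<open>By induction on n: conjugation by \<open>hF (n + 1) m\<close> moves the M's and the word
  one strand to the right, and \<open>trace_shift\<close> removes the conjugation from the
  trace.\<close>

lemma shifted_trace:
  assumes "set ls \<subseteq> {1..<m}"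
  shows "trs n m (DD n m * (LL n m * rword (map (\<lambda>l. l + n) ls))) = chE m (rword ls)"
proof (induction n)
  case 0 then show ?case by (simp add: chE_def mult.assoc)
next
  case (Suc n)
  let ?h = "hF (Suc n) m" and ?hi = "hFi (Suc n) m"
  let ?z = "LL n m * rword (map (\<lambda>l. l + n) ls)"
  have L: "?h * LL n k = LL (Suc n) k * ?h" if "k \<le> m" for k
    using that
  proof (induction k)
    case (Suc k)
    have "?h * LL n (Suc k) = LL (Suc n) k * (?h * mb (Suc (n + k)))"
      using Suc by (simp add: LL_Suc mult.assoc[symmetric])
    also have "?h * mb (Suc (n + k)) = mb (Suc (Suc (n + k))) * ?h" using Suc by (intro hF_mb) auto
    finally show ?case by (simp add: LL_Suc mult.assoc)
  qed simp
  have W: "?h * rword (map (\<lambda>l. l + n) ls) = rword (map (\<lambda>l. l + Suc n) ls) * ?h"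
    using assms
  proof (induction ls)
    case (Cons l ls)
    have "?h * r (l + n) = r (Suc (l + n)) * ?h" using Cons.prems by (intro hF_r) auto
    then have "?h * (r (l + n) * rword (map (\<lambda>l. l + n) ls)) = r (Suc (l + n)) * (?h * rword (map (\<lambda>l. l + n) ls))"
      by (simp add: mult.assoc[symmetric])
    then show ?case using Cons by (simp add: rword_def mult.assoc)
  qed (simp add: rword_def)
  have "?h * ?z = LL (Suc n) m * rword (map (\<lambda>l. l + Suc n) ls) * ?h"
    by (simp only: mult.assoc[symmetric] L[OF order_refl]) (simp only: mult.assoc W)
  then have "?h * ?z * ?hi = LL (Suc n) m * rword (map (\<lambda>l. l + Suc n) ls)"
    using hF_inv[of "Suc n" m] by (simp add: mult.assoc)
  moreover have "trs (Suc n) m (DD (Suc n) m * (?h * ?z * ?hi)) = trs n m (DD n m * ?z)"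
  proof -
    have "cE k ?z" if "Suc n + m \<le> k" for k
      by (intro cE_mult LL_cE rword_cE[of _ "n + m"]) (use assms that in auto)
    then show ?thesis using trace_shift[of "Suc n" m ?z] by simp
  qed
  ultimately show ?case using Suc by simp
qed

text \<open>Used to pull this value out of the trace over the first n strands in
  \<open>chE_mult\<close>.\<close>

lemma chE_cE: assumes "set ls \<subseteq> {1..<m}" "1 \<le> j" shows "cE j (chE m (rword ls))"
proof (cases "j \<le> m")
  case True then show ?thesis using assms unfolding chE_def by (intro trs_cE_self) auto
next
  case False
  then show ?thesis unfolding chE_def using assms
    by (intro trs_cE cE_mult LL_cE rword_cE[OF assms(1)] locat_cE[OF DD_locat]) auto
qed

text \<open>By \<open>LL_r_far\<close> the word js commutes with the M's of higher number, so
  everything regroups into a part for the first n strands and one for the last m. The first part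
  avoids the last strands; the inner trace therefore sees only the second part, and
  \<open>shifted_trace\<close> evaluates it.\<close>

lemma chE_mult:
  assumes "set js \<subseteq> {1..<n}" "set ls \<subseteq> {1..<m}"
  shows "chE (n + m) (rword js * rword (map (\<lambda>l. l + n) ls)) = chE n (rword js) * chE m (rword ls)"
proof -
  let ?x = "rword js" and ?y = "rword (map (\<lambda>l. l + n) ls)"
  have xL: "LL n m * ?x = ?x * LL n m"
    using assms(1) by (induction js) (auto simp: rword_def intro!: comm_mult sym[OF LL_r_far])
  have DL: "DD n m * LL 0 n = LL 0 n * DD n m"
    by (rule sym, rule locat_comm[OF DD_locat]) (auto intro!: LL_cE)
  have Dx: "DD n m * ?x = ?x * DD n m"
    by (rule sym, rule locat_comm[OF DD_locat], rule rword_cE[OF assms(1)]) auto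
  have "DD 0 (n + m) * LL 0 (n + m) * (?x * ?y) = (DD 0 n * LL 0 n * ?x) * (DD n m * (LL n m * ?y))"
    unfolding DD_split LL_split by (simp add: mult.assoc comm_left[OF DL] comm_left[OF xL] comm_left[OF Dx])
  moreover have "cE k (DD 0 n * LL 0 n * ?x)" if "n < k" for k
    using assms that by (intro cE_mult LL_cE rword_cE locat_cE[OF DD_locat]) auto
  ultimately have "chE (n + m) (?x * ?y) = trs 0 n ((DD 0 n * LL 0 n * ?x) * trs n m (DD n m * (LL n m * ?y)))"
    using trs_left[of n m "DD 0 n * LL 0 n * ?x"] by (simp add: chE_def trs_split)
  also have "\<dots> = trs 0 n ((DD 0 n * LL 0 n * ?x) * chE m (rword ls))"
    by (simp add: shifted_trace[OF assms(2)])
  also have "\<dots> = chE n ?x * chE m (rword ls)"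
    unfolding chE_def[of n] by (rule trs_right) (use chE_cE[OF assms(2)] in auto)
  finally show ?thesis .
qed

sublocale B: bmw sw q \<mu> r ri kk
proof unfold_locales
  show "r i * r j = r j * r i" if "1 \<le> i" "i + 2 \<le> j" for i j
    by (rule locat_comm[OF locats(1)]) (use that in \<open>auto intro!: locat_cE[OF locats(1)]\<close>)
qed (use q mu r_braid r_quad r_kk inverses kk_rels in auto)

sublocale B: bmw_trace_dual sw q \<mu> r ri kk chE
proof unfold_locales
  show "chE (n + m) (B.word js * B.word (map (\<lambda>l. l + n) ls)) = chE n (B.word js) * chE m (B.word ls)"
    if "set js \<subseteq> {1..<n}" "set ls \<subseteq> {1..<m}" for n m js ls
    using chE_mult[OF that] by (simp add: rword_def B.word_def)
  show "chE n (x + y) = chE n x + chE n y" for n x y by (simp add: chE_def distrib_left trs_add)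
  show "chE n (c \<odot> x) = c \<odot> chE n x" for n c x by (simp add: chE_def trs_sm)
qed (use chE_r in auto)

end

section \<open>A model of the tensor algebra\<close>

text \<open>A ring containing \<open>A\<close> and commuting copies of \<open>Mat\<^sub>N\<close>: right linear operators on functions
  of infinite multi-indices \<open>I\<close>. A matrix acts on the residue of \<open>I k\<close> modulo \<open>N\<close>, the quotient being a
  multiplicity; in this way the matrix units sum up to 1 although the type does not mention \<open>N\<close>.\<close>

typedef (overloaded) 'a rlinear = "{X :: ((nat \<Rightarrow> nat) \<Rightarrow> 'a::ring_1) \<Rightarrow> (nat \<Rightarrow> nat) \<Rightarrow> 'a.
    (\<forall>f g. X (\<lambda>I. f I + g I) = (\<lambda>I. X f I + X g I)) \<and> (\<forall>f a. X (\<lambda>I. f I * a) = (\<lambda>I. X f I * a))}"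
  by (rule exI[of _ "\<lambda>f. f"]) simp

lemma rlinear_add: "Rep_rlinear X (\<lambda>I. f I + g I) = (\<lambda>I. Rep_rlinear X f I + Rep_rlinear X g I)"
  and rlinear_mult: "Rep_rlinear X (\<lambda>I. f I * a) = (\<lambda>I. Rep_rlinear X f I * a)"
  using Rep_rlinear[of X] by auto

lemma rlinear_eqI: "(\<And>f I. Rep_rlinear X f I = Rep_rlinear Y f I) \<Longrightarrow> X = Y"
  by (subst Rep_rlinear_inject[symmetric]) (auto simp: fun_eq_iff)

instantiation rlinear :: (ring_1) ring_1
begin

definition "0 = Abs_rlinear (\<lambda>f I. 0)"
definition "1 = Abs_rlinear (\<lambda>f. f)"
definition "X + Y = Abs_rlinear (\<lambda>f I. Rep_rlinear X f I + Rep_rlinear Y f I)"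
definition "X - Y = Abs_rlinear (\<lambda>f I. Rep_rlinear X f I - Rep_rlinear Y f I)"
definition "- X = Abs_rlinear (\<lambda>f I. - Rep_rlinear X f I)"
definition "X * Y = Abs_rlinear (\<lambda>f. Rep_rlinear X (Rep_rlinear Y f))"

lemma Rep_rlinear_0: "Rep_rlinear 0 f I = 0"
  unfolding zero_rlinear_def by (subst Abs_rlinear_inverse) auto
lemma Rep_rlinear_1: "Rep_rlinear 1 f = f"
  unfolding one_rlinear_def by (subst Abs_rlinear_inverse) auto
lemma Rep_rlinear_plus: "Rep_rlinear (X + Y) f I = Rep_rlinear X f I + Rep_rlinear Y f I"
  unfolding plus_rlinear_def
  by (subst Abs_rlinear_inverse) (auto simp: rlinear_add rlinear_mult algebra_simps)
lemma Rep_rlinear_minus: "Rep_rlinear (X - Y) f I = Rep_rlinear X f I - Rep_rlinear Y f I"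
  unfolding minus_rlinear_def
  by (subst Abs_rlinear_inverse) (auto simp: rlinear_add rlinear_mult algebra_simps)
lemma Rep_rlinear_uminus: "Rep_rlinear (- X) f I = - Rep_rlinear X f I"
  unfolding uminus_rlinear_def
  by (subst Abs_rlinear_inverse) (auto simp: rlinear_add rlinear_mult algebra_simps)
lemma Rep_rlinear_times: "Rep_rlinear (X * Y) f = Rep_rlinear X (Rep_rlinear Y f)"
  unfolding times_rlinear_def
  by (subst Abs_rlinear_inverse) (auto simp: rlinear_add rlinear_mult)

lemmas Rep_rlinear_simps = Rep_rlinear_0 Rep_rlinear_1 Rep_rlinear_plus Rep_rlinear_minus Rep_rlinear_uminus Rep_rlinear_times

instance
proof
  fix X Y Z :: "'a rlinear"
  have e: "Rep_rlinear (U + V) f = (\<lambda>I. Rep_rlinear U f I + Rep_rlinear V f I)" for U V :: "'a rlinear" and f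
    by (rule ext) (rule Rep_rlinear_plus)
  have z: "Rep_rlinear 0 f = (\<lambda>I. 0 :: 'a)" for f by (rule ext) (rule Rep_rlinear_0)
  show "X * Y * Z = X * (Y * Z)" by (rule rlinear_eqI) (simp add: Rep_rlinear_times)
  show "X + Y + Z = X + (Y + Z)" "X + Y = Y + X" "0 + X = X" "- X + X = 0" "X - Y = X + - Y"
    "1 * X = X" "X * 1 = X" "(X + Y) * Z = X * Z + Y * Z" 
    by (rule rlinear_eqI, simp add: Rep_rlinear_simps algebra_simps)+
  show "X * (Y + Z) = X * Y + X * Z"
    by (rule rlinear_eqI) (simp add: Rep_rlinear_times e rlinear_add)
  show "(0 :: 'a rlinear) \<noteq> 1"
  proof
    assume "(0 :: 'a rlinear) = 1"
    then have "Rep_rlinear 0 (\<lambda>I. 1 :: 'a) = Rep_rlinear 1 (\<lambda>I. 1)" by simp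
    then show False by (simp add: z Rep_rlinear_1 fun_eq_iff)
  qed
qed

end

lemma Rep_rlinear_sum: "Rep_rlinear (sum h A) f I = (\<Sum>x\<in>A. Rep_rlinear (h x) f I)"
  by (induction A rule: infinite_finite_induct) (simp_all add: Rep_rlinear_simps)

definition lmult :: "'a::ring_1 \<Rightarrow> 'a rlinear" where "lmult a = Abs_rlinear (\<lambda>f I. a * f I)"

lemma Rep_lmult: "Rep_rlinear (lmult a) f I = a * f I"
  unfolding lmult_def by (subst Abs_rlinear_inverse) (auto simp: algebra_simps)

lemma lmult_inject: assumes "lmult a = lmult b" shows "a = b"
proof -
  have "Rep_rlinear (lmult a) (\<lambda>I. 1) (\<lambda>k. 0) = Rep_rlinear (lmult b) (\<lambda>I. 1) (\<lambda>k. 0)"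
    by (simp only: assms)
  then show ?thesis by (simp add: Rep_lmult)
qed

definition munit :: "nat \<Rightarrow> nat \<Rightarrow> nat \<Rightarrow> nat \<Rightarrow> 'a::ring_1 rlinear" where
  "munit N k x y = Abs_rlinear (\<lambda>f I. if I k mod N = x then f (I(k := y + N * (I k div N))) else 0)"

lemma Rep_munit: "Rep_rlinear (munit N k x y) f I = (if I k mod N = x then f (I(k := y + N * (I k div N))) else 0)"
  unfolding munit_def by (subst Abs_rlinear_inverse) auto

lemma matrix_units_model:
  fixes sc :: "complex \<Rightarrow> 'a::ring_1"
  assumes "complex_algebra_map sc" "N > 0"
  shows "matrix_units (\<lambda>c. lmult (sc c)) N (munit N) lmult sc"
proof -
  have sc: "sc 1 = 1" "sc (x + y) = sc x + sc y" "sc (x * y) = sc x * sc y" "sc x * a = a * sc x" for x y a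
    using assms(1) unfolding complex_algebra_map_def by blast+
  have l: "lmult (1::'a) = 1" "lmult (a + b) = lmult a + lmult b" "lmult (a * b) = lmult a * lmult b" for a b :: 'a
    by (rule rlinear_eqI; simp add: Rep_lmult Rep_rlinear_simps distrib_right mult.assoc)+
  have central: "lmult (sc c) * X = X * lmult (sc c)" for c and X :: "'a rlinear"
  proof (rule rlinear_eqI)
    fix f I
    \<comment> \<open>\<open>sc c\<close> is central in A, so multiplying by it on the left is
      multiplying on the right, and right linear operators commute with that.\<close>
    have "Rep_rlinear (lmult (sc c)) f = (\<lambda>I. f I * sc c)" by (rule ext) (simp add: Rep_lmult sc(4))
    then show "Rep_rlinear (lmult (sc c) * X) f I = Rep_rlinear (X * lmult (sc c)) f I"
      by (simp add: Rep_rlinear_times rlinear_mult Rep_lmult sc(4))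
  qed
  show ?thesis
  proof unfold_locales
    show "complex_algebra_map (\<lambda>c. lmult (sc c))"
      unfolding complex_algebra_map_def by (intro conjI allI central) (simp_all only: sc(1-3) l)
    show "munit N k x y * munit N k z w = (if y = z then munit N k x w else (0 :: 'a rlinear))"
      if "x < N" "y < N" "z < N" "w < N" for k x y z w
      by (rule rlinear_eqI) (use that in \<open>auto simp: Rep_rlinear_simps Rep_munit\<close>)
    show "(\<Sum>x<N. munit N k x x) = (1 :: 'a rlinear)" for k
    proof (rule rlinear_eqI)
      fix f I
      \<comment> \<open>Since N > 0 the residue of \<open>I k\<close> is one of the x < N, so
        exactly one summand survives.\<close>
      have "Rep_rlinear (\<Sum>x<N. munit N k x x) f I = (f (I(k := I k mod N + N * (I k div N))) :: 'a)"
        using assms(2) by (simp add: Rep_rlinear_sum Rep_munit)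
      also have "I k mod N + N * (I k div N) = I k" by simp
      finally show "Rep_rlinear (\<Sum>x<N. munit N k x x) f I = (Rep_rlinear 1 f I :: 'a)"
        by (simp add: Rep_rlinear_1)
    qed
    show "munit N j x y * munit N k z w = (munit N k z w * munit N j x y :: 'a rlinear)" if "j \<noteq> k" for j k x y z w
      by (rule rlinear_eqI) (use that in \<open>auto simp: Rep_rlinear_simps Rep_munit fun_upd_twist\<close>)
    show "lmult a * munit N k x y = munit N k x y * (lmult a :: 'a rlinear)" for a k x y
      by (rule rlinear_eqI) (simp add: Rep_rlinear_simps Rep_munit Rep_lmult)
  qed (use assms l in auto)
qed

section \<open>Translation of the defined elements and conditions into the ring\<close>

context quantum_matrix_algebra
begin

lemma C_baxop: "1 \<le> i \<Longrightarrow> i < n \<Longrightarrow> C 1 n (baxop N n q \<mu> R \<alpha> x i) =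
   1 + (((x - 1) / (q - 1/q)) \<odot> r i + ((x - 1) / (\<alpha> * x + 1)) \<odot> kk i)"
  by (simp add: baxop_def C_oadd C_idop C_osmul C_at2 r_def kk_def)

lemma C_Aop: "i \<le> n \<Longrightarrow> C 1 n (Aop N n q \<mu> R i) = B.A i"
proof (induction i rule: B.A.induct)
  case (3 k)
  have "C 1 n (baxop N n q \<mu> R (q / \<mu>) ((1/q) ^ (2 * Suc k)) (Suc k)) = B.X (Suc k)"
    using 3 by (subst C_baxop) (simp_all add: B.X_def B.al_def B.be_def)
  then show ?case using 3 by (simp add: C_osmul C_mprod B.cc_def mult.assoc)
qed (simp_all add: C_idop)

lemma C_Sop: "i \<le> n \<Longrightarrow> C 1 n (Sop N n q \<mu> R i) = B.dual.A i"
proof (induction i rule: B.dual.A.induct)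
  case (3 k)
  have e: "(1 / (- (1/q))) ^ (2 * Suc k) = q ^ (2 * Suc k)" by (simp add: power_mult)
  have "C 1 n (baxop N n q \<mu> R (- 1 / (q * \<mu>)) (q ^ (2 * Suc k)) (Suc k)) = B.dual.X (Suc k)"
    using 3 unfolding B.dual.X_def B.dual.al_def B.dual.be_def e by (subst C_baxop) simp_all
  moreover have "(1/q) ^ Suc k / qnum q (Suc (Suc k)) = B.dual.cc (Suc k)"
    unfolding B.dual.cc_def B.dual_qnum by (simp add: power_minus[of "1/q"])
  ultimately show ?case using 3 by (simp add: C_osmul C_mprod mult.assoc)
qed (simp_all add: C_idop)

lemma io_a_el: "Dop N R = DM \<Longrightarrow> io (a_el N sc R F M q \<mu> i) = B.aa i"
  by (simp add: a_el_def B.aa_def io_chX C_Aop[unfolded One_nat_def])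

lemma io_s_el: "Dop N R = DM \<Longrightarrow> io (s_el N sc R F M q \<mu> i) = B.dual.aa i"
  by (simp add: s_el_def B.dual.aa_def io_chX C_Sop[unfolded One_nat_def])

lemma io_p_el: assumes "Dop N R = DM" shows "io (p_el N sc R F M i) = B.pp i"
proof -
  have "C 1 i (mprod N i (map (\<lambda>k. at2 i k R) (rev [1..<i]))) = prod_list (map (\<lambda>k. C 1 i (at2 i k R)) (rev [1..<i]))"
    by (simp only: C_mprod map_map comp_def)
  also have "map (\<lambda>k. C 1 i (at2 i k R)) (rev [1..<i]) = map r (rev [1..<i])"
    by (rule map_cong) (auto simp: C_at2 r_def)
  finally show ?thesis by (simp add: p_el_def io_chX[OF assms] B.pp_def B.tail_def B.word_def)
qed

lemma io_g_el: "Dop N R = DM \<Longrightarrow> io (g_el N sc R F M q \<mu>) = B.gg"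
  using C_at2[of 1 2 1 "Kop N q \<mu> R"]
  by (simp add: g_el_def io_mult io_chX B.gg_def sm_def sw_io eta_def B.eta'_def kk_def)

text \<open>\<open>B.dd (j - 1)\<close> is the unit q^(2j-3) times \<mu> + q^(3-2j).\<close>

lemma generic_iff: "B.generic n \<longleftrightarrow> (\<forall>j\<in>{2..n}. qnum q j \<noteq> 0 \<and> \<mu> \<noteq> - (q powi (3 - 2 * int j)))"
proof -
  have "B.dd (j - 1) = 0 \<longleftrightarrow> \<mu> = - (q powi (3 - 2 * int j))" if j: "2 \<le> j" for j
  proof -
    obtain k where k: "j = Suc k" using j by (cases j) auto
    have e: "3 - 2 * int j = 1 - int (2 * k)" by (simp add: k)
    have p: "q powi (3 - 2 * int j) = q / q ^ (2 * k)"
      unfolding e by (subst power_int_diff) (use q(1) in \<open>simp_all only: power_int_of_nat power_int_1_right simp_thms\<close>)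
    have "B.dd (j - 1) = (q ^ (2 * k) / q) * (\<mu> + q / q ^ (2 * k))"
      using q(1) by (simp add: B.dd_def k field_simps)
    then show ?thesis using q(1) unfolding p by (simp add: eq_neg_iff_add_eq_0)
  qed
  then show ?thesis unfolding B.generic_def by auto
qed

lemma dual_generic_iff: "B.dual.generic n \<longleftrightarrow> (\<forall>j\<in>{2..n}. qnum q j \<noteq> 0 \<and> \<mu> \<noteq> q powi (2 * int j - 3))"
proof -
  have "B.dual.dd (j - 1) = 0 \<longleftrightarrow> \<mu> = q powi (2 * int j - 3)" if j: "2 \<le> j" for j
  proof -
    obtain k where k: "j = Suc k" using j by (cases j) auto
    have e: "2 * int j - 3 = int (2 * k) - 1" by (simp add: k)
    have p: "q powi (2 * int j - 3) = q ^ (2 * k) / q"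
      unfolding e by (subst power_int_diff) (use q(1) in \<open>simp_all only: power_int_of_nat power_int_1_right simp_thms\<close>)
    have "B.dual.dd (j - 1) = - ((q / q ^ (2 * k)) * (\<mu> - q ^ (2 * k) / q))"
    proof -
      have "(- (1/q)) ^ (2 * k) = 1 / q ^ (2 * k)" by (simp add: power_mult power_one_over)
      then show ?thesis using q(1) unfolding B.dual.dd_def k diff_Suc_1 by (simp add: field_simps)
    qed
    then show ?thesis using q(1) unfolding p by simp
  qed
  moreover have "qnum (- (1/q)) j = 0 \<longleftrightarrow> qnum q j = 0" for j by (simp add: B.dual_qnum)
  ultimately show ?thesis unfolding B.dual.generic_def by auto
qed

lemma io_power: "io (x ^ n) = io x ^ n"
  by (induction n) (simp_all add: io_mult)

lemma io_diff: "io (a - b) = io a - io b"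
  using io_add[of "a - b" b] by (simp add: eq_diff_eq)

end

lemma otr_trivial: "1 \<le> n \<Longrightarrow> otr 0 n X = 0"
proof -
  assume "1 \<le> n"
  then have "idx 0 n = {}" by (auto simp: idx_def)
  then show ?thesis by (simp add: otr_def)
qed

theorem theorem6p1:
  fixes N :: nat and q \<mu> :: complex and R F :: "complex op"
    and sc :: "complex \<Rightarrow> 'a::ring_1" and M :: "nat \<Rightarrow> nat \<Rightarrow> 'a" and n :: nat
  assumes q: "q \<noteq> 0" "q \<noteq> 1" "q \<noteq> -1"
    and mu: "\<mu> \<noteq> 0" "\<mu> \<noteq> q" "\<mu> \<noteq> - (1/q)"
    and RR: "R_matrix N R" "strictly_skew_invertible N R" "BMW_type N q \<mu> R"
    and FF: "R_matrix N F" "strictly_skew_invertible N F"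
    and comp: "compatible_pair N R F"
    and alg: "complex_algebra_map sc"
    and rel: "QMA_rel N sc R F M"
    and n: "n \<ge> 1"
  defines "a \<equiv> a_el N sc R F M q \<mu>" and "s \<equiv> s_el N sc R F M q \<mu>"
    and "p \<equiv> p_el N sc R F M" and "g \<equiv> g_el N sc R F M q \<mu>"
  shows
   "((\<forall>j\<in>{2..n}. qnum q j \<noteq> 0 \<and> \<mu> \<noteq> - (q powi (3 - 2 * int j))) \<longrightarrow>
      (\<Sum>i<n. sc ((-q) ^ i) * a i * p (n - i)) =
        sc ((-1) ^ (n - 1) * qnum q n) * a n
        + sc ((-1) ^ n) * (\<Sum>i=1..n div 2.
             sc (\<mu> * q powi (int n - 2 * int i) - q powi (1 - int n + 2 * int i)) * a (n - 2 * i) * g ^ i))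
    \<and> ((\<forall>j\<in>{2..n}. qnum q j \<noteq> 0 \<and> \<mu> \<noteq> q powi (2 * int j - 3)) \<longrightarrow>
      (\<Sum>i<n. sc (q powi (- int i)) * s i * p (n - i)) =
        sc (qnum q n) * s n
        + (\<Sum>i=1..n div 2.
             sc (\<mu> * q powi (2 * int i - int n) + q powi (int n - 2 * int i - 1)) * s (n - 2 * i) * g ^ i))
    \<and> ((\<forall>j\<in>{2..n}. qnum q j \<noteq> 0 \<and> \<mu> \<noteq> - (q powi (3 - 2 * int j)) \<and> \<mu> \<noteq> q powi (2 * int j - 3)) \<longrightarrow>
      (\<forall>m\<le>n. (\<Sum>i=0..m. sc ((-1) ^ i) * a i * s (m - i)) =
                 (if m = 0 then 1 else 0) - (if m = 2 then g else 0)))"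
proof (cases "N = 0")
  \<comment> \<open>The model needs residues modulo a positive N. For N = 0 there are no
    multi-indices of positive length, so all elements of positive degree vanish and only the terms
    in \<open>a 0 * s 0\<close> are left.\<close>
  case True
  have z: "a i = 0" "s i = 0" "p i = 0" if "1 \<le> i" for i
    using that True by (auto simp: a_def s_def p_def a_el_def s_el_def p_el_def chX_def otr_trivial)
  have g: "g = 0" using True by (simp add: g_def g_el_def chX_def otr_trivial)
  have one: "a 0 = 1" "s 0 = 1" "sc 1 = 1" using alg by (auto simp: a_def s_def a_el_def s_el_def complex_algebra_map_def)
  have gi: "g ^ i = 0" if "1 \<le> i" for i using g that by (simp add: power_0_left)
  have "sc ((-1)^i) * a i * s (m - i) = (if i = 0 \<and> m = 0 then 1 else 0)" if "i \<le> m" for i m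
    using z(1)[of i] z(2)[of "m - i"] one that by (cases "i = 0"; cases "i = m") auto
  then have "(\<Sum>i=0..m. sc ((-1) ^ i) * a i * s (m - i)) = (\<Sum>i=0..m. if i = 0 \<and> m = 0 then 1 else 0)" for m
    by (intro sum.cong) auto
  also have "(\<Sum>i=0..m. if i = 0 \<and> m = 0 then 1 else 0) = (if m = 0 then 1 else 0 :: 'a)" for m :: nat
    by (cases "m = 0") auto
  finally show ?thesis using z gi n g by (simp add: sum.neutral)
next
  case False
  interpret matrix_units "\<lambda>c. lmult (sc c)" N "munit N" lmult sc
    using matrix_units_model[OF alg] False by simp
  have "\<exists>Psi. skew_inv_by N R Psi"
    using RR(2) by (simp add: strictly_skew_invertible_def skew_invertible_def)
  \<comment> \<open>\<open>PsiOf N R\<close> is the choice made in \<open>Dop\<close>, so the D of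
    the locale is the D of the theorem.\<close>
  then have skew: "skew_inv_by N R (PsiOf N R)" unfolding PsiOf_def by (rule someI_ex)
  interpret quantum_matrix_algebra "\<lambda>c. lmult (sc c)" N "munit N" lmult sc R "PsiOf N R" F M q \<mu>
    by unfold_locales (use skew q mu RR FF comp rel in auto)
  have D: "Dop N R = DM" by (simp add: Dop_def DM_def)
  have e: "lmult (a i) = B.aa i" "lmult (s i) = B.dual.aa i" "lmult (p i) = B.pp i" "lmult g = B.gg" for i
    unfolding a_def s_def p_def g_def by (rule io_a_el[OF D] io_s_el[OF D] io_p_el[OF D] io_g_el[OF D])+
  \<comment> \<open>Each identity is proved after applying the embedding \<open>lmult\<close> and
    pulled back by its injectivity.\<close>
  note io = io_add io_diff io_sum sm_def io_mult io_power mult.assoc e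
  show ?thesis
  proof (intro conjI impI allI)
    assume "\<forall>j\<in>{2..n}. qnum q j \<noteq> 0 \<and> \<mu> \<noteq> - (q powi (3 - 2 * int j))"
    then have gen: "B.generic n" by (simp add: generic_iff)
    have sgn: "(-1) ^ (n - 1) * qnum q n = - ((-1) ^ n * qnum q n)" using n by (cases n) auto
    show "(\<Sum>i<n. sc ((-q) ^ i) * a i * p (n - i)) =
        sc ((-1) ^ (n - 1) * qnum q n) * a n
        + sc ((-1) ^ n) * (\<Sum>i=1..n div 2.
             sc (\<mu> * q powi (int n - 2 * int i) - q powi (1 - int n + 2 * int i)) * a (n - 2 * i) * g ^ i)"
      by (rule lmult_inject, unfold sgn, insert B.Newton[OF gen, unfolded B.NN_def]) (simp only: io)
  next
    assume "\<forall>j\<in>{2..n}. qnum q j \<noteq> 0 \<and> \<mu> \<noteq> q powi (2 * int j - 3)"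
    then have gen: "B.dual.generic n" by (simp add: dual_generic_iff)
    have pw: "q powi (- int i) = (1/q) ^ i" for i by (simp add: power_int_minus power_one_over inverse_eq_divide)
    show "(\<Sum>i<n. sc (q powi (- int i)) * s i * p (n - i)) =
        sc (qnum q n) * s n
        + (\<Sum>i=1..n div 2.
             sc (\<mu> * q powi (2 * int i - int n) + q powi (int n - 2 * int i - 1)) * s (n - 2 * i) * g ^ i)"
      by (rule lmult_inject, unfold pw, insert B.dual_Newton[OF gen]) (simp only: io)
  next
    fix m assume h: "\<forall>j\<in>{2..n}. qnum q j \<noteq> 0 \<and> \<mu> \<noteq> - (q powi (3 - 2 * int j)) \<and> \<mu> \<noteq> q powi (2 * int j - 3)"
      and m: "m \<le> n"
    have gen: "B.generic n" "B.dual.generic n" using h by (auto simp: generic_iff dual_generic_iff)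
    have "lmult (\<Sum>i=0..m. sc ((-1) ^ i) * a i * s (m - i)) = (if m = 0 then 1 else 0) - (if m = 2 then B.gg else 0)"
      using B.Wronski[OF gen m] by (simp only: io atLeast0AtMost)
    also have "\<dots> = lmult ((if m = 0 then 1 else 0) - (if m = 2 then g else 0))"
      by (simp add: io_diff e)
    finally show "(\<Sum>i=0..m. sc ((-1) ^ i) * a i * s (m - i)) = (if m = 0 then 1 else 0) - (if m = 2 then g else 0)"
      by (rule lmult_inject)
  qed
qed

end
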